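(* Let $M^n$ be a closed connected smooth triangulable $n$-manifold and let $X$ be a cpx on $M$ all of whose $2$-cells are even sided. Then the holonomy $\mathrm{Hol}_{X^{(1)}}:\pi_1(X^{(1)})\to S_{n+1}$ extends uniquely to a homomorphism $\mathrm{Hol}_X:\pi_1(M)\to S_{n+1}$, i.e. there is a unique homomorphism $\mathrm{Hol}_X:\pi_1(M)\to S_{n+1}$ whose composition with the map $\pi_1(X^{(1)})\to\pi_1(M)$ induced by inclusion is $\mathrm{Hol}_{X^{(1)}}$.
   Context: A cpx $X$ on a closed connected smooth triangulable manifold $M^n$ (without boundary) is a cell complex structure on $M$ with embedded cells that is dual to a simplicial triangulation of $M$ (it is not required that two regions meet in at most one cell). It has regular degree: for $1\le k\le n$, exactly $n-k+2$ $k$-cells meet at each $(k-1)$-cell. $X^{(i)}$ is the $i$-skeleton; $n$-cells are called regions. A $2$-cell is even sided if it has an even number of edges. Holonomy on the $1$-skeleton: exactly $n+1$ regions meet at each vertex and $n$ regions at each edge. Fix a base vertex $v_0$ and a coloring of the $n+1$ regions at $v_0$ by the $n+1$ distinct colors $1,\dots,n+1$. Along an edge path in $X^{(1)}$ the coloring is transported: along an edge the $n$ regions adjacent to the edge keep their colors, and the one new region at the end vertex is assigned the unused color. Along a closed edge path based at $v_0$ the final coloring at $v_0$ differs from the initial one by a permutation in $S_{n+1}$, with composition of cycles corresponding to composition of permutations; this defines $\mathrm{Hol}_{X^{(1)}}:\pi_1(X^{(1)})\to S_{n+1}$. *)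

theory Defs
  imports "HOL-Analysis.Analysis" "HOL-Algebra.Sym_Groups"
begin

section \<open>Closed smooth manifolds\<close>

text \<open>\<open>k\<close>-fold continuous differentiability, for functions on an open set \<open>S\<close>.\<close>

primrec Ck_on :: "nat \<Rightarrow> 'b::real_normed_vector set \<Rightarrow> ('b \<Rightarrow> 'c::real_normed_vector) \<Rightarrow> bool" where
  "Ck_on 0 S f \<longleftrightarrow> continuous_on S f"
| "Ck_on (Suc k) S f \<longleftrightarrow>
     f differentiable_on S \<and> (\<forall>v. Ck_on k S (\<lambda>x. frechet_derivative f (at x) v))"

definition smooth_map_on :: "'b::real_normed_vector set \<Rightarrow> ('b \<Rightarrow> 'c::real_normed_vector) \<Rightarrow> bool" where
  "smooth_map_on S f \<longleftrightarrow> (\<forall>k. Ck_on k S f)"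

definition smooth_atlas ::
  "'a::topological_space set \<Rightarrow> ('a set \<times> ('a \<Rightarrow> real ^ 'n)) set \<Rightarrow> bool" where
  "smooth_atlas M A \<longleftrightarrow>
     (\<forall>(U, \<phi>) \<in> A. openin (top_of_set M) U \<and> open (\<phi> ` U) \<and> (\<exists>\<psi>. homeomorphism U (\<phi> ` U) \<phi> \<psi>)) \<and>
     (\<Union>(U, \<phi>) \<in> A. U) = M \<and>
     (\<forall>(U, \<phi>) \<in> A. \<forall>(V, \<psi>) \<in> A. smooth_map_on (\<phi> ` (U \<inter> V)) (\<psi> \<circ> inv_into U \<phi>))"

definition closed_smooth_manifold ::
  "'a::topological_space set \<Rightarrow> ('a set \<times> ('a \<Rightarrow> real ^ 'n)) set \<Rightarrow> bool" where
  "closed_smooth_manifold M A \<longleftrightarrow>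
     Hausdorff_space (top_of_set M) \<and> second_countable (top_of_set M) \<and> compact M \<and>
     smooth_atlas M A"


section \<open>Cell complexes dual to triangulations\<close>

text \<open>
  A complex on \<open>M\<close> is given by its sets \<open>X k\<close> of closed \<open>k\<close>-cells.  The dimension of the ambient
  manifold enters through the index type \<open>'n\<close>; model balls and model simplices of dimension
  \<open>k \<le> CARD('n)\<close> are taken inside \<open>real ^ 'n\<close>, so there are no cells of higher dimension.
\<close>

definition cell_boundary :: "(nat \<Rightarrow> 'a set set) \<Rightarrow> nat \<Rightarrow> 'a set \<Rightarrow> 'a set" where
  "cell_boundary X k c = \<Union>{d. \<exists>j<k. d \<in> X j \<and> d \<subseteq> c}"

text \<open>
  Embedded cells: each closed \<open>k\<close>-cell is the homeomorphic image of the closed unit ball of a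
  \<open>k\<close>-dimensional Euclidean space, the unit sphere going onto a union of cells of lower dimension.
\<close>

definition embedded_cell_complex ::
  "'n::finite itself \<Rightarrow> 'a::topological_space set \<Rightarrow> (nat \<Rightarrow> 'a set set) \<Rightarrow> bool" where
  "embedded_cell_complex _ M X \<longleftrightarrow>
     finite (\<Union>k. X k) \<and>
     (\<forall>k. \<forall>c \<in> X k. c \<subseteq> M \<and>
        (\<exists>(V :: (real ^ 'n) set) h g. subspace V \<and> dim V = k \<and>
           homeomorphism (V \<inter> cball 0 1) c h g \<and> h ` (V \<inter> sphere 0 1) = cell_boundary X k c)) \<and>
     (\<forall>x \<in> M. \<exists>!c. \<exists>k. c \<in> X k \<and> x \<in> c - cell_boundary X k c)"

text \<open>
  Triangulations by embedded simplices, where several simplices may share the same vertex set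
  (dually, two regions may meet in several cells): \<open>\<kappa> s\<close> is the characteristic map of \<open>s\<close>, its
  restriction to a face is, up to an affine change of coordinates, the characteristic map of a
  simplex, and the open simplices partition \<open>M\<close>.
\<close>

definition simplicial_triangulation ::
  "'n::finite itself \<Rightarrow> 'a::topological_space set \<Rightarrow> (nat \<Rightarrow> 'a set set) \<Rightarrow> bool" where
  "simplicial_triangulation _ M T \<longleftrightarrow>
     finite (\<Union>k. T k) \<and>
     (\<exists>(\<Delta> :: 'a set \<Rightarrow> (real ^ 'n) set) \<kappa>.
        (\<forall>k. \<forall>s \<in> T k. s \<subseteq> M \<and> int k simplex \<Delta> s \<and> (\<exists>g. homeomorphism (\<Delta> s) s (\<kappa> s) g) \<and>
           (\<forall>F. F face_of \<Delta> s \<and> F \<noteq> {} \<longrightarrow>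
              \<kappa> s ` F \<in> T (nat (aff_dim F)) \<and>
              (\<exists>a L. linear L \<and> (\<lambda>y. a + L y) ` \<Delta> (\<kappa> s ` F) = F \<and>
                 (\<forall>y \<in> \<Delta> (\<kappa> s ` F). \<kappa> (\<kappa> s ` F) y = \<kappa> s (a + L y))))) \<and>
        (\<forall>x \<in> M. \<exists>!s. s \<in> (\<Union>k. T k) \<and> x \<in> \<kappa> s ` rel_interior (\<Delta> s)))"

definition dual_complex ::
  "nat \<Rightarrow> (nat \<Rightarrow> 'a set set) \<Rightarrow> (nat \<Rightarrow> 'a set set) \<Rightarrow> bool" where
  "dual_complex n X T \<longleftrightarrow>
     (\<exists>D. (\<forall>k\<le>n. bij_betw D (T k) (X (n - k))) \<and>
          (\<forall>s \<in> (\<Union>k. T k). \<forall>t \<in> (\<Union>k. T k). s \<subseteq> t \<longleftrightarrow> D t \<subseteq> D s))"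

definition cpx ::
  "'n::finite itself \<Rightarrow> 'a::topological_space set \<Rightarrow> (nat \<Rightarrow> 'a set set) \<Rightarrow> bool" where
  "cpx N M X \<longleftrightarrow>
     embedded_cell_complex N M X \<and>
     (\<exists>T. simplicial_triangulation N M T \<and> dual_complex CARD('n) X T)"

definition skeleton :: "(nat \<Rightarrow> 'a set set) \<Rightarrow> nat \<Rightarrow> 'a set" where
  "skeleton X i = (\<Union>j\<le>i. \<Union>(X j))"

definition even_sided :: "(nat \<Rightarrow> 'a set set) \<Rightarrow> 'a set \<Rightarrow> bool" where
  "even_sided X c \<longleftrightarrow> even (card {e \<in> X 1. e \<subseteq> c})"


section \<open>The fundamental group\<close>

definition loop_class :: "'a::topological_space set \<Rightarrow> (real \<Rightarrow> 'a) \<Rightarrow> (real \<Rightarrow> 'a) set" where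
  "loop_class S p = {q. homotopic_paths S p q}"

definition fundamental_group ::
  "'a::topological_space set \<Rightarrow> 'a \<Rightarrow> (real \<Rightarrow> 'a) set monoid" where
  "fundamental_group S x =
     \<lparr> carrier = loop_class S ` {p. path p \<and> path_image p \<subseteq> S \<and> pathstart p = x \<and> pathfinish p = x},
       mult = (\<lambda>\<gamma> \<delta>. \<Union>p\<in>\<gamma>. \<Union>q\<in>\<delta>. loop_class S (p +++ q)),
       one = loop_class S (\<lambda>_. x) \<rparr>"

text \<open>The map induced by the inclusion of a subspace into \<open>S\<close>.\<close>

definition inclusion_map ::
  "'a::topological_space set \<Rightarrow> (real \<Rightarrow> 'a) set \<Rightarrow> (real \<Rightarrow> 'a) set" where
  "inclusion_map S \<gamma> = (\<Union>p\<in>\<gamma>. loop_class S p)"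


section \<open>Holonomy on the 1-skeleton\<close>

text \<open>
  An edge path starting at \<open>v\<close> is the list of its steps \<open>(e, u)\<close>: traverse the edge \<open>e\<close>, arriving
  at the vertex \<open>u\<close>.  The edges are recorded because several of them may join the same vertices.
\<close>

fun edge_path :: "(nat \<Rightarrow> 'a set set) \<Rightarrow> 'a \<Rightarrow> ('a set \<times> 'a) list \<Rightarrow> 'a \<Rightarrow> bool" where
  "edge_path X v [] w \<longleftrightarrow> {v} \<in> X 0 \<and> v = w"
| "edge_path X v ((e, u) # es) w \<longleftrightarrow>
     {v} \<in> X 0 \<and> e \<in> X 1 \<and> v \<in> e \<and> u \<in> e \<and> u \<noteq> v \<and> edge_path X u es w"

definition edge_arc :: "'a::topological_space set \<Rightarrow> 'a \<Rightarrow> 'a \<Rightarrow> real \<Rightarrow> 'a" where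
  "edge_arc e v u = (SOME p. arc p \<and> path_image p = e \<and> pathstart p = v \<and> pathfinish p = u)"

fun realization :: "'a::topological_space \<Rightarrow> ('a set \<times> 'a) list \<Rightarrow> real \<Rightarrow> 'a" where
  "realization v [] = (\<lambda>_. v)"
| "realization v ((e, u) # es) = edge_arc e v u +++ realization u es"

definition regions_at :: "nat \<Rightarrow> (nat \<Rightarrow> 'a set set) \<Rightarrow> 'a set \<Rightarrow> 'a set set" where
  "regions_at n X c = {R \<in> X n. c \<subseteq> R}"

definition edge_transport ::
  "nat \<Rightarrow> (nat \<Rightarrow> 'a set set) \<Rightarrow> 'a set \<times> 'a \<Rightarrow> ('a set \<Rightarrow> nat) \<Rightarrow> 'a set \<Rightarrow> nat" where
  "edge_transport n X = (\<lambda>(e, u) col. \<lambda>R \<in> regions_at n X {u}.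
     if e \<subseteq> R then col R else (THE i. i \<in> {1..n+1} \<and> i \<notin> col ` regions_at n X e))"

definition transport ::
  "nat \<Rightarrow> (nat \<Rightarrow> 'a set set) \<Rightarrow> ('a set \<times> 'a) list \<Rightarrow> ('a set \<Rightarrow> nat) \<Rightarrow> 'a set \<Rightarrow> nat" where
  "transport n X es col = fold (edge_transport n X) es col"

text \<open>
  \<open>Hol1 n X v0 col \<gamma>\<close> is the permutation taking the coloring \<open>col\<close> at \<open>v0\<close> to its transport along
  a closed edge path representing \<open>\<gamma>\<close>.  Transport commutes with permutations of the colors, so
  running through \<open>\<gamma>\<close> and then \<open>\<delta>\<close> gives \<open>Hol1 \<gamma> \<circ> Hol1 \<delta>\<close>.
\<close>

definition Hol1 ::
  "nat \<Rightarrow> (nat \<Rightarrow> 'a::topological_space set set) \<Rightarrow> 'a \<Rightarrow> ('a set \<Rightarrow> nat) \<Rightarrow>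
   (real \<Rightarrow> 'a) set \<Rightarrow> nat \<Rightarrow> nat" where
  "Hol1 n X v0 col \<gamma> =
     (THE \<sigma>. \<sigma> permutes {1..n+1} \<and>
        (\<exists>es. edge_path X v0 es v0 \<and> realization v0 es \<in> \<gamma> \<and>
           (\<forall>R \<in> regions_at n X {v0}. transport n X es col R = \<sigma> (col R))))"

end

theory Submission
  imports Defs
begin

text \<open>
  Call the closed cell whose interior contains a point its carrier.  Every point has a neighbourhood
  on which carriers only grow, so \<open>x \<mapsto> carrier_cell x\<close> is continuous for the Alexandrov topology on
  the face poset, and sections of a locally constant sheaf on this poset are transported along paths
  and homotopies in \<open>M\<close>.

  The sheaf in question consists of the coherent colorings of a cell: colorings at all its vertices
  that match along its edges.  It is locally constant provided every coloring at a vertex of a cell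
  \<open>c\<close> extends to a coherent coloring of \<open>c\<close>.  For a polygon this says that its edges can be colored
  alternately with two colors, i.e. that it is even sided; for a cell of dimension at least 3 it
  follows by transport along paths in the boundary sphere, which is simply connected.  Hence edge
  paths that are homotopic in \<open>M\<close> have the same transport.

  Conversely every loop of \<open>M\<close>, and every loop of the 1-skeleton within the 1-skeleton, is homotopic
  to an edge path: near a point \<open>x\<close> a path starting at \<open>x\<close> can be pushed into a single closed cell, and
  vertices of a cell are joined by edge paths in it because boundary spheres are connected.
\<close>

section \<open>Homotopies of paths\<close>

lemma homotopic_paths_image_simply_connected:
  fixes K :: "'b::real_normed_vector set"
  assumes "simply_connected K" "path f" "path_image f \<subseteq> K" "path g" "path_image g \<subseteq> K"
    and "pathstart f = pathstart g" "pathfinish f = pathfinish g"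
    and "continuous_on K h" "h ` K \<subseteq> S"
  shows "homotopic_paths S (h \<circ> f) (h \<circ> g)"
proof (rule homotopic_paths_continuous_image)
  show "homotopic_paths K f g"
    using assms by (auto simp: simply_connected_eq_homotopic_paths)
qed (use assms in auto)

lemma homotopic_paths_homeomorphic_simply_connected:
  fixes K :: "'b::real_normed_vector set"
  assumes "simply_connected K" "homeomorphism K U h k"
    and p: "path p" "path_image p \<subseteq> U" and q: "path q" "path_image q \<subseteq> U"
    and "pathstart p = pathstart q" "pathfinish p = pathfinish q"
  shows "homotopic_paths U p q"
proof -
  have k: "continuous_on U k" "k ` U = K" and h: "continuous_on K h" "h ` K = U"
    and hk: "\<And>y. y \<in> U \<Longrightarrow> h (k y) = y"
    using assms(2) by (auto simp: homeomorphism_def)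
  have to_K: "path (k \<circ> r)" "path_image (k \<circ> r) \<subseteq> K" if "path r" "path_image r \<subseteq> U" for r
    using that k by (auto intro!: path_continuous_image intro: continuous_on_subset simp: path_image_compose)
  have from_K: "homotopic_paths U r (h \<circ> (k \<circ> r))" if "path r" "path_image r \<subseteq> U" for r
    using that hk by (intro homotopic_paths_eq) (auto simp: path_image_def image_subset_iff)
  have "homotopic_paths U (h \<circ> (k \<circ> p)) (h \<circ> (k \<circ> q))"
    using assms h to_K by (intro homotopic_paths_image_simply_connected)
      (auto simp: pathstart_compose pathfinish_compose)
  then show ?thesis
    using from_K[OF p] from_K[OF q] homotopic_paths_sym homotopic_paths_trans by blast
qed

lemma path_constant: "path (\<lambda>_. x)"
  and pathstart_constant: "pathstart (\<lambda>_. x) = x"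
  and pathfinish_constant: "pathfinish (\<lambda>_. x) = x"
  by (auto simp: path_def pathstart_def pathfinish_def)

lemma homotopic_paths_interval_image:
  assumes "path p" "path_image p \<subseteq> S" "path f" "path_image f \<subseteq> {0..1}" "path g" "path_image g \<subseteq> {0..1}"
    and "pathstart f = pathstart g" "pathfinish f = pathfinish g"
  shows "homotopic_paths S (p \<circ> f) (p \<circ> g)"
  using assms
  by (intro homotopic_paths_image_simply_connected[of "{0..1}"])
    (auto simp: path_def path_image_def convex_imp_simply_connected)

lemma homotopic_paths_join_constant:
  assumes "path p" "path_image p \<subseteq> S"
  shows "homotopic_paths S (p +++ (\<lambda>_. pathfinish p)) p"
    and "homotopic_paths S ((\<lambda>_. pathstart p) +++ p) p"
proof -
  have eq: "p \<circ> linepath 0 1 = p" "p \<circ> linepath 1 1 = (\<lambda>_. pathfinish p)"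
    "p \<circ> linepath 0 0 = (\<lambda>_. pathstart p)"
    by (auto simp: linepath_def fun_eq_iff pathfinish_def pathstart_def algebra_simps)
  have "homotopic_paths S (p \<circ> (linepath 0 1 +++ linepath 1 1)) (p \<circ> linepath 0 1)"
    "homotopic_paths S (p \<circ> (linepath 0 0 +++ linepath 0 1)) (p \<circ> linepath 0 1)"
    using assms
    by (intro homotopic_paths_interval_image; auto simp: path_image_join closed_segment_eq_real_ivl)+
  then show "homotopic_paths S (p +++ (\<lambda>_. pathfinish p)) p"
    and "homotopic_paths S ((\<lambda>_. pathstart p) +++ p) p"
    by (simp_all add: path_compose_join eq)
qed

lemma path_segment:
  assumes "path p" "a \<in> {0..1}" "b \<in> {0..1}"
  shows "path (p \<circ> linepath a b)" "path_image (p \<circ> linepath a b) = p ` closed_segment a b"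
    "path_image (p \<circ> linepath a b) \<subseteq> path_image p"
    "pathstart (p \<circ> linepath a b) = p a" "pathfinish (p \<circ> linepath a b) = p b"
proof -
  have seg: "closed_segment a b \<subseteq> {0..1}"
    using assms by (intro closed_segment_subset) auto
  then show "path (p \<circ> linepath a b)"
    using assms by (intro path_continuous_image) (auto simp: path_def intro: continuous_on_subset)
  show "path_image (p \<circ> linepath a b) = p ` closed_segment a b"
    by (simp add: path_image_compose)
  then show "path_image (p \<circ> linepath a b) \<subseteq> path_image p"
    using seg by (auto simp: path_image_def)
qed (auto simp: pathstart_compose pathfinish_compose)

lemma homotopic_paths_join_segments:
  assumes "path p" "path_image p \<subseteq> S" "a \<in> {0..1}" "b \<in> {0..1}" "c \<in> {0..1}"
  shows "homotopic_paths S ((p \<circ> linepath a b) +++ (p \<circ> linepath b c)) (p \<circ> linepath a c)"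
proof -
  have "closed_segment u v \<subseteq> {0..1}" if "u \<in> {0..1}" "v \<in> {0..1}" for u v :: real
    using that by (intro closed_segment_subset) auto
  then show ?thesis
    unfolding path_compose_join[symmetric]
    using assms by (intro homotopic_paths_interval_image) (auto simp: path_image_join)
qed

lemma path_segment_in_nbhd:
  assumes "path p" "path_image p \<subseteq> S" "t \<in> {0..1}" "openin (top_of_set S) U" "p t \<in> U"
  obtains d where "d > 0"
    "\<And>s. s \<in> {0..1} \<Longrightarrow> \<bar>s - t\<bar> < d \<Longrightarrow> path_image (p \<circ> linepath t s) \<subseteq> U"
proof -
  have "openin (top_of_set {0..1}) ({0..1} \<inter> p -` U)"
    using assms by (intro continuous_openin_preimage[of _ _ S]) (auto simp: path_def path_image_def)
  moreover have "t \<in> {0..1} \<inter> p -` U"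
    using assms(3,5) by blast
  ultimately have "\<exists>d>0. \<forall>s\<in>{0..1}. dist s t < d \<longrightarrow> s \<in> {0..1} \<inter> p -` U"
    unfolding openin_euclidean_subtopology_iff by blast
  then obtain d where d: "d > 0" "\<And>s. s \<in> {0..1} \<Longrightarrow> dist s t < d \<Longrightarrow> p s \<in> U"
    by blast
  have "path_image (p \<circ> linepath t s) \<subseteq> U" if s: "s \<in> {0..1}" "\<bar>s - t\<bar> < d" for s
  proof -
    have "r \<in> {0..1} \<and> dist r t < d" if "r \<in> closed_segment t s" for r
      using that s assms(3) by (auto simp: closed_segment_eq_real_ivl dist_real_def split: if_splits)
    then show ?thesis
      using d(2) path_segment(2)[OF assms(1,3) s(1)] by auto
  qed
  then show thesis
    using that d(1) by blast
qed

definition all_paths_homotopic_in :: "'a::topological_space set \<Rightarrow> 'a set \<Rightarrow> bool" where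
  "all_paths_homotopic_in S U \<longleftrightarrow> (\<forall>p q. path p \<longrightarrow> path_image p \<subseteq> U \<longrightarrow> path q \<longrightarrow> path_image q \<subseteq> U \<longrightarrow>
     pathstart p = pathstart q \<longrightarrow> pathfinish p = pathfinish q \<longrightarrow> homotopic_paths S p q)"

text \<open>Unlike in the usual definition, paths and not only loops in \<open>U\<close> are compared; neither
  \<open>S\<close> nor \<open>U\<close> is assumed to be path connected.\<close>

definition semilocally_simply_connected :: "'a::topological_space set \<Rightarrow> bool" where
  "semilocally_simply_connected S \<longleftrightarrow>
     (\<forall>x\<in>S. \<exists>U. openin (top_of_set S) U \<and> x \<in> U \<and> all_paths_homotopic_in S U)"

lemma smooth_atlas_imp_semilocally_simply_connected:
  fixes A :: "('a::topological_space set \<times> ('a \<Rightarrow> real ^ 'n::finite)) set"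
  assumes "smooth_atlas M A"
  shows "semilocally_simply_connected M"
  unfolding semilocally_simply_connected_def
proof
  fix x assume "x \<in> M"
  then obtain U \<phi> where U: "(U, \<phi>) \<in> A" "x \<in> U"
    using assms unfolding smooth_atlas_def by fast
  then obtain \<psi> where chart: "openin (top_of_set M) U" "open (\<phi> ` U)" "homeomorphism U (\<phi> ` U) \<phi> \<psi>"
    using assms unfolding smooth_atlas_def by fast
  then obtain r where r: "r > 0" "ball (\<phi> x) r \<subseteq> \<phi> ` U"
    using U(2) open_contains_ball by blast
  define B where "B = \<psi> ` ball (\<phi> x) r"
  have hom: "homeomorphism (ball (\<phi> x) r) B \<psi> \<phi>"
    unfolding B_def using homeomorphism_symD[OF chart(3)] r(2)
    by (rule homeomorphism_of_subsets) auto
  have "openin (top_of_set U) B"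
    unfolding B_def using r(2)
    by (intro homeomorphism_imp_open_map[OF homeomorphism_symD[OF chart(3)]]) (simp add: openin_open_eq chart(2))
  then have "openin (top_of_set M) B"
    using chart(1) openin_trans by blast
  moreover have "x \<in> B"
    using r(1) U(2) chart(3) by (metis B_def centre_in_ball homeomorphism_apply1 image_eqI)
  moreover have "all_paths_homotopic_in M B"
    unfolding all_paths_homotopic_in_def
    using homotopic_paths_homeomorphic_simply_connected[OF _ hom] openin_imp_subset[OF \<open>openin (top_of_set M) B\<close>]
      homotopic_paths_subset convex_imp_simply_connected convex_ball by blast
  ultimately show "\<exists>U. openin (top_of_set M) U \<and> x \<in> U \<and> all_paths_homotopic_in M U"
    by blast
qed

lemma homotopic_paths_square_sides:
  fixes H :: "real \<times> real \<Rightarrow> 'a::topological_space"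
  assumes H: "continuous_on ({0..1} \<times> {0..1}) H" "H ` ({0..1} \<times> {0..1}) \<subseteq> S"
  shows "homotopic_paths S (\<lambda>t. H (0, t)) ((\<lambda>t. H (t, 0)) +++ (\<lambda>t. H (1, t)) +++ (\<lambda>t. H (1 - t, 1)))"
proof -
  let ?Q = "{0..1::real} \<times> {0..1::real}"
  let ?bottom = "linepath (0, 0) (0, 1) :: real \<Rightarrow> real \<times> real"
  let ?left = "linepath (0, 0) (1, 0) :: real \<Rightarrow> real \<times> real"
    and ?top = "linepath (1, 0) (1, 1) :: real \<Rightarrow> real \<times> real"
    and ?right = "linepath (1, 1) (0, 1) :: real \<Rightarrow> real \<times> real"
  have convex: "convex ?Q"
    by (simp add: convex_Times)
  have segment: "closed_segment a b \<subseteq> ?Q" if "a \<in> ?Q" "b \<in> ?Q" for a b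
    using that convex by (rule closed_segment_subset)
  have "homotopic_paths S (H \<circ> ?bottom) (H \<circ> (?left +++ ?top +++ ?right))"
    by (rule homotopic_paths_image_simply_connected[OF convex_imp_simply_connected[OF convex]])
      (use segment H in \<open>auto simp: path_image_join\<close>)
  moreover have "H \<circ> ?bottom = (\<lambda>t. H (0, t))" "H \<circ> ?left = (\<lambda>t. H (t, 0))"
    "H \<circ> ?top = (\<lambda>t. H (1, t))" "H \<circ> ?right = (\<lambda>t. H (1 - t, 1))"
    by (simp_all add: fun_eq_iff linepath_def)
  ultimately show ?thesis
    by (simp add: path_compose_join)
qed

lemma homotopic_paths_contraction:
  fixes r :: "real \<times> 'a::topological_space \<Rightarrow> 'a"
  assumes r: "continuous_on ({0..1} \<times> U) r" "r ` ({0..1} \<times> U) \<subseteq> S"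
    and ends: "\<And>y. y \<in> U \<Longrightarrow> r (0, y) = y" "\<And>y. y \<in> U \<Longrightarrow> r (1, y) = v"
    and p: "path p" "path_image p \<subseteq> U" and q: "path q" "path_image q \<subseteq> U"
    and pq: "pathstart p = pathstart q" "pathfinish p = pathfinish q"
  shows "homotopic_paths S p q"
proof -
  have contracted: "homotopic_paths S f ((\<lambda>t. r (t, pathstart f)) +++ (\<lambda>_. v) +++ (\<lambda>t. r (1 - t, pathfinish f)))"
    if f: "path f" "path_image f \<subseteq> U" for f
  proof -
    let ?sides = "(\<lambda>t. r (t, f 0)) +++ (\<lambda>t. r (1, f t)) +++ (\<lambda>t. r (1 - t, f 1))"
    have fU: "f t \<in> U" if "t \<in> {0..1}" for t
      using f(2) that by (auto simp: path_image_def)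
    have "continuous_on ({0..1} \<times> {0..1}) (\<lambda>z. f (snd z))"
      by (rule continuous_on_compose2[of "{0..1}" f]) (use f(1) in \<open>auto simp: path_def intro!: continuous_intros\<close>)
    then have "continuous_on ({0..1} \<times> {0..1}) (\<lambda>z. r (fst z, f (snd z)))"
      using fU by (auto intro!: continuous_on_compose2[OF r(1)] continuous_intros)
    moreover have "(\<lambda>z. r (fst z, f (snd z))) ` ({0..1} \<times> {0..1}) \<subseteq> S"
      using fU by (intro image_subsetI subsetD[OF r(2)] imageI) auto
    ultimately have sides: "homotopic_paths S (\<lambda>t. r (0, f t)) ?sides"
      using homotopic_paths_square_sides[of "\<lambda>z. r (fst z, f (snd z))" S] by simp
    have "homotopic_paths S f (\<lambda>t. r (0, f t))"
      using homotopic_paths_imp_subset[OF sides] fU ends(1)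
      by (intro homotopic_paths_eq f(1)) (auto simp: path_image_def)
    also note sides
    also have "homotopic_paths S ?sides ((\<lambda>t. r (t, pathstart f)) +++ (\<lambda>_. v) +++ (\<lambda>t. r (1 - t, pathfinish f)))"
      using homotopic_paths_imp_path[OF sides] homotopic_paths_imp_subset[OF sides] fU ends(2)
      by (intro homotopic_paths_eq) (auto simp: joinpaths_def pathstart_def pathfinish_def)
    finally show ?thesis .
  qed
  show ?thesis
    using contracted[OF p] contracted[OF q] unfolding pq
    using homotopic_paths_sym homotopic_paths_trans by blast
qed

section \<open>Alternating colorings of even cycles\<close>

locale fixpoint_free_involutions =
  fixes D :: "'d set" and \<alpha> \<beta> :: "'d \<Rightarrow> 'd"
  assumes finite_D: "finite D"
    and permutes: "\<alpha> permutes D" "\<beta> permutes D"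
    and involutive: "\<alpha> (\<alpha> x) = x" "\<beta> (\<beta> x) = x"
    and fixpoint_free: "x \<in> D \<Longrightarrow> \<alpha> x \<noteq> x" "x \<in> D \<Longrightarrow> \<beta> x \<noteq> x"
begin

abbreviation rotation :: "'d \<Rightarrow> 'd" where
  "rotation \<equiv> \<beta> \<circ> \<alpha>"

lemma permutation_rotation: "permutation rotation"
  using finite_D permutes permutes_compose permutes_imp_permutation by blast

lemma rotation_in: "x \<in> D \<Longrightarrow> (rotation ^^ k) x \<in> D"
  using permutes by (induction k) (auto simp: permutes_in_image)

lemma reflection_notin_orbit:
  assumes "x \<in> D"
  shows "(rotation ^^ k) x \<noteq> \<alpha> x"
  using assms
proof (induction k arbitrary: x rule: induct_nat_012)
  case 0
  then show ?case
    using fixpoint_free(1)[of x] by auto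
next
  case 1
  then show ?case
    using fixpoint_free(2)[of "\<alpha> x"] permutes by (auto simp: permutes_in_image)
next
  case (ge2 k)
  show ?case
  proof
    assume "(rotation ^^ Suc (Suc k)) x = \<alpha> x"
    then have "\<beta> (\<alpha> ((rotation ^^ k) (rotation x))) = \<alpha> x"
      by (metis comp_apply funpow.simps(2) funpow_Suc_right)
    then have "(rotation ^^ k) (rotation x) = \<alpha> (rotation x)"
      by (metis comp_apply involutive)
    moreover have "rotation x \<in> D"
      using rotation_in[OF ge2.prems, of 1] by simp
    ultimately show False
      using ge2.IH(1) by blast
  qed
qed

lemma reflected_orbit_disjoint:
  assumes "x \<in> D"
  shows "range (\<lambda>i. (rotation ^^ i) x) \<inter> \<alpha> ` range (\<lambda>i. (rotation ^^ i) x) = {}"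
proof -
  have "(rotation ^^ j) x \<noteq> \<alpha> ((rotation ^^ i) x)" if "i \<le> j" for i j
    using reflection_notin_orbit[OF rotation_in[OF assms], of "j - i" i] that
    by (metis funpow_add le_add_diff_inverse2 o_apply)
  then have "(rotation ^^ j) x \<noteq> \<alpha> ((rotation ^^ i) x)" for i j
    by (metis involutive(1) nat_le_linear)
  then show ?thesis
    by auto
qed

end

locale transitive_involutions = fixpoint_free_involutions +
  assumes transitive: "A \<subseteq> D \<Longrightarrow> A \<noteq> {} \<Longrightarrow> \<alpha> ` A \<subseteq> A \<Longrightarrow> \<beta> ` A \<subseteq> A \<Longrightarrow> A = D"
begin

lemma reflected_orbit_cover:
  assumes x: "x \<in> D"
  shows "D = range (\<lambda>i. (rotation ^^ i) x) \<union> \<alpha> ` range (\<lambda>i. (rotation ^^ i) x)" (is "D = ?O \<union> \<alpha> ` ?O")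
proof -
  define m where "m = least_power rotation x"
  have m: "m > 0" "(rotation ^^ m) x = x"
    using least_power_of_permutation[OF permutation_rotation] by (auto simp: m_def)
  have "\<beta> ((rotation ^^ i) x) \<in> \<alpha> ` ?O" for i
  proof -
    have "(rotation ^^ i) x = (rotation ^^ Suc (i + m - 1)) x"
      using m by (simp add: funpow_add)
    then have "\<beta> ((rotation ^^ i) x) = \<alpha> ((rotation ^^ (i + m - 1)) x)"
      by (simp add: involutive)
    then show ?thesis
      by blast
  qed
  moreover have "\<beta> (\<alpha> ((rotation ^^ i) x)) \<in> ?O" for i
    by (rule range_eqI[of _ _ "Suc i"]) simp
  ultimately have "\<beta> ` (?O \<union> \<alpha> ` ?O) \<subseteq> ?O \<union> \<alpha> ` ?O"
    by blast
  moreover have "\<alpha> ` (?O \<union> \<alpha> ` ?O) \<subseteq> ?O \<union> \<alpha> ` ?O"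
    by (auto simp: involutive)
  moreover have "?O \<union> \<alpha> ` ?O \<subseteq> D"
    using rotation_in[OF x] permutes by (auto simp: permutes_in_image)
  ultimately show ?thesis
    using transitive[of "?O \<union> \<alpha> ` ?O"] by blast
qed

lemma card_eq_twice_least_power:
  assumes x: "x \<in> D"
  shows "card D = 2 * least_power rotation x"
proof -
  define orbit where "orbit = range (\<lambda>i. (rotation ^^ i) x)"
  have D_eq: "D = orbit \<union> \<alpha> ` orbit" and disjoint: "orbit \<inter> \<alpha> ` orbit = {}"
    using reflected_orbit_cover[OF x] reflected_orbit_disjoint[OF x] by (simp_all add: orbit_def)
  have "card orbit = least_power rotation x"
    using support_set[OF permutation_rotation, of x]
      distinct_card[OF cycle_of_permutation[OF permutation_rotation, of x]]
    by (simp add: orbit_def)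
  moreover have "card (\<alpha> ` orbit) = card orbit"
    using permutes(1) by (meson card_image permutes_inj_on)
  moreover have "finite orbit"
    using D_eq finite_D by (metis finite_Un)
  ultimately show ?thesis
    using D_eq disjoint by (simp add: card_Un_disjoint)
qed

lemma orbit_index_parity:
  assumes even: "even (least_power rotation x)" and eq: "(rotation ^^ i) x = (rotation ^^ j) x"
  shows "even i \<longleftrightarrow> even j"
proof -
  have "even i \<longleftrightarrow> even j" if "(rotation ^^ i) x = (rotation ^^ j) x" "i \<le> j" for i j
  proof -
    have "inj rotation"
      using permutation_rotation by (simp add: permutation_bijective bij_is_inj)
    then have "least_power rotation x dvd j - i"
      using funpow_diff[of rotation i j x] that least_power_dvd[OF permutation_rotation] by simp
    then show ?thesis
      using even that(2) by (meson dvd_diffD dvd_diffD1 dvd_trans)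
  qed
  then show ?thesis
    using eq by (metis nat_le_linear)
qed

text \<open>The elements of \<open>D\<close> form one cycle in which \<open>\<alpha>\<close>-steps and \<open>\<beta>\<close>-steps alternate.  A coloring that is
  constant along \<open>\<alpha>\<close>-steps and changes along \<open>\<beta>\<close>-steps closes up if the number of \<open>\<beta>\<close>-steps is even.\<close>

lemma alternating_coloring_exists:
  assumes "4 dvd card D"
  shows "\<exists>b :: 'a \<Rightarrow> bool. \<forall>x\<in>D. b (\<alpha> x) = b x \<and> b (\<beta> x) \<noteq> b x"
proof (cases "D = {}")
  case False
  then obtain d where d: "d \<in> D"
    by blast
  define w where "w i = (rotation ^^ i) d" for i
  define b where "b x \<longleftrightarrow> (\<exists>i. even i \<and> (x = w i \<or> x = \<alpha> (w i)))" for x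
  have "2 * 2 dvd 2 * least_power rotation d"
    using assms card_eq_twice_least_power[OF d] by simp
  then have even: "even (least_power rotation d)"
    by (simp only: nat_mult_dvd_cancel_disj) simp
  have "even i \<longleftrightarrow> even j" if "w i = w j" for i j
    using that unfolding w_def by (rule orbit_index_parity[OF even])
  moreover have "w j \<noteq> \<alpha> (w i)" for i j
    using reflected_orbit_disjoint[OF d] unfolding w_def by blast
  ultimately have b: "b (w i) = even i" "b (\<alpha> (w i)) = even i" for i
    using involutive(1) unfolding b_def by metis+
  have step: "\<beta> (\<alpha> (w i)) = w (Suc i)" "\<beta> (w (Suc i)) = \<alpha> (w i)" for i
    by (simp_all add: w_def involutive)
  have pred: "\<exists>j. w i = w (Suc j)" for i
    using least_power_of_permutation[OF permutation_rotation, of d]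
    by (intro exI[of _ "i + least_power rotation d - 1"]) (simp add: w_def funpow_add)
  have "b (\<alpha> x) = b x \<and> b (\<beta> x) \<noteq> b x" if "x \<in> D" for x
  proof -
    have "x \<in> range w \<union> \<alpha> ` range w"
      using that reflected_orbit_cover[OF d] by (simp add: w_def[abs_def])
    then consider i where "x = w (Suc i)" | i where "x = \<alpha> (w i)"
      using pred by blast
    then show ?thesis
      by cases (simp_all add: step involutive b)
  qed
  then show ?thesis
    by (intro exI[of _ b]) simp
qed simp

end

definition other_element :: "'a set \<Rightarrow> 'a \<Rightarrow> 'a" where
  "other_element A x = (THE y. y \<in> A \<and> y \<noteq> x)"

lemma other_element:
  assumes "card A = 2" "x \<in> A"
  shows "A = {x, other_element A x}" "other_element A x \<noteq> x" "other_element A (other_element A x) = x"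
proof -
  obtain y where y: "A = {x, y}" "y \<noteq> x"
    using assms by (metis card_2_iff insertE insert_commute singletonD)
  have "other_element A x = y" "other_element A y = x"
    unfolding other_element_def using y by (auto intro!: the_equality)
  then show "A = {x, other_element A x}" "other_element A x \<noteq> x" "other_element A (other_element A x) = x"
    using y by simp_all
qed

locale cycle_graph =
  fixes E :: "'e set" and V :: "'v set" and ends :: "'e \<Rightarrow> 'v set"
  assumes finite_E: "finite E"
    and ends_subset: "e \<in> E \<Longrightarrow> ends e \<subseteq> V"
    and card_ends: "e \<in> E \<Longrightarrow> card (ends e) = 2"
    and degree: "v \<in> V \<Longrightarrow> card {e \<in> E. v \<in> ends e} = 2"
    and connected: "W \<subseteq> V \<Longrightarrow> W \<noteq> {} \<Longrightarrow> (\<And>e. e \<in> E \<Longrightarrow> ends e \<inter> W \<noteq> {} \<Longrightarrow> ends e \<subseteq> W) \<Longrightarrow> W = V"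
begin

definition darts :: "('e \<times> 'v) set" where
  "darts = (SIGMA e:E. ends e)"

definition traverse :: "'e \<times> 'v \<Rightarrow> 'e \<times> 'v" where
  "traverse = (\<lambda>(e, v). if (e, v) \<in> darts then (e, other_element (ends e) v) else (e, v))"

definition turn :: "'e \<times> 'v \<Rightarrow> 'e \<times> 'v" where
  "turn = (\<lambda>(e, v). if (e, v) \<in> darts then (other_element {e \<in> E. v \<in> ends e} e, v) else (e, v))"

lemma dartsD:
  assumes "(e, v) \<in> darts"
  shows "e \<in> E" "v \<in> ends e" "v \<in> V" "e \<in> {e \<in> E. v \<in> ends e}"
  using assms ends_subset by (auto simp: darts_def)

lemma traverse_dart:
  assumes "(e, v) \<in> darts"
  shows "\<exists>u. traverse (e, v) = (e, u) \<and> ends e = {v, u} \<and> u \<noteq> v \<and> (e, u) \<in> darts \<and> traverse (e, u) = (e, v)"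
proof -
  note other = other_element[OF card_ends[OF dartsD(1)[OF assms]] dartsD(2)[OF assms]]
  then have dart: "(e, other_element (ends e) v) \<in> darts"
    using dartsD(1)[OF assms] unfolding darts_def by blast
  show ?thesis
  proof (intro exI conjI)
    show "traverse (e, v) = (e, other_element (ends e) v)"
      "traverse (e, other_element (ends e) v) = (e, v)"
      using assms dart other(3) by (simp_all add: traverse_def)
  qed (fact other dart)+
qed

lemma turn_dart:
  assumes "(e, v) \<in> darts"
  shows "\<exists>e'. turn (e, v) = (e', v) \<and> {e \<in> E. v \<in> ends e} = {e, e'} \<and> e' \<noteq> e \<and> (e', v) \<in> darts \<and> turn (e', v) = (e, v)"
proof -
  let ?star = "{e \<in> E. v \<in> ends e}"
  note other = other_element[OF degree[OF dartsD(3)[OF assms]] dartsD(4)[OF assms]]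
  then have "other_element ?star e \<in> ?star"
    by blast
  then have dart: "(other_element ?star e, v) \<in> darts"
    by (simp add: darts_def)
  show ?thesis
  proof (intro exI conjI)
    show "turn (e, v) = (other_element ?star e, v)" "turn (other_element ?star e, v) = (e, v)"
      using assms dart other(3) by (simp_all add: turn_def)
  qed (fact other dart)+
qed

lemma traverse_turn_involutions: "fixpoint_free_involutions darts traverse turn"
proof
  have "finite (ends e)" if "e \<in> E" for e
    using card_ends[OF that] by (metis card.infinite zero_neq_numeral)
  then show finite: "finite darts"
    unfolding darts_def using finite_E by blast
  have dart: "traverse x \<in> darts" "traverse x \<noteq> x" "traverse (traverse x) = x"
      "turn x \<in> darts" "turn x \<noteq> x" "turn (turn x) = x" if "x \<in> darts" for x
  proof -
    obtain e v where x: "x = (e, v)"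
      by fastforce
    obtain u where "traverse (e, v) = (e, u)" "u \<noteq> v" "(e, u) \<in> darts" "traverse (e, u) = (e, v)"
      using traverse_dart \<open>x \<in> darts\<close> unfolding x by blast
    moreover obtain e' where "turn (e, v) = (e', v)" "e' \<noteq> e" "(e', v) \<in> darts" "turn (e', v) = (e, v)"
      using turn_dart \<open>x \<in> darts\<close> unfolding x by blast
    ultimately show "traverse x \<in> darts" "traverse x \<noteq> x" "traverse (traverse x) = x"
      "turn x \<in> darts" "turn x \<noteq> x" "turn (turn x) = x"
      by (simp_all add: x)
  qed
  have non_dart: "traverse x = x" "turn x = x" if "x \<notin> darts" for x
    using that by (cases x, simp add: traverse_def turn_def)+
  show involutive: "traverse (traverse x) = x" "turn (turn x) = x" for x
    using dart[of x] non_dart[of x] by (cases "x \<in> darts"; simp)+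
  show "traverse permutes darts" "turn permutes darts"
    using inj_imp_permutes[OF inj_on_inverseI finite dart(1) non_dart(1)]
      inj_imp_permutes[OF inj_on_inverseI finite dart(4) non_dart(2)] involutive by blast+
  show "traverse x \<noteq> x" "turn x \<noteq> x" if "x \<in> darts" for x
    using dart that by blast+
qed

lemma turn_eq:
  assumes "(e, v) \<in> darts" "(e', v) \<in> darts" "e' \<noteq> e"
  shows "turn (e, v) = (e', v)"
proof -
  obtain e'' where "turn (e, v) = (e'', v)" "{e \<in> E. v \<in> ends e} = {e, e''}"
    using turn_dart[OF assms(1)] by blast
  moreover have "e' \<in> {e \<in> E. v \<in> ends e}"
    using dartsD(4)[OF assms(2)] .
  ultimately show ?thesis
    using assms(3) by auto
qed

lemma traverse_eq:
  assumes "(e, v) \<in> darts" "(e, u) \<in> darts" "u \<noteq> v"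
  shows "traverse (e, v) = (e, u)"
proof -
  obtain w where "traverse (e, v) = (e, w)" "ends e = {v, w}"
    using traverse_dart[OF assms(1)] by blast
  moreover have "u \<in> ends e"
    using dartsD(2)[OF assms(2)] .
  ultimately show ?thesis
    using assms(3) by auto
qed

lemma invariant_darts_eq:
  assumes A: "A \<subseteq> darts" "A \<noteq> {}" "traverse ` A \<subseteq> A" "turn ` A \<subseteq> A"
  shows "A = darts"
proof -
  have turned: "(e', v) \<in> A" if "(e, v) \<in> A" "(e', v) \<in> darts" for e e' v
    using that turn_eq[of e v e'] A(1,4) by (metis image_subset_iff subsetD)
  have traversed: "(e, u) \<in> A" if "(e, v) \<in> A" "(e, u) \<in> darts" for e u v
    using that traverse_eq[of e v u] A(1,3) by (metis image_subset_iff subsetD)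
  have "snd ` A = V"
  proof (rule connected)
    show "snd ` A \<subseteq> V"
      using A(1) dartsD(3) by force
    fix e assume e: "e \<in> E" "ends e \<inter> snd ` A \<noteq> {}"
    then obtain v e' where "(e', v) \<in> A" "v \<in> ends e"
      by auto
    then have "(e, v) \<in> A"
      using turned e(1) by (simp add: darts_def)
    then have "(e, u) \<in> A" if "u \<in> ends e" for u
      using traversed that e(1) by (simp add: darts_def)
    then show "ends e \<subseteq> snd ` A"
      by force
  qed (use A(2) in simp)
  then have "(e, v) \<in> A" if "(e, v) \<in> darts" for e v
    using dartsD(3)[OF that] turned that by fastforce
  then show ?thesis
    using A(1) by auto
qed

lemma traverse_turn_transitive: "transitive_involutions darts traverse turn"
  using traverse_turn_involutions invariant_darts_eq
  by (intro transitive_involutions.intro transitive_involutions_axioms.intro)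

theorem even_alternating_edge_coloring:
  assumes "even (card E)"
  obtains b :: "'e \<Rightarrow> bool"
  where "\<And>v e e'. e \<in> E \<Longrightarrow> e' \<in> E \<Longrightarrow> v \<in> ends e \<Longrightarrow> v \<in> ends e' \<Longrightarrow> e \<noteq> e' \<Longrightarrow> b e \<noteq> b e'"
proof -
  have "card darts = 2 * card E"
    unfolding darts_def using finite_E card_ends by (simp add: card_ge_0_finite)
  then have card: "4 dvd card darts"
    using \<open>even (card E)\<close> by (auto elim!: evenE)
  obtain b :: "'e \<times> 'v \<Rightarrow> bool" where b: "\<forall>x\<in>darts. b (traverse x) = b x \<and> b (turn x) \<noteq> b x"
    using exE[OF transitive_involutions.alternating_coloring_exists[OF traverse_turn_transitive card]] .
  have same: "b (e, u) = b (e, v)" if "(e, u) \<in> darts" "(e, v) \<in> darts" for e u v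
    using that b traverse_eq by metis
  define end_of where "end_of e = (SOME u. u \<in> ends e)" for e
  have end_dart: "(e, end_of e) \<in> darts" if "e \<in> E" "v \<in> ends e" for e v
    using that someI[of "\<lambda>u. u \<in> ends e" v] by (simp add: darts_def end_of_def)
  have "b (e, end_of e) \<noteq> b (e', end_of e')"
    if e: "e \<in> E" "e' \<in> E" "v \<in> ends e" "v \<in> ends e'" "e \<noteq> e'" for v e e'
  proof -
    have darts: "(e, v) \<in> darts" "(e', v) \<in> darts"
      using e by (auto simp: darts_def)
    then have "b (e', v) \<noteq> b (e, v)"
      using b turn_eq e(5) by metis
    then show ?thesis
      using same darts end_dart e by metis
  qed
  then show thesis
    using that[of "\<lambda>e. b (e, end_of e)"] by blast
qed

end

section \<open>Triangulations and their dual complexes\<close>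

lemma convex_hull_subset_iff_affine_independent:
  assumes "\<not> affine_dependent C" "A \<subseteq> C" "B \<subseteq> C"
  shows "convex hull A \<subseteq> convex hull B \<longleftrightarrow> A \<subseteq> B"
proof
  assume sub: "convex hull A \<subseteq> convex hull B"
  show "A \<subseteq> B"
  proof (rule ccontr)
    assume "\<not> A \<subseteq> B"
    then obtain a where a: "a \<in> A" "a \<notin> B"
      by blast
    then have "a \<in> affine hull B"
      using sub hull_inc[of a A convex] convex_hull_subset_affine_hull by blast
    then have "a \<in> affine hull (C - {a})"
      using hull_mono[of B "C - {a}" affine] a assms(3) by blast
    then show False
      using assms a by (auto simp: affine_dependent_def)
  qed
qed (rule hull_mono)

lemma convex_hull_point_rel_interior:
  fixes C :: "'b::euclidean_space set"
  assumes "finite C" "\<not> affine_dependent C" "z \<in> convex hull C"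
  shows "\<exists>A\<subseteq>C. A \<noteq> {} \<and> z \<in> rel_interior (convex hull A)"
  using assms
proof (induction C rule: finite_psubset_induct)
  case (psubset C)
  show ?case
  proof (cases "z \<in> rel_interior (convex hull C)")
    case True
    then show ?thesis
      by (metis convex_hull_empty empty_iff order_refl rel_interior_empty)
  next
    case False
    then have "z \<in> convex hull C - rel_interior (convex hull C)"
      using psubset by auto
    then obtain a where a: "a \<in> C" "z \<in> convex hull (C - {a})"
      using rel_boundary_of_convex_hull[OF psubset.prems(1)] by auto
    moreover have "\<not> affine_dependent (C - {a})"
      using psubset.prems affine_independent_Diff by blast
    ultimately show ?thesis
      using psubset.IH[of "C - {a}"] by blast
  qed
qed

locale triangulation =
  fixes M :: "'a::topological_space set" and T :: "nat \<Rightarrow> 'a set set"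
    and \<Delta> :: "'a set \<Rightarrow> (real ^ 'n::finite) set" and \<kappa> :: "'a set \<Rightarrow> (real ^ 'n) \<Rightarrow> 'a"
  assumes simplices: "\<forall>k. \<forall>s \<in> T k. s \<subseteq> M \<and> int k simplex \<Delta> s \<and> (\<exists>g. homeomorphism (\<Delta> s) s (\<kappa> s) g) \<and>
           (\<forall>F. F face_of \<Delta> s \<and> F \<noteq> {} \<longrightarrow>
              \<kappa> s ` F \<in> T (nat (aff_dim F)) \<and>
              (\<exists>a L. linear L \<and> (\<lambda>y. a + L y) ` \<Delta> (\<kappa> s ` F) = F \<and>
                 (\<forall>y \<in> \<Delta> (\<kappa> s ` F). \<kappa> (\<kappa> s ` F) y = \<kappa> s (a + L y))))"
    and partition: "\<forall>x \<in> M. \<exists>!s. s \<in> (\<Union>k. T k) \<and> x \<in> \<kappa> s ` rel_interior (\<Delta> s)"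
begin

lemma simplexD:
  assumes "s \<in> T k"
  shows "s \<subseteq> M" "int k simplex \<Delta> s" "\<kappa> s ` \<Delta> s = s" "inj_on (\<kappa> s) (\<Delta> s)" "convex (\<Delta> s)" "\<Delta> s \<noteq> {}"
proof -
  have s: "s \<subseteq> M" "int k simplex \<Delta> s" "\<exists>g. homeomorphism (\<Delta> s) s (\<kappa> s) g"
    using simplices assms by blast+
  then show "s \<subseteq> M" "int k simplex \<Delta> s"
    by blast+
  obtain g where "homeomorphism (\<Delta> s) s (\<kappa> s) g"
    using s(3) by blast
  then show "\<kappa> s ` \<Delta> s = s" "inj_on (\<kappa> s) (\<Delta> s)"
    using homeomorphism_image1 homeomorphism_apply1 inj_on_inverseI by metis+
  show "convex (\<Delta> s)"
    using s(2) by (auto simp: simplex)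
  show "\<Delta> s \<noteq> {}"
    using s(2) by auto
qed

lemma simplex_dim_unique:
  assumes "s \<in> T i" "s \<in> T j"
  shows "i = j"
  using simplexD(2)[OF assms(1)] simplexD(2)[OF assms(2)] aff_dim_simplex by (metis of_nat_eq_iff)

lemma subsimplex_is_face:
  assumes s: "s \<in> T j" and t: "t \<in> T k" and st: "s \<subseteq> t"
    and C: "finite C" "\<not> affine_dependent C" "\<Delta> t = convex hull C"
  shows "\<exists>A\<subseteq>C. A \<noteq> {} \<and> s = \<kappa> t ` (convex hull A)"
proof -
  obtain y where y: "y \<in> rel_interior (\<Delta> s)"
    using simplexD(5,6)[OF s] rel_interior_eq_empty by blast
  then have x: "\<kappa> s y \<in> s"
    using rel_interior_subset simplexD(3)[OF s] by blast
  then obtain z where z: "z \<in> convex hull C" "\<kappa> s y = \<kappa> t z"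
    using st simplexD(3)[OF t] C(3) by (metis imageE subsetD)
  obtain A where A: "A \<subseteq> C" "A \<noteq> {}" "z \<in> rel_interior (convex hull A)"
    using convex_hull_point_rel_interior[OF C(1,2) z(1)] by blast
  define F s' where "F = convex hull A" and "s' = \<kappa> t ` F"
  have "F face_of \<Delta> t" "F \<noteq> {}"
    using A C face_of_convex_hull_affine_independent[OF C(2)] by (auto simp: F_def)
  then obtain a L where aL: "s' \<in> T (nat (aff_dim F))" "linear L" "(\<lambda>y. a + L y) ` \<Delta> s' = F"
     "\<forall>y \<in> \<Delta> s'. \<kappa> s' y = \<kappa> t (a + L y)"
    using simplices t unfolding s'_def by blast
  have "rel_interior F = rel_interior ((\<lambda>y. a + y) ` L ` \<Delta> s')"
    using aL(3) by (simp add: image_image)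
  also have "\<dots> = (\<lambda>y. a + y) ` L ` rel_interior (\<Delta> s')"
    using rel_interior_convex_linear_image[OF aL(2) simplexD(5)[OF aL(1)]] by (simp add: rel_interior_translation)
  finally obtain w where w: "w \<in> rel_interior (\<Delta> s')" "z = a + L w"
    using A(3) by (auto simp: F_def)
  then have "\<kappa> s y = \<kappa> s' w"
    using z(2) aL(4) rel_interior_subset by fastforce
  then have "\<kappa> s y \<in> \<kappa> s' ` rel_interior (\<Delta> s')" "\<kappa> s y \<in> \<kappa> s ` rel_interior (\<Delta> s)"
    using w(1) y by (metis imageI)+
  moreover have "s' \<in> (\<Union>k. T k)" "s \<in> (\<Union>k. T k)" "\<kappa> s y \<in> M"
    using aL(1) s x simplexD(1)[OF s] by auto
  ultimately have "s = s'"
    using partition by blast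
  then show ?thesis
    using A by (auto simp: s'_def F_def)
qed

lemma face_simplex:
  assumes t: "t \<in> T k" and C: "finite C" "\<not> affine_dependent C" "\<Delta> t = convex hull C"
    and A: "A \<subseteq> C" "A \<noteq> {}"
  shows "\<kappa> t ` (convex hull A) \<in> T (card A - 1)"
proof -
  have "convex hull A face_of \<Delta> t" "convex hull A \<noteq> {}"
    using A C face_of_convex_hull_affine_independent[OF C(2)] by auto
  then have "\<kappa> t ` (convex hull A) \<in> T (nat (aff_dim (convex hull A)))"
    using simplices t by blast
  moreover have "\<not> affine_dependent A"
    using A C(2) affine_independent_subset by blast
  then have "aff_dim (convex hull A) = int (card A) - 1"
    by (simp add: aff_dim_convex_hull aff_dim_affine_independent)
  moreover have "card A > 0"
    using A C(1) finite_subset card_gt_0_iff by metis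
  ultimately show ?thesis
    by (simp add: nat_diff_distrib)
qed

definition vertex_set :: "'a set \<Rightarrow> 'a set set" where
  "vertex_set s = {p \<in> T 0. p \<subseteq> s}"

definition face_indexing :: "'a set \<Rightarrow> (real ^ 'n) set \<Rightarrow> ((real ^ 'n) set \<Rightarrow> 'a set) \<Rightarrow> bool" where
  "face_indexing t C \<phi> \<longleftrightarrow> finite C \<and> \<phi> C = t \<and>
     (\<forall>A\<subseteq>C. A \<noteq> {} \<longrightarrow> \<phi> A \<in> T (card A - 1)) \<and>
     (\<forall>A\<subseteq>C. \<forall>B\<subseteq>C. \<phi> A \<subseteq> \<phi> B \<longleftrightarrow> A \<subseteq> B) \<and>
     (\<forall>j. \<forall>s\<in>T j. s \<subseteq> t \<longrightarrow> (\<exists>A\<subseteq>C. A \<noteq> {} \<and> s = \<phi> A))"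

lemma face_indexingD:
  assumes "face_indexing t C \<phi>"
  shows "finite C" "\<phi> C = t" "\<And>A. A \<subseteq> C \<Longrightarrow> A \<noteq> {} \<Longrightarrow> \<phi> A \<in> T (card A - 1)"
    "\<And>A B. A \<subseteq> C \<Longrightarrow> B \<subseteq> C \<Longrightarrow> \<phi> A \<subseteq> \<phi> B \<longleftrightarrow> A \<subseteq> B"
    "\<And>s j. s \<in> T j \<Longrightarrow> s \<subseteq> t \<Longrightarrow> \<exists>A\<subseteq>C. A \<noteq> {} \<and> s = \<phi> A"
  using assms by (simp_all add: face_indexing_def)

lemma simplex_face_indexing:
  assumes t: "t \<in> T k"
  obtains C \<phi> where "card C = k + 1" "face_indexing t C \<phi>"
proof -
  obtain C where C: "finite C" "\<not> affine_dependent C" "int (card C) = int k + 1" "\<Delta> t = convex hull C"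
    using simplexD(2)[OF t] by (auto simp: simplex)
  define \<phi> where "\<phi> A = \<kappa> t ` (convex hull A)" for A
  have "card C = k + 1" and top: "\<phi> C = t"
    using C simplexD(3)[OF t] by (auto simp: \<phi>_def)
  have face: "\<phi> A \<in> T (card A - 1)" if "A \<subseteq> C" "A \<noteq> {}" for A
    unfolding \<phi>_def using face_simplex[OF t C(1,2,4) that] .
  have mono: "\<phi> A \<subseteq> \<phi> B \<longleftrightarrow> A \<subseteq> B" if AB: "A \<subseteq> C" "B \<subseteq> C" for A B
  proof -
    have "convex hull A \<subseteq> \<Delta> t" "convex hull B \<subseteq> \<Delta> t"
      using AB hull_mono C(4) by metis+
    then have "\<phi> A \<subseteq> \<phi> B \<longleftrightarrow> convex hull A \<subseteq> convex hull B"
      unfolding \<phi>_def using simplexD(4)[OF t] by (meson inj_on_image_subset_iff)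
    then show ?thesis
      using convex_hull_subset_iff_affine_independent[OF C(2) AB] by simp
  qed
  have subsimplex: "\<exists>A\<subseteq>C. A \<noteq> {} \<and> s = \<phi> A" if "s \<in> T j" "s \<subseteq> t" for s j
    unfolding \<phi>_def using subsimplex_is_face[OF that(1) t that(2) C(1,2,4)] .
  have "face_indexing t C \<phi>"
    unfolding face_indexing_def by (intro conjI allI impI ballI C(1) top face mono subsimplex)
  then show thesis
    using that \<open>card C = k + 1\<close> by blast
qed

lemma vertex_set_face:
  assumes "face_indexing t C \<phi>" and A: "A \<subseteq> C" "A \<noteq> {}"
  shows "vertex_set (\<phi> A) = (\<lambda>a. \<phi> {a}) ` A"
proof
  note face = face_indexingD(3)[OF assms(1)] and mono = face_indexingD(4)[OF assms(1)]
  show "(\<lambda>a. \<phi> {a}) ` A \<subseteq> vertex_set (\<phi> A)"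
    using A face[of "{_}"] mono[of "{_}" A] by (auto simp: vertex_set_def)
  show "vertex_set (\<phi> A) \<subseteq> (\<lambda>a. \<phi> {a}) ` A"
  proof
    fix p assume p: "p \<in> vertex_set (\<phi> A)"
    moreover have "\<phi> A \<subseteq> t"
      using mono[OF A(1) order_refl] A(1) face_indexingD(2)[OF assms(1)] by simp
    ultimately obtain B where B: "B \<subseteq> C" "B \<noteq> {}" "p = \<phi> B"
      using face_indexingD(5)[OF assms(1), of p 0] by (auto simp: vertex_set_def)
    then have "B \<subseteq> A"
      using p mono[OF B(1) A(1)] by (simp add: vertex_set_def)
    moreover have "card B - 1 = 0"
      using simplex_dim_unique[OF face[OF B(1,2)], of 0] p B(3) by (simp add: vertex_set_def)
    moreover have "card B > 0"
      using B face_indexingD(1)[OF assms(1)] by (meson card_gt_0_iff finite_subset)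
    ultimately obtain b where "B = {b}" "b \<in> A"
      by (metis One_nat_def Suc_pred' card_1_singletonE insert_subset)
    then show "p \<in> (\<lambda>a. \<phi> {a}) ` A"
      using B(3) by blast
  qed
qed

lemma inj_on_face_indexing_vertex: "face_indexing t C \<phi> \<Longrightarrow> inj_on (\<lambda>a. \<phi> {a}) C"
  using face_indexingD(4)[of t C \<phi> "{_}" "{_}"] by (intro inj_onI) auto

lemma card_vertex_set:
  assumes "s \<in> T k"
  shows "card (vertex_set s) = k + 1"
proof -
  obtain C \<phi> where C: "card C = k + 1" "face_indexing s C \<phi>"
    using simplex_face_indexing[OF assms] .
  then have "C \<noteq> {}"
    by auto
  then show ?thesis
    using vertex_set_face[OF C(2) order_refl] face_indexingD(2)[OF C(2)] inj_on_face_indexing_vertex[OF C(2)] C(1)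
    by (simp add: card_image)
qed

lemma vertex_set_subset_iff:
  assumes t: "t \<in> T k" and s: "s \<in> T i" "s \<subseteq> t" and s': "s' \<in> T j" "s' \<subseteq> t"
  shows "s \<subseteq> s' \<longleftrightarrow> vertex_set s \<subseteq> vertex_set s'"
proof -
  obtain C \<phi> where C: "face_indexing t C \<phi>"
    using simplex_face_indexing[OF t] .
  obtain A B where "A \<subseteq> C" "A \<noteq> {}" "s = \<phi> A" "B \<subseteq> C" "B \<noteq> {}" "s' = \<phi> B"
    using face_indexingD(5)[OF C] s s' by meson
  then show ?thesis
    using face_indexingD(4)[OF C] vertex_set_face[OF C] inj_on_face_indexing_vertex[OF C]
    by (simp add: inj_on_image_subset_iff)
qed

lemma simplex_of_vertex_set:
  assumes t: "t \<in> T k" and A: "A \<subseteq> vertex_set t" "A \<noteq> {}"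
  shows "\<exists>s\<in>T (card A - 1). s \<subseteq> t \<and> vertex_set s = A"
proof -
  obtain C \<phi> where C: "card C = k + 1" "face_indexing t C \<phi>"
    using simplex_face_indexing[OF t] .
  note top = face_indexingD(2)[OF C(2)] and vertices = vertex_set_face[OF C(2)]
  have "C \<noteq> {}"
    using C(1) by auto
  then have "A \<subseteq> (\<lambda>a. \<phi> {a}) ` C"
    using A(1) vertices[OF order_refl] top by simp
  then obtain B where B: "B \<subseteq> C" "A = (\<lambda>a. \<phi> {a}) ` B"
    by (meson subset_imageE)
  then have "B \<noteq> {}" "card A = card B"
    using A(2) inj_on_face_indexing_vertex[OF C(2)] by (auto intro: card_image inj_on_subset)
  then show ?thesis
    using face_indexingD(3)[OF C(2) B(1)] face_indexingD(4)[OF C(2) B(1) order_refl] vertices[OF B(1)] B top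
    by (intro bexI[of _ "\<phi> B"]) simp_all
qed

end

locale dual_triangulation = triangulation M T \<Delta> \<kappa>
  for M :: "'a::topological_space set" and T
    and \<Delta> :: "'a set \<Rightarrow> (real ^ 'n::finite) set" and \<kappa> +
  fixes n :: nat and X :: "nat \<Rightarrow> 'a set set" and D :: "'a set \<Rightarrow> 'a set"
  assumes dual_bij: "k \<le> n \<Longrightarrow> bij_betw D (T k) (X (n - k))"
    and dual_subset: "s \<in> T i \<Longrightarrow> t \<in> T j \<Longrightarrow> D t \<subseteq> D s \<longleftrightarrow> s \<subseteq> t"
    and cell_dim: "c \<in> X j \<Longrightarrow> j \<le> n"
begin

abbreviation regions :: "'a set \<Rightarrow> 'a set set" where
  "regions \<equiv> regions_at n X"

lemma regions_dual:
  assumes "s \<in> T k"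
  shows "regions (D s) = D ` vertex_set s"
proof -
  have "X n = D ` T 0"
    using dual_bij[of 0] by (auto simp: bij_betw_def)
  then show ?thesis
    using dual_subset[OF _ assms, of _ 0] by (auto simp: regions_at_def vertex_set_def)
qed

lemma card_regions_dual:
  assumes "s \<in> T k"
  shows "card (regions (D s)) = k + 1"
proof -
  have "inj_on D (vertex_set s)"
    using dual_bij[of 0] by (auto simp: bij_betw_def vertex_set_def inj_on_def)
  then show ?thesis
    using regions_dual[OF assms] card_vertex_set[OF assms] by (simp add: card_image)
qed

lemma vertex_dual_simplex:
  assumes "{v} \<in> X 0"
  obtains t where "t \<in> T n" "D t = {v}"
proof -
  have "{v} \<in> D ` T n"
    using assms dual_bij[of n] by (simp add: bij_betw_def)
  then show thesis
    using that by force
qed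

lemma cell_dual_simplex:
  assumes "d \<in> X j" "v \<in> d" "t \<in> T n" "D t = {v}"
  obtains s where "s \<in> T (n - j)" "s \<subseteq> t" "D s = d"
proof -
  have "d \<in> D ` T (n - j)"
    using dual_bij[of "n - j"] cell_dim[OF assms(1)] assms(1) by (auto simp: bij_betw_def)
  then show thesis
    using that dual_subset[OF _ assms(3)] assms(2,4) by auto
qed

lemma card_regions:
  assumes "{v} \<in> X 0" "d \<in> X j" "v \<in> d"
  shows "card (regions d) + j = n + 1"
proof -
  obtain t where "t \<in> T n" "D t = {v}"
    using vertex_dual_simplex[OF assms(1)] .
  then obtain s where "s \<in> T (n - j)" "D s = d"
    using cell_dual_simplex[OF assms(2,3)] by blast
  then show ?thesis
    using card_regions_dual[of s "n - j"] cell_dim[OF assms(2)] by simp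
qed

lemma regions_subset_iff:
  assumes "{v} \<in> X 0" and d: "d \<in> X i" "v \<in> d" and d': "d' \<in> X j" "v \<in> d'"
  shows "regions d' \<subseteq> regions d \<longleftrightarrow> d \<subseteq> d'"
proof -
  obtain t where t: "t \<in> T n" "D t = {v}"
    using vertex_dual_simplex[OF assms(1)] .
  obtain s where s: "s \<in> T (n - i)" "s \<subseteq> t" "D s = d"
    using cell_dual_simplex[OF d t] .
  obtain s' where s': "s' \<in> T (n - j)" "s' \<subseteq> t" "D s' = d'"
    using cell_dual_simplex[OF d' t] .
  have "inj_on D (vertex_set t)"
    using dual_bij[of 0] by (auto simp: bij_betw_def vertex_set_def inj_on_def)
  moreover have "vertex_set s \<subseteq> vertex_set t" "vertex_set s' \<subseteq> vertex_set t"
    using s(2) s'(2) by (auto simp: vertex_set_def)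
  ultimately have "regions d' \<subseteq> regions d \<longleftrightarrow> vertex_set s' \<subseteq> vertex_set s"
    using regions_dual[OF s(1)] regions_dual[OF s'(1)] s(3) s'(3) by (simp add: inj_on_image_subset_iff)
  also have "\<dots> \<longleftrightarrow> s' \<subseteq> s"
    using vertex_set_subset_iff[OF t(1) s'(1,2) s(1,2)] by simp
  also have "\<dots> \<longleftrightarrow> d \<subseteq> d'"
    using dual_subset[OF s'(1) s(1)] s(3) s'(3) by simp
  finally show ?thesis .
qed

lemma cell_of_regions:
  assumes "{v} \<in> X 0" "A \<subseteq> regions {v}" "A \<noteq> {}"
  shows "\<exists>d\<in>X (n + 1 - card A). v \<in> d \<and> regions d = A"
proof -
  obtain t where t: "t \<in> T n" "D t = {v}"
    using vertex_dual_simplex[OF assms(1)] .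
  then obtain B where B: "B \<subseteq> vertex_set t" "A = D ` B"
    using assms(2) regions_dual[OF t(1)] by (metis subset_imageE)
  then obtain s where s: "s \<in> T (card B - 1)" "s \<subseteq> t" "vertex_set s = B"
    using simplex_of_vertex_set[OF t(1)] assms(3) by blast
  have card: "card A = card B" "card B > 0"
    using regions_dual[OF s(1)] card_regions_dual[OF s(1)] card_vertex_set[OF s(1)] s(3) B(2) by simp_all
  have "card B \<le> n + 1"
    using card_vertex_set[OF t(1)] B(1) by (metis Suc_eq_plus1 card.infinite card_mono nat.distinct(1))
  then have "bij_betw D (T (card B - 1)) (X (n + 1 - card A))"
    using dual_bij[of "card B - 1"] card by simp
  then have "D s \<in> X (n + 1 - card A)"
    using s(1) by (rule bij_betwE[rule_format])
  moreover have "v \<in> D s"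
    using dual_subset[OF s(1) t(1)] s(2) t(2) by simp
  ultimately show ?thesis
    using regions_dual[OF s(1)] s(3) B(2) by blast
qed

end

section \<open>Embedded cell complexes\<close>

lemma one_dim_subspace_unit_ball:
  fixes V :: "'b::euclidean_space set"
  assumes "subspace V" "dim V = 1"
  obtains b where "norm b = 1" "V \<inter> sphere 0 1 = {b, - b}" "V \<inter> cball 0 1 = closed_segment b (- b)"
proof -
  obtain B where B: "\<And>x. x \<in> B \<Longrightarrow> norm x = 1" "card B = dim V" "span B = V"
    using orthonormal_basis_subspace[OF assms(1)] by metis
  then obtain b where "B = {b}"
    using assms(2) by (metis card_1_singletonE)
  then have b: "norm b = 1" "V = range (\<lambda>t. t *\<^sub>R b)"
    using B by (auto simp: span_singleton)
  have ends: "b \<in> V" "- b \<in> V"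
    using b(2) by (metis rangeI scaleR_one, metis rangeI scaleR_minus1_left)
  have "V \<inter> sphere 0 1 \<subseteq> {b, - b}"
    using b by (auto simp: abs_if split: if_splits)
  moreover have "V \<inter> cball 0 1 \<subseteq> closed_segment b (- b)"
  proof
    fix x assume x: "x \<in> V \<inter> cball 0 1"
    then obtain t where t: "x = t *\<^sub>R b"
      using b(2) by blast
    then have "\<bar>t\<bar> \<le> 1"
      using x b(1) by simp
    have "x = (1 - (1 - t) / 2) *\<^sub>R b + ((1 - t) / 2) *\<^sub>R (- b)"
      unfolding t by (simp flip: scaleR_left_diff_distrib)
    then show "x \<in> closed_segment b (- b)"
      unfolding closed_segment_def using \<open>\<bar>t\<bar> \<le> 1\<close> by (intro CollectI exI[of _ "(1 - t) / 2"]) auto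
  qed
  moreover have "closed_segment b (- b) \<subseteq> V \<inter> cball 0 1"
    using ends b(1) assms(1) by (intro closed_segment_subset convex_Int) (auto simp: subspace_imp_convex)
  moreover have "{b, - b} \<subseteq> V \<inter> sphere 0 1"
    using ends b(1) by simp
  ultimately show thesis
    using that[OF b(1)] by blast
qed

locale cell_complex =
  fixes N :: "'n::finite itself" and M :: "'a::topological_space set" and X :: "nat \<Rightarrow> 'a set set"
  assumes hausdorff: "Hausdorff_space (top_of_set M)"
    and embedded: "embedded_cell_complex N M X"
begin

abbreviation cells :: "'a set set" where
  "cells \<equiv> \<Union>k. X k"

definition vertices :: "'a set \<Rightarrow> 'a set" where
  "vertices c = {v. {v} \<in> X 0 \<and> v \<in> c}"

definition carrier_cell :: "'a \<Rightarrow> 'a set" where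
  "carrier_cell x = (THE c. \<exists>k. c \<in> X k \<and> x \<in> c - cell_boundary X k c)"

subsection \<open>Cells as balls\<close>

lemma finite_cells: "finite cells"
  using embedded by (simp add: embedded_cell_complex_def)

lemma cell_subset: "c \<in> cells \<Longrightarrow> c \<subseteq> M"
  using embedded unfolding embedded_cell_complex_def by blast

lemma cell_ball:
  assumes "c \<in> X k"
  obtains V :: "(real ^ 'n) set" and h g where "subspace V" "dim V = k"
    "homeomorphism (V \<inter> cball 0 1) c h g" "h ` (V \<inter> sphere 0 1) = cell_boundary X k c"
proof -
  have "\<exists>(V :: (real ^ 'n) set) h g. subspace V \<and> dim V = k \<and>
      homeomorphism (V \<inter> cball 0 1) c h g \<and> h ` (V \<inter> sphere 0 1) = cell_boundary X k c"
    using embedded assms unfolding embedded_cell_complex_def by blast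
  then show thesis
    using that by blast
qed

lemma cell_dim_le:
  assumes "c \<in> X k"
  shows "k \<le> CARD('n)"
  using cell_ball[OF assms] dim_subset_UNIV by (metis DIM_cart DIM_real mult.right_neutral)

lemma cell_homeomorphic_convex:
  assumes "c \<in> cells"
  obtains K :: "(real ^ 'n) set" and h g where "convex K" "compact K" "homeomorphism K c h g"
proof -
  obtain V :: "(real ^ 'n) set" and h g where "subspace V" "homeomorphism (V \<inter> cball 0 1) c h g"
    using assms cell_ball by (metis UN_E)
  then show thesis
    using that by (metis convex_Int convex_cball subspace_imp_convex closed_subspace closed_Int_compact compact_cball)
qed

lemma closedin_cell:
  assumes "c \<in> cells"
  shows "closedin (top_of_set M) c"
proof -
  obtain K :: "(real ^ 'n) set" and h g where "compact K" "homeomorphism K c h g"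
    using cell_homeomorphic_convex[OF assms] by metis
  then have "compact c"
    by (metis compact_continuous_image homeomorphism_def)
  then have "compactin (top_of_set M) c"
    using cell_subset[OF assms] by (simp add: compactin_subtopology)
  then show ?thesis
    using hausdorff compactin_imp_closedin by blast
qed

lemma path_connected_cell:
  assumes "c \<in> cells"
  shows "path_connected c"
  using cell_homeomorphic_convex[OF assms]
  by (metis convex_imp_path_connected homeomorphism_def path_connected_continuous_image)

lemma cell_homotopic_paths:
  assumes "c \<in> cells" "path p" "path_image p \<subseteq> c" "path q" "path_image q \<subseteq> c"
    and "pathstart p = pathstart q" "pathfinish p = pathfinish q"
  shows "homotopic_paths c p q"
proof -
  obtain K :: "(real ^ 'n) set" and h g where K: "convex K" "homeomorphism K c h g"
    using cell_homeomorphic_convex[OF assms(1)] by metis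
  show ?thesis
    by (rule homotopic_paths_homeomorphic_simply_connected[OF convex_imp_simply_connected[OF K(1)] K(2) assms(2-)])
qed

lemma cell_locally_path_connected:
  assumes "c \<in> cells" "openin (top_of_set c) U" "x \<in> U"
  obtains W where "openin (top_of_set c) W" "path_connected W" "x \<in> W" "W \<subseteq> U"
proof -
  obtain K :: "(real ^ 'n) set" and h g where K: "convex K" "homeomorphism K c h g"
    using cell_homeomorphic_convex[OF assms(1)] by metis
  have "openin (top_of_set K) (g ` U)"
    by (rule homeomorphism_imp_open_map[OF homeomorphism_symD[OF K(2)] assms(2)])
  moreover have "g x \<in> g ` U"
    using assms(3) by blast
  ultimately obtain r where r: "r > 0" "ball (g x) r \<inter> K \<subseteq> g ` U"
    using openin_contains_ball by metis
  have sub: "U \<subseteq> c"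
    using assms(2) by (rule openin_imp_subset)
  then have gK: "g x \<in> K"
    using assms(3) homeomorphism_image2[OF K(2)] by blast
  have hg: "h (g y) = y" if "y \<in> U" for y
    using homeomorphism_apply2[OF K(2)] sub that by blast
  let ?W = "h ` (ball (g x) r \<inter> K)"
  show thesis
  proof (rule that)
    show "openin (top_of_set c) ?W"
      by (rule homeomorphism_imp_open_map[OF K(2)]) (auto simp: openin_open)
    show "path_connected ?W"
      using K by (intro path_connected_continuous_image convex_imp_path_connected convex_Int)
        (auto simp: homeomorphism_def intro: continuous_on_subset)
    show "x \<in> ?W"
      using hg[OF assms(3)] r(1) gK by (intro image_eqI[of _ _ "g x"]) auto
    show "?W \<subseteq> U"
      using image_mono[OF r(2), of h] hg by (simp add: image_image)
  qed
qed

lemma continuous_on_times_cells: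
  assumes W: "W \<subseteq> M" and C: "C \<subseteq> cells" "W \<subseteq> \<Union>C"
    and cont: "\<And>c. c \<in> C \<Longrightarrow> continuous_on (I \<times> (W \<inter> c)) f"
  shows "continuous_on (I \<times> W) f"
proof -
  let ?T = "\<lambda>c. (I \<times> W) \<inter> snd -` c"
  have "continuous_map (top_of_set (I \<times> W)) euclidean f"
  proof (rule pasting_lemma_closed[where I = C and T = ?T and f = "\<lambda>_. f"])
    show "finite C"
      using finite_cells C(1) finite_subset by blast
    show "\<exists>c. c \<in> C \<and> z \<in> ?T c \<and> f z = f z" if "z \<in> topspace (top_of_set (I \<times> W))" for z
      using that C(2) by force
    fix c assume c: "c \<in> C"
    then show "closedin (top_of_set (I \<times> W)) (?T c)"
      using closedin_cell[of c] W C(1)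
      by (intro continuous_closedin_preimage_gen[of _ _ M]) (auto intro!: continuous_intros)
    have "I \<times> (W \<inter> c) = ?T c"
      by auto
    then show "continuous_map (subtopology (top_of_set (I \<times> W)) (?T c)) euclidean f"
      using cont[OF c] by (simp add: subtopology_subtopology)
  qed simp
  then show ?thesis
    by simp
qed

lemma cell_contraction:
  assumes "c \<in> cells" "v \<in> c"
  obtains r :: "real \<times> 'a \<Rightarrow> 'a" where "continuous_on ({0..1} \<times> c) r" "r ` ({0..1} \<times> c) \<subseteq> c"
    "\<And>y. y \<in> c \<Longrightarrow> r (0, y) = y" "\<And>y. y \<in> c \<Longrightarrow> r (1, y) = v" "\<And>s. r (s, v) = v"
proof -
  obtain K :: "(real ^ 'n) set" and h g where K: "convex K" "homeomorphism K c h g"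
    using cell_homeomorphic_convex[OF assms(1)] by metis
  have h: "continuous_on K h" "h ` K = c" "\<And>y. y \<in> c \<Longrightarrow> h (g y) = y" and g: "continuous_on c g" "g ` c = K"
    using K(2) by (auto simp: homeomorphism_def)
  define segment where "segment z = (1 - fst z) *\<^sub>R g (snd z) + fst z *\<^sub>R g v" for z :: "real \<times> 'a"
  have segment: "segment z \<in> K" if "z \<in> {0..1} \<times> c" for z
    unfolding segment_def using that g(2) assms(2) by (intro convexD[OF K(1)]) auto
  show thesis
  proof (rule that)
    have "continuous_on ({0..1} \<times> c) (\<lambda>z. g (snd z))"
      by (rule continuous_on_compose2[OF g(1)]) (auto intro!: continuous_intros)
    then have "continuous_on ({0..1} \<times> c) segment"
      unfolding segment_def by (intro continuous_intros)
    then show "continuous_on ({0..1} \<times> c) (\<lambda>z. h (segment z))"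
      using segment by (intro continuous_on_compose2[OF h(1)]) auto
    show "(\<lambda>z. h (segment z)) ` ({0..1} \<times> c) \<subseteq> c"
      using segment h(2) by blast
    show "h (segment (0, y)) = y" "h (segment (1, y)) = v" if "y \<in> c" for y
      using h(3) that assms(2) by (simp_all add: segment_def)
    show "h (segment (s, v)) = v" for s
      using h(3)[OF assms(2)] by (simp add: segment_def flip: scaleR_left_distrib)
  qed
qed

subsection \<open>Carriers\<close>

lemma cell_boundary_subset: "cell_boundary X k c \<subseteq> c"
  by (auto simp: cell_boundary_def)

lemma carrier_cell_unique:
  "x \<in> M \<Longrightarrow> \<exists>!c. \<exists>k. c \<in> X k \<and> x \<in> c - cell_boundary X k c"
  using embedded by (simp add: embedded_cell_complex_def)

lemma carrier_cell_eq:
  assumes "c \<in> X k" "x \<in> c - cell_boundary X k c"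
  shows "carrier_cell x = c"
proof -
  have "x \<in> M"
    using assms cell_subset by blast
  then show ?thesis
    unfolding carrier_cell_def using assms by (intro the1_equality carrier_cell_unique) auto
qed

lemma carrier_cell:
  assumes "x \<in> M"
  shows "carrier_cell x \<in> cells" "x \<in> carrier_cell x"
  using theI'[OF carrier_cell_unique[OF assms]] unfolding carrier_cell_def by blast+

lemma carrier_cell_face:
  assumes "c \<in> X k" "x \<in> c"
  shows "carrier_cell x \<subseteq> c \<and> (\<exists>j\<le>k. carrier_cell x \<in> X j \<and> x \<in> carrier_cell x - cell_boundary X j (carrier_cell x))"
  using assms
proof (induction k arbitrary: c rule: less_induct)
  case (less k)
  show ?case
  proof (cases "x \<in> cell_boundary X k c")
    case False
    then have "carrier_cell x = c"
      using less.prems carrier_cell_eq by blast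
    then show ?thesis
      using less.prems False by auto
  next
    case True
    then obtain d j where "j < k" "d \<in> X j" "d \<subseteq> c" "x \<in> d"
      by (auto simp: cell_boundary_def)
    then show ?thesis
      using less.IH[of j d] by (meson less_imp_le_nat order_trans)
  qed
qed

lemma carrier_cell_subset: "c \<in> cells \<Longrightarrow> x \<in> c \<Longrightarrow> carrier_cell x \<subseteq> c"
  using carrier_cell_face by blast

lemma carrier_cell_boundary:
  assumes "x \<in> cell_boundary X k c"
  obtains j where "j < k" "carrier_cell x \<in> X j" "carrier_cell x \<subseteq> c"
proof -
  obtain d j where "j < k" "d \<in> X j" "d \<subseteq> c" "x \<in> d"
    using assms by (auto simp: cell_boundary_def)
  then show thesis
    using that carrier_cell_face[of d j x] by (meson le_less_trans order_trans)
qed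

lemma carrier_cell_upward_nbhd:
  assumes "x \<in> M"
  obtains W where "openin (top_of_set M) W" "x \<in> W" "\<And>y. y \<in> W \<Longrightarrow> carrier_cell x \<subseteq> carrier_cell y"
proof -
  define B where "B = {c \<in> cells. x \<notin> c}"
  have "finite B"
    unfolding B_def using finite_cells by (rule rev_finite_subset) blast
  then have "closedin (top_of_set M) (\<Union>B)"
    by (rule closedin_Union) (auto simp: B_def intro: closedin_cell)
  then have "openin (top_of_set M) (M - \<Union>B)"
    by (intro openin_diff) auto
  moreover have "x \<in> M - \<Union>B"
    using assms by (auto simp: B_def)
  moreover have "carrier_cell x \<subseteq> carrier_cell y" if "y \<in> M - \<Union>B" for y
  proof -
    have "x \<in> carrier_cell y"
      using that carrier_cell[of y] unfolding B_def by blast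
    then show ?thesis
      using that carrier_cell(1) carrier_cell_subset by blast
  qed
  ultimately show thesis
    using that by blast
qed

lemma zero_cell_singleton:
  assumes "c \<in> X 0"
  obtains v where "c = {v}"
proof -
  obtain V :: "(real ^ 'n) set" and h g where V: "subspace V" "dim V = 0" "homeomorphism (V \<inter> cball 0 1) c h g"
    using cell_ball[OF assms] by metis
  then have "V = {0}"
    using dim_eq_0 subspace_0 by blast
  then have "c = h ` ({0} \<inter> cball 0 1)"
    using V by (simp add: homeomorphism_def)
  then show thesis
    using that by auto
qed

lemma carrier_cell_vertex: "{v} \<in> X 0 \<Longrightarrow> carrier_cell v = {v}"
  by (rule carrier_cell_eq[of _ 0]) (auto simp: cell_boundary_def)

lemma vertices_vertex: "{v} \<in> X 0 \<Longrightarrow> vertices {v} = {v}"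
  by (auto simp: vertices_def)

lemma vertices_mono: "c \<subseteq> d \<Longrightarrow> vertices c \<subseteq> vertices d"
  by (auto simp: vertices_def)

subsection \<open>Boundary spheres\<close>

lemma cell_boundary_sphere:
  assumes "c \<in> X k"
  obtains S :: "(real ^ 'n) set" and h g where "homeomorphism S (cell_boundary X k c) h g"
    "1 \<le> k \<Longrightarrow> S \<noteq> {}" "2 \<le> k \<Longrightarrow> connected S" "3 \<le> k \<Longrightarrow> simply_connected S"
proof -
  obtain V :: "(real ^ 'n) set" and h g where V: "subspace V" "dim V = k"
    "homeomorphism (V \<inter> cball 0 1) c h g" "h ` (V \<inter> sphere 0 1) = cell_boundary X k c"
    using cell_ball[OF assms] by metis
  let ?K = "cball 0 1 \<inter> V"
  have interior: "interior (cball 0 1) \<inter> V \<noteq> {}"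
    using subspace_0[OF V(1)] by (force simp: interior_cball)
  have K: "convex ?K" "bounded ?K"
    using V(1) by (auto intro!: convex_Int simp: bounded_Int subspace_imp_convex)
  have "V \<inter> sphere 0 1 = rel_frontier ?K"
    using interior V(1) by (subst convex_affine_rel_frontier_Int) (auto simp: subspace_imp_affine)
  moreover have "aff_dim ?K = k"
    using V interior by (metis Int_commute aff_dim_convex_Int_nonempty_interior aff_dim_subspace subspace_imp_convex)
  ultimately have "2 \<le> k \<Longrightarrow> connected (V \<inter> sphere 0 1)" "3 \<le> k \<Longrightarrow> simply_connected (V \<inter> sphere 0 1)"
    using K by (auto intro!: connected_sphere_gen simply_connected_sphere_gen)
  moreover have "V \<inter> sphere 0 1 \<noteq> {}" if "1 \<le> k"
  proof -
    obtain a where "a \<in> V" "a \<noteq> 0"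
      using V(2) \<open>1 \<le> k\<close> dim_eq_0[of V] by auto
    then have "a /\<^sub>R norm a \<in> V \<inter> sphere 0 1"
      using V(1) by (auto simp: subspace_mul)
    then show ?thesis
      by blast
  qed
  moreover have "homeomorphism (V \<inter> sphere 0 1) (cell_boundary X k c) h g"
    by (rule homeomorphism_of_subsets[OF V(3) _ empty_subsetI V(4)]) auto
  ultimately show thesis
    using that by blast
qed

lemma connected_cell_boundary:
  assumes "c \<in> X k" "2 \<le> k"
  shows "connected (cell_boundary X k c)"
  using cell_boundary_sphere[OF assms(1)] assms(2) by (metis connected_continuous_image homeomorphism_def)

lemma cell_boundary_homotopic_paths:
  assumes "c \<in> X k" "3 \<le> k"
    and "path p" "path_image p \<subseteq> cell_boundary X k c" "path q" "path_image q \<subseteq> cell_boundary X k c"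
    and "pathstart p = pathstart q" "pathfinish p = pathfinish q"
  shows "homotopic_paths (cell_boundary X k c) p q"
proof -
  obtain S :: "(real ^ 'n) set" and h g where S: "homeomorphism S (cell_boundary X k c) h g" "simply_connected S"
    using cell_boundary_sphere[OF assms(1)] assms(2) by metis
  show ?thesis
    by (rule homotopic_paths_homeomorphic_simply_connected[OF S(2,1) assms(3-)])
qed

lemma cell_boundary_nonempty: "c \<in> X k \<Longrightarrow> 0 < k \<Longrightarrow> cell_boundary X k c \<noteq> {}"
  by (rule cell_boundary_sphere) (auto simp: homeomorphism_def)

lemma vertices_subset_cell_boundary: "0 < k \<Longrightarrow> vertices c \<subseteq> cell_boundary X k c"
  by (force simp: vertices_def cell_boundary_def)

lemma vertices_nonempty:
  assumes "c \<in> cells"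
  shows "vertices c \<noteq> {}"
proof -
  have "vertices c \<noteq> {}" if "c \<in> X k" for k
    using that
  proof (induction k arbitrary: c rule: less_induct)
    case (less k)
    show ?case
    proof (cases "k = 0")
      case True
      with less.prems zero_cell_singleton show ?thesis
        by (auto simp: vertices_def)
    next
      case False
      then obtain d j where "j < k" "d \<in> X j" "d \<subseteq> c"
        using cell_boundary_nonempty[of c k] less.prems by (auto simp: cell_boundary_def)
      then show ?thesis
        using less.IH[of j d] vertices_mono by blast
    qed
  qed
  then show ?thesis
    using assms by blast
qed

subsection \<open>Edges\<close>

lemma edge_arcE:
  assumes "e \<in> X 1"
  obtains p where "arc p" "path_image p = e" "vertices e = {pathstart p, pathfinish p}"
proof -
  obtain V :: "(real ^ 'n) set" and h g where V: "subspace V" "dim V = 1"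
    "homeomorphism (V \<inter> cball 0 1) e h g" "h ` (V \<inter> sphere 0 1) = cell_boundary X 1 e"
    using cell_ball[OF assms] by metis
  obtain b where b: "norm b = 1" "V \<inter> sphere 0 1 = {b, - b}" "V \<inter> cball 0 1 = closed_segment b (- b)"
    using one_dim_subspace_unit_ball[OF V(1,2)] .
  have h: "continuous_on (closed_segment b (- b)) h" "h ` closed_segment b (- b) = e"
    "inj_on h (closed_segment b (- b))"
    using V(3) unfolding b(3) by (auto simp: homeomorphism_def intro: inj_on_inverseI)
  show thesis
  proof (rule that)
    have "b \<noteq> - b"
    proof
      assume "b = - b"
      then have "2 *\<^sub>R b = 0"
        by (metis scaleR_2 add.right_inverse)
      then show False
        using b(1) by simp
    qed
    then have "inj_on (linepath b (- b)) {0..1}"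
      by (intro arc_imp_inj_on arc_linepath)
    then show "arc (h \<circ> linepath b (- b))"
      using h by (auto simp: arc_def path_continuous_image linepath_image_01 intro!: comp_inj_on)
    show "path_image (h \<circ> linepath b (- b)) = e"
      using h(2) by (simp add: path_image_compose)
    have "cell_boundary X 1 e \<subseteq> vertices e"
      by (auto simp: cell_boundary_def vertices_def elim: zero_cell_singleton)
    then have "vertices e = h ` {b, - b}"
      using vertices_subset_cell_boundary[of 1 e] V(4) b(2) by auto
    then show "vertices e = {pathstart (h \<circ> linepath b (- b)), pathfinish (h \<circ> linepath b (- b))}"
      by (simp add: pathstart_compose pathfinish_compose)
  qed
qed

lemma card_vertices_edge:
  assumes "e \<in> X 1"
  shows "card (vertices e) = 2"
  using edge_arcE[OF assms] arc_distinct_ends by (metis card_2_iff)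

lemma edge_infinite: "e \<in> X 1 \<Longrightarrow> infinite e"
proof (rule edge_arcE)
  fix p assume "arc p" "path_image p = e"
  then show "infinite e"
    using finite_imageD[of p "{0..1::real}"] by (auto simp: arc_def path_image_def infinite_Icc)
qed

lemma edge_arc:
  assumes "e \<in> X 1" "v \<in> vertices e" "u \<in> vertices e" "u \<noteq> v"
  shows "arc (edge_arc e v u)" "path_image (edge_arc e v u) = e"
    "pathstart (edge_arc e v u) = v" "pathfinish (edge_arc e v u) = u"
proof -
  obtain p where p: "arc p" "path_image p = e" "vertices e = {pathstart p, pathfinish p}"
    using edge_arcE[OF assms(1)] by metis
  have "\<exists>p. arc p \<and> path_image p = e \<and> pathstart p = v \<and> pathfinish p = u"
  proof (cases "pathstart p = v")
    case True
    then show ?thesis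
      using p assms by auto
  next
    case False
    then show ?thesis
      using p assms by (intro exI[of _ "reversepath p"]) (auto simp: arc_reversepath)
  qed
  then have "arc (edge_arc e v u) \<and> path_image (edge_arc e v u) = e \<and>
      pathstart (edge_arc e v u) = v \<and> pathfinish (edge_arc e v u) = u"
    unfolding edge_arc_def by (rule someI_ex)
  then show "arc (edge_arc e v u)" "path_image (edge_arc e v u) = e"
    "pathstart (edge_arc e v u) = v" "pathfinish (edge_arc e v u) = u"
    by auto
qed

lemma carrier_cell_edge:
  assumes "e \<in> X 1" "x \<in> e"
  shows "carrier_cell x = e \<or> {x} \<in> X 0"
proof (cases "x \<in> cell_boundary X 1 e")
  case True
  then have "carrier_cell x \<in> X 0"
    using carrier_cell_boundary by (metis less_one)
  moreover have "x \<in> carrier_cell x"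
    using carrier_cell(2) cell_subset assms by blast
  ultimately show ?thesis
    by (metis singletonD zero_cell_singleton)
next
  case False
  then show ?thesis
    using carrier_cell_eq[OF assms(1)] assms(2) by blast
qed

lemma edge_subset_edge:
  assumes "e \<in> X 1" "e' \<in> X 1" "e \<subseteq> e'"
  shows "e = e'"
proof (rule ccontr)
  assume "e \<noteq> e'"
  have "e \<subseteq> vertices e'"
  proof
    fix x assume "x \<in> e"
    then have "x \<in> e'" "{x} \<in> X 0"
      using carrier_cell_edge[OF assms(1)] carrier_cell_edge[OF assms(2)] assms(3) \<open>e \<noteq> e'\<close> by (metis subsetD)+
    then show "x \<in> vertices e'"
      by (simp add: vertices_def)
  qed
  moreover have "finite (vertices e')"
    using card_vertices_edge[OF assms(2)] by (metis card.infinite zero_neq_numeral)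
  ultimately show False
    using edge_infinite[OF assms(1)] finite_subset by blast
qed

subsection \<open>Edge paths\<close>

lemma edge_path_vertices: "edge_path X v es w \<Longrightarrow> {v} \<in> X 0 \<and> {w} \<in> X 0"
  by (induction X v es w rule: edge_path.induct) auto

lemma edge_path_edges: "edge_path X u es v \<Longrightarrow> fst ` set es \<subseteq> X 1"
  by (induction X u es v rule: edge_path.induct) auto

lemma edge_path_append:
  "edge_path X u es v \<Longrightarrow> edge_path X v es' w \<Longrightarrow> edge_path X u (es @ es') w"
  by (induction X u es v rule: edge_path.induct) auto

lemma edge_path_ConsE:
  assumes "edge_path X v (s # es) w"
  obtains e u where "s = (e, u)" "e \<in> X 1" "v \<in> vertices e" "u \<in> vertices e" "u \<noteq> v" "edge_path X u es w"
  using assms edge_path_vertices by (cases s) (auto simp: vertices_def)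

lemma realization_path:
  assumes "edge_path X v es w"
  shows "path (realization v es)" "pathstart (realization v es) = v" "pathfinish (realization v es) = w"
    "path_image (realization v es) = insert v (\<Union>(fst ` set es))"
proof -
  have "path (realization v es) \<and> pathstart (realization v es) = v \<and> pathfinish (realization v es) = w \<and>
      path_image (realization v es) = insert v (\<Union>(fst ` set es))"
    using assms
  proof (induction es arbitrary: v)
    case Nil
    then show ?case
      by (simp add: path_constant pathstart_constant pathfinish_constant)
  next
    case (Cons s es)
    then obtain e u where s: "s = (e, u)" and e: "e \<in> X 1" "v \<in> vertices e" "u \<in> vertices e" "u \<noteq> v"
      and es: "edge_path X u es w"
      by (elim edge_path_ConsE)
    show ?case
      using Cons.IH[OF es] edge_arc[OF e] s e(2,3) by (auto simp: arc_imp_path path_image_join vertices_def)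
  qed
  then show "path (realization v es)" "pathstart (realization v es) = v" "pathfinish (realization v es) = w"
    "path_image (realization v es) = insert v (\<Union>(fst ` set es))"
    by auto
qed

lemma realization_append:
  assumes "edge_path X u es v" "edge_path X v es' w"
    and "path_image (realization u es) \<subseteq> S" "path_image (realization v es') \<subseteq> S"
  shows "homotopic_paths S (realization u es +++ realization v es') (realization u (es @ es'))"
  using assms
proof (induction es arbitrary: u)
  case Nil
  then show ?case
    using homotopic_paths_join_constant(2)[of "realization v es'" S] realization_path[OF Nil.prems(2)] by simp
next
  case (Cons s es)
  then obtain e x where s: "s = (e, x)" and e: "e \<in> X 1" "u \<in> vertices e" "x \<in> vertices e" "x \<noteq> u"
    and es: "edge_path X x es v"
    by (elim edge_path_ConsE)
  note arc = edge_arc[OF e]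
  note r = realization_path[OF es] and r' = realization_path[OF Cons.prems(2)]
  have sub: "e \<subseteq> S" "path_image (realization x es) \<subseteq> S"
    using Cons.prems(3) arc r by (auto simp: s path_image_join arc_imp_path)
  have "homotopic_paths S ((edge_arc e u x +++ realization x es) +++ realization v es')
      (edge_arc e u x +++ (realization x es +++ realization v es'))"
    using r r' arc sub Cons.prems(4)
    by (intro homotopic_paths_sym[OF homotopic_paths_assoc]) (auto simp: arc_imp_path)
  also have "homotopic_paths S \<dots> (edge_arc e u x +++ realization x (es @ es'))"
    using Cons.IH[OF es Cons.prems(2) sub(2) Cons.prems(4)] arc r sub(1)
    by (intro homotopic_paths_join) (auto simp: arc_imp_path)
  finally show ?case
    using s by simp
qed

lemma connected_carriers_induct:
  assumes B: "connected B" "B \<subseteq> M" and uw: "u \<in> vertices B" "w \<in> vertices B"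
    and carriers: "\<And>x a b. x \<in> B \<Longrightarrow> a \<in> vertices (carrier_cell x) \<Longrightarrow> b \<in> vertices (carrier_cell x) \<Longrightarrow> J a b"
    and trans: "\<And>a b c. J a b \<Longrightarrow> J b c \<Longrightarrow> J a c"
  shows "J u w"
proof -
  define R where "R x y \<longleftrightarrow>
    (\<forall>a\<in>vertices (carrier_cell x). \<forall>b\<in>vertices (carrier_cell y). J a b \<and> J b a)" for x y
  have "R u w"
  proof (rule connected_equivalence_relation[OF B(1)])
    show "u \<in> B" "w \<in> B"
      using uw by (auto simp: vertices_def)
    show "R y x" if "R x y" for x y
      using that by (auto simp: R_def)
    show "R x z" if "R x y" "R y z" "y \<in> B" for x y z
    proof -
      have "vertices (carrier_cell y) \<noteq> {}"
        using that(3) B(2) carrier_cell(1) vertices_nonempty by blast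
      then show ?thesis
        using that(1,2) trans unfolding R_def by (metis ex_in_conv)
    qed
    fix x assume x: "x \<in> B"
    then obtain W where W: "openin (top_of_set M) W" "x \<in> W" "\<And>y. y \<in> W \<Longrightarrow> carrier_cell x \<subseteq> carrier_cell y"
      using carrier_cell_upward_nbhd B(2) by blast
    have "R x y" if "y \<in> B \<inter> W" for y
      using that W(3)[of y] vertices_mono[of "carrier_cell x" "carrier_cell y"] carriers[of y]
      unfolding R_def by blast
    moreover obtain G where "open G" "W = M \<inter> G"
      using W(1) unfolding openin_open by blast
    then have "openin (top_of_set B) (B \<inter> W)"
      using B(2) unfolding openin_open by blast
    ultimately show "\<exists>T. openin (top_of_set B) T \<and> x \<in> T \<and> (\<forall>y\<in>T. R x y)"
      using x W(2) by blast
  qed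
  then show ?thesis
    using uw carrier_cell_vertex vertices_vertex by (simp add: R_def vertices_def)
qed

definition edge_connected_in :: "'a set \<Rightarrow> 'a \<Rightarrow> 'a \<Rightarrow> bool" where
  "edge_connected_in c u w \<longleftrightarrow> (\<exists>es. edge_path X u es w \<and> \<Union>(fst ` set es) \<subseteq> c)"

lemma edge_connected_in_trans:
  assumes "edge_connected_in c u v" "edge_connected_in c v w"
  shows "edge_connected_in c u w"
proof -
  obtain es where "edge_path X u es v" "\<Union>(fst ` set es) \<subseteq> c"
    using assms(1) unfolding edge_connected_in_def by blast
  moreover obtain es' where "edge_path X v es' w" "\<Union>(fst ` set es') \<subseteq> c"
    using assms(2) unfolding edge_connected_in_def by blast
  ultimately show ?thesis
    unfolding edge_connected_in_def by (intro exI[of _ "es @ es'"]) (auto intro: edge_path_append)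
qed

lemma edge_connected_in_mono: "edge_connected_in c u w \<Longrightarrow> c \<subseteq> d \<Longrightarrow> edge_connected_in d u w"
  unfolding edge_connected_in_def by blast

lemma edge_connected_in_cell_step:
  assumes c: "c \<in> X k" "2 \<le> k" "u \<in> vertices c" "w \<in> vertices c"
    and faces: "\<And>j d a b. j < k \<Longrightarrow> d \<in> X j \<Longrightarrow> a \<in> vertices d \<Longrightarrow> b \<in> vertices d \<Longrightarrow> edge_connected_in d a b"
  shows "edge_connected_in c u w"
proof (rule connected_carriers_induct[OF connected_cell_boundary[OF c(1,2)]])
  show "cell_boundary X k c \<subseteq> M"
    using cell_subset c(1) cell_boundary_subset by blast
  show "u \<in> vertices (cell_boundary X k c)" "w \<in> vertices (cell_boundary X k c)"
    using c vertices_subset_cell_boundary[of k c] by (auto simp: vertices_def)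
  show "edge_connected_in c a b"
    if "x \<in> cell_boundary X k c" and ab: "a \<in> vertices (carrier_cell x)" "b \<in> vertices (carrier_cell x)" for x a b
  proof -
    obtain j where "j < k" "carrier_cell x \<in> X j" "carrier_cell x \<subseteq> c"
      using carrier_cell_boundary \<open>x \<in> cell_boundary X k c\<close> .
    then show ?thesis
      using edge_connected_in_mono[OF faces[OF _ _ ab]] by blast
  qed
qed (rule edge_connected_in_trans)

lemma edge_connected_in_cell:
  assumes "c \<in> cells" "u \<in> vertices c" "w \<in> vertices c"
  shows "edge_connected_in c u w"
proof -
  have "edge_connected_in c u w" if "c \<in> X k" "u \<in> vertices c" "w \<in> vertices c" for k c u w
    using that
  proof (induction k arbitrary: c u w rule: less_induct)
    case (less k)
    consider "k = 0 \<or> u = w" | "k = 1" "u \<noteq> w" | "2 \<le> k"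
      by linarith
    then show ?case
    proof cases
      case 1
      then have "u = w"
        using less.prems zero_cell_singleton[of c] by (auto simp: vertices_def)
      then show ?thesis
        using less.prems unfolding edge_connected_in_def by (intro exI[of _ "[]"]) (auto simp: vertices_def)
    next
      case 2
      then show ?thesis
        using less.prems unfolding edge_connected_in_def by (intro exI[of _ "[(c, w)]"]) (auto simp: vertices_def)
    next
      case 3
      then show ?thesis
        using edge_connected_in_cell_step less by blast
    qed
  qed
  then show ?thesis
    using assms by blast
qed

lemma cell_edge_connected:
  assumes "c \<in> cells" "u \<in> vertices c" "w \<in> vertices c"
  obtains es where "edge_path X u es w" "\<Union>(fst ` set es) \<subseteq> c"
  using edge_connected_in_cell[OF assms] unfolding edge_connected_in_def by blast

end

section \<open>Approximation of paths by edge paths\<close>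

context cell_complex
begin

definition edge_path_approximable :: "(real \<Rightarrow> 'a) \<Rightarrow> bool" where
  "edge_path_approximable p \<longleftrightarrow> (\<exists>es \<beta>. edge_path X (pathstart p) es (pathstart \<beta>) \<and>
     path \<beta> \<and> path_image \<beta> \<subseteq> carrier_cell (pathfinish p) \<and>
     homotopic_paths M p (realization (pathstart p) es +++ \<beta>))"

lemma edge_path_approximable_homotopic:
  assumes "edge_path_approximable p" "homotopic_paths M p q"
  shows "edge_path_approximable q"
  using assms homotopic_paths_imp_pathstart[OF assms(2)] homotopic_paths_imp_pathfinish[OF assms(2)]
  unfolding edge_path_approximable_def by (metis homotopic_paths_sym homotopic_paths_trans)

lemma edge_path_approximable_vertex:
  assumes "{v} \<in> X 0"
  shows "edge_path_approximable (\<lambda>_. v)"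
proof -
  have "v \<in> M"
    using assms cell_subset by blast
  then have "homotopic_paths M (\<lambda>_. v) ((\<lambda>_. v) +++ (\<lambda>_. v))"
    using homotopic_paths_join_constant(1)[of "\<lambda>_. v" M, THEN homotopic_paths_sym]
    by (simp add: path_constant pathfinish_constant)
  then show ?thesis
    unfolding edge_path_approximable_def using assms
    by (intro exI[of _ "[]"] exI[of _ "\<lambda>_. v"])
      (simp add: path_constant pathstart_constant pathfinish_constant carrier_cell_vertex)
qed

lemma cell_path_edge_path:
  assumes c: "c \<in> cells" and q: "path q" "path_image q \<subseteq> c" "{pathstart q} \<in> X 0"
  obtains es \<beta> where "edge_path X (pathstart q) es (pathstart \<beta>)" "path \<beta>" "path_image \<beta> \<subseteq> carrier_cell (pathfinish q)"
    "homotopic_paths c q (realization (pathstart q) es +++ \<beta>)"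
proof -
  let ?y = "pathfinish q"
  have y: "?y \<in> c" and start: "pathstart q \<in> vertices c"
    using q by (auto simp: vertices_def)
  then have d: "carrier_cell ?y \<in> cells" "?y \<in> carrier_cell ?y" "carrier_cell ?y \<subseteq> c"
    using carrier_cell[of ?y] cell_subset[OF c] carrier_cell_subset[OF c y] by auto
  obtain b where b: "b \<in> vertices (carrier_cell ?y)"
    using vertices_nonempty[OF d(1)] by blast
  then obtain \<beta> where \<beta>: "path \<beta>" "path_image \<beta> \<subseteq> carrier_cell ?y" "pathstart \<beta> = b" "pathfinish \<beta> = ?y"
    using path_connected_cell[OF d(1)] d(2) unfolding path_connected_def vertices_def by blast
  obtain es where es: "edge_path X (pathstart q) es b" "\<Union>(fst ` set es) \<subseteq> c"
    using cell_edge_connected[OF c start] b vertices_mono[OF d(3)] by blast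
  note r = realization_path[OF es(1)]
  have "homotopic_paths c q (realization (pathstart q) es +++ \<beta>)"
    using q \<beta> r es(2) d(3) start
    by (intro cell_homotopic_paths[OF c]) (auto simp: path_image_join vertices_def)
  then show thesis
    using that es(1) \<beta> by blast
qed

lemma edge_path_approximable_join:
  assumes p: "edge_path_approximable p" and pq: "pathfinish p = pathstart q"
    and c: "c \<in> cells" and q': "path_image q' \<subseteq> c" "homotopic_paths M q q'"
  shows "edge_path_approximable (p +++ q)"
proof -
  obtain es \<beta> where es: "edge_path X (pathstart p) es (pathstart \<beta>)"
    and \<beta>: "path \<beta>" "path_image \<beta> \<subseteq> carrier_cell (pathfinish p)"
    and hom: "homotopic_paths M p (realization (pathstart p) es +++ \<beta>)"
    using p unfolding edge_path_approximable_def by blast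
  have ends: "path q'" "pathstart q' = pathstart q" "pathfinish q' = pathfinish q" "pathfinish \<beta> = pathfinish p"
    using q'(2) hom homotopic_paths_imp_path homotopic_paths_imp_pathstart homotopic_paths_imp_pathfinish
    by (metis pathfinish_join)+
  have "pathfinish p \<in> c"
    using ends(2) pq q'(1) pathstart_in_path_image by fastforce
  then have in_c: "path_image (\<beta> +++ q') \<subseteq> c"
    using \<beta>(2) carrier_cell_subset[OF c] q'(1) ends pq by (auto simp: path_image_join)
  obtain es' \<beta>' where es': "edge_path X (pathstart \<beta>) es' (pathstart \<beta>')"
    and \<beta>': "path \<beta>'" "path_image \<beta>' \<subseteq> carrier_cell (pathfinish q)"
    and hom': "homotopic_paths c (\<beta> +++ q') (realization (pathstart \<beta>) es' +++ \<beta>')"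
    using cell_path_edge_path[OF c _ in_c] \<beta>(1) ends pq edge_path_vertices[OF es] by auto
  have cM: "c \<subseteq> M"
    by (rule cell_subset[OF c])
  note r = realization_path[OF es] and r' = realization_path[OF es']
  have sub: "path_image (realization (pathstart p) es) \<subseteq> M" "path_image \<beta> \<subseteq> M" "path_image q' \<subseteq> M"
    "path_image (realization (pathstart \<beta>) es') \<subseteq> M" "path_image \<beta>' \<subseteq> M"
    using homotopic_paths_imp_subset[OF hom] homotopic_paths_imp_subset[OF hom'] in_c cM r r' \<beta> ends pq
    by (auto simp: path_image_join)
  have "homotopic_paths M (p +++ q) ((realization (pathstart p) es +++ \<beta>) +++ q')"
    using hom q'(2) pq by (intro homotopic_paths_join)
  also have "homotopic_paths M \<dots> (realization (pathstart p) es +++ (\<beta> +++ q'))"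
    using r \<beta> ends pq sub by (intro homotopic_paths_sym[OF homotopic_paths_assoc]) auto
  also have "homotopic_paths M \<dots> (realization (pathstart p) es +++ (realization (pathstart \<beta>) es' +++ \<beta>'))"
    using r sub ends pq by (intro homotopic_paths_join homotopic_paths_subset[OF hom' cM]) auto
  also have "homotopic_paths M \<dots> ((realization (pathstart p) es +++ realization (pathstart \<beta>) es') +++ \<beta>')"
    using r r' \<beta>' sub by (intro homotopic_paths_assoc) auto
  also have "homotopic_paths M \<dots> (realization (pathstart p) (es @ es') +++ \<beta>')"
    using realization_append[OF es es'] sub r' \<beta>' by (intro homotopic_paths_join) auto
  finally show ?thesis
    unfolding edge_path_approximable_def using edge_path_append[OF es es'] \<beta>' by auto
qed

lemma cell_path_connected_nbhd:
  assumes c: "c \<in> cells" "x \<in> c" and B: "openin (top_of_set M) B" "x \<in> B"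
  shows "\<exists>V. openin (top_of_set M) V \<and> x \<in> V \<and> path_connected (V \<inter> c) \<and> V \<inter> c \<subseteq> B"
proof -
  have cM: "c \<subseteq> M"
    by (rule cell_subset[OF c(1)])
  then have "openin (top_of_set c) (c \<inter> B)"
    using B(1) unfolding openin_open by blast
  then obtain V where V: "openin (top_of_set c) V" "path_connected V" "x \<in> V" "V \<subseteq> c \<inter> B"
    using cell_locally_path_connected[OF c(1)] B(2) c(2) by blast
  then obtain G where "open G" "V = c \<inter> G"
    by (auto simp: openin_open)
  moreover from this have "M \<inter> G \<inter> c = V"
    using cM by blast
  ultimately show ?thesis
    using V c cM by (intro exI[of _ "M \<inter> G"]) (auto simp: openin_open)
qed

lemma cells_path_joined_nbhd:
  assumes B: "openin (top_of_set M) B" "x \<in> B"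
  obtains U where "openin (top_of_set M) U" "x \<in> U" "U \<subseteq> B"
    "\<And>c y. c \<in> cells \<Longrightarrow> x \<in> c \<Longrightarrow> y \<in> U \<inter> c \<Longrightarrow>
       \<exists>q. path q \<and> path_image q \<subseteq> c \<inter> B \<and> pathstart q = x \<and> pathfinish q = y"
proof -
  define C where "C = {c \<in> cells. x \<in> c}"
  have C: "finite C" "C \<noteq> {}"
    unfolding C_def using finite_cells carrier_cell[of x] openin_imp_subset[OF B(1)] B(2)
    by (auto intro: rev_finite_subset)
  obtain V where V: "\<And>c. c \<in> C \<Longrightarrow> openin (top_of_set M) (V c) \<and> x \<in> V c \<and> path_connected (V c \<inter> c) \<and> V c \<inter> c \<subseteq> B"
    using cell_path_connected_nbhd[OF _ _ B] unfolding C_def by (metis (no_types, lifting) mem_Collect_eq)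
  show thesis
  proof (rule that)
    show "openin (top_of_set M) (B \<inter> (\<Inter>c\<in>C. V c))"
      using B(1) C V by (intro openin_Int openin_INT2) auto
    show "\<exists>q. path q \<and> path_image q \<subseteq> c \<inter> B \<and> pathstart q = x \<and> pathfinish q = y"
      if "c \<in> cells" "x \<in> c" "y \<in> B \<inter> (\<Inter>c\<in>C. V c) \<inter> c" for c y
    proof -
      have "c \<in> C"
        using that by (simp add: C_def)
      then have Vc: "path_connected (V c \<inter> c)" "V c \<inter> c \<subseteq> B" "x \<in> V c \<inter> c" "y \<in> V c \<inter> c"
        using V that by auto
      then obtain q where "path q" "path_image q \<subseteq> V c \<inter> c" "pathstart q = x" "pathfinish q = y"
        unfolding path_connected_def by blast
      then show ?thesis
        using Vc(2) by blast
    qed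
  qed (use B(2) V in auto)
qed

lemma path_homotopic_into_cell_nbhd:
  assumes M: "semilocally_simply_connected M" and x: "x \<in> M"
  obtains U where "openin (top_of_set M) U" "x \<in> U"
    "\<And>q. path q \<Longrightarrow> path_image q \<subseteq> U \<Longrightarrow> pathstart q = x \<Longrightarrow>
       \<exists>c\<in>cells. \<exists>q'. path_image q' \<subseteq> c \<and> homotopic_paths M q q'"
proof -
  obtain B where B: "openin (top_of_set M) B" "x \<in> B"
    and homotopic: "all_paths_homotopic_in M B"
    using M x unfolding semilocally_simply_connected_def by blast
  obtain U where U: "openin (top_of_set M) U" "x \<in> U" "U \<subseteq> B"
    and joined: "\<And>c y. c \<in> cells \<Longrightarrow> x \<in> c \<Longrightarrow> y \<in> U \<inter> c \<Longrightarrow>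
       \<exists>q. path q \<and> path_image q \<subseteq> c \<inter> B \<and> pathstart q = x \<and> pathfinish q = y"
    by (rule cells_path_joined_nbhd[OF B]) (rule that)
  obtain W where W: "openin (top_of_set M) W" "x \<in> W" "\<And>y. y \<in> W \<Longrightarrow> carrier_cell x \<subseteq> carrier_cell y"
    using carrier_cell_upward_nbhd[OF x] by blast
  show thesis
  proof (rule that)
    show "openin (top_of_set M) (U \<inter> W)" "x \<in> U \<inter> W"
      using U W by auto
    fix q assume q: "path q" "path_image q \<subseteq> U \<inter> W" "pathstart q = x"
    define y c where "y = pathfinish q" and "c = carrier_cell y"
    have y: "y \<in> U \<inter> W" "y \<in> M"
      using q(2) openin_imp_subset[OF U(1)] by (auto simp: y_def)
    have c: "c \<in> cells" "y \<in> c" "x \<in> c"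
      using carrier_cell[OF y(2)] W(3)[of y] y(1) carrier_cell(2)[OF x] by (auto simp: c_def)
    then obtain q' where q': "path q'" "path_image q' \<subseteq> c \<inter> B" "pathstart q' = x" "pathfinish q' = y"
      using joined y(1) by blast
    moreover have "path_image q \<subseteq> B"
      using q(2) U(3) by blast
    ultimately have "homotopic_paths M q q'"
      using q homotopic by (simp add: y_def all_paths_homotopic_in_def)
    then show "\<exists>c\<in>cells. \<exists>q'. path_image q' \<subseteq> c \<and> homotopic_paths M q q'"
      using c(1) q'(2) by blast
  qed
qed

lemma edge_path_approximable_segment_extend:
  assumes p: "path p" "path_image p \<subseteq> M" and st: "s \<in> {0..1}" "t \<in> {0..1}"
    and approximable: "edge_path_approximable (p \<circ> linepath 0 s)"
    and c: "c \<in> cells" "path_image q \<subseteq> c" "homotopic_paths M (p \<circ> linepath s t) q"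
  shows "edge_path_approximable (p \<circ> linepath 0 t)"
proof (rule edge_path_approximable_homotopic)
  show "edge_path_approximable ((p \<circ> linepath 0 s) +++ (p \<circ> linepath s t))"
    using approximable c by (intro edge_path_approximable_join) (auto simp: pathstart_compose pathfinish_compose)
  show "homotopic_paths M ((p \<circ> linepath 0 s) +++ (p \<circ> linepath s t)) (p \<circ> linepath 0 t)"
    using p st by (intro homotopic_paths_join_segments) auto
qed

lemma path_segments_homotopic_into_cell:
  assumes M: "semilocally_simply_connected M" and p: "path p" "path_image p \<subseteq> M" and t: "t \<in> {0..1}"
  obtains d where "d > 0" "\<And>s. s \<in> {0..1} \<Longrightarrow> \<bar>s - t\<bar> < d \<Longrightarrow>
    \<exists>c\<in>cells. \<exists>q. path_image q \<subseteq> c \<and> homotopic_paths M (p \<circ> linepath t s) q"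
proof -
  have "p t \<in> M"
    using p(2) t by (auto simp: path_image_def)
  then obtain U where U: "openin (top_of_set M) U" "p t \<in> U"
    and into_cell: "\<And>q. path q \<Longrightarrow> path_image q \<subseteq> U \<Longrightarrow> pathstart q = p t \<Longrightarrow>
      \<exists>c\<in>cells. \<exists>q'. path_image q' \<subseteq> c \<and> homotopic_paths M q q'"
    by (rule path_homotopic_into_cell_nbhd[OF M]) (rule that)
  obtain d where d: "d > 0" "\<And>s. s \<in> {0..1} \<Longrightarrow> \<bar>s - t\<bar> < d \<Longrightarrow> path_image (p \<circ> linepath t s) \<subseteq> U"
    using path_segment_in_nbhd[OF p t U] by blast
  have "\<exists>c\<in>cells. \<exists>q. path_image q \<subseteq> c \<and> homotopic_paths M (p \<circ> linepath t s) q"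
    if "s \<in> {0..1}" "\<bar>s - t\<bar> < d" for s
    using into_cell[OF _ d(2)[OF that]] path_segment[OF p(1) t that(1)] by blast
  then show thesis
    using that d(1) by blast
qed

lemma path_edge_path_approximable:
  assumes M: "semilocally_simply_connected M"
    and p: "path p" "path_image p \<subseteq> M" "{pathstart p} \<in> X 0"
  shows "edge_path_approximable p"
proof -
  define P where "P t = edge_path_approximable (p \<circ> linepath 0 t)" for t
  have "0 \<le> (0::real) \<and> 1 \<le> (1::real) \<longrightarrow> P 0 \<longrightarrow> P 1"
  proof (rule Bolzano[of 0 1 "\<lambda>a b. 0 \<le> a \<and> b \<le> 1 \<longrightarrow> P a \<longrightarrow> P b"])
    fix t :: real assume "0 \<le> t" "t \<le> 1"
    then have t: "t \<in> {0..1}"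
      by simp
    obtain d where d: "d > 0" and near: "\<And>s. s \<in> {0..1} \<Longrightarrow> \<bar>s - t\<bar> < d \<Longrightarrow>
        \<exists>c\<in>cells. \<exists>q. path_image q \<subseteq> c \<and> homotopic_paths M (p \<circ> linepath t s) q"
      by (rule path_segments_homotopic_into_cell[OF M p(1,2) t]) (rule that)
    have "P b" if ab: "a \<le> t \<and> t \<le> b \<and> b - a < d" "0 \<le> a \<and> b \<le> 1" and "P a" for a b
    proof -
      have I: "a \<in> {0..1}" "b \<in> {0..1}" "\<bar>a - t\<bar> < d" "\<bar>b - t\<bar> < d"
        using ab t by auto
      obtain c q where "c \<in> cells" "path_image (reversepath q) \<subseteq> c" "homotopic_paths M (p \<circ> linepath t a) q"
        using near[OF I(1,3)] by auto
      then have "P t"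
        using \<open>P a\<close> homotopic_paths_reversepath_D[of M "p \<circ> linepath t a" q] unfolding P_def
        by (intro edge_path_approximable_segment_extend[OF p(1,2) I(1) t])
          (auto simp: path_compose_reversepath[symmetric])
      moreover obtain c q where "c \<in> cells" "path_image q \<subseteq> c" "homotopic_paths M (p \<circ> linepath t b) q"
        using near[OF I(2,4)] by blast
      ultimately show ?thesis
        unfolding P_def by (intro edge_path_approximable_segment_extend[OF p(1,2) t I(2)])
    qed
    then show "\<exists>d>0. \<forall>a b. a \<le> t \<and> t \<le> b \<and> b - a < d \<longrightarrow> 0 \<le> a \<and> b \<le> 1 \<longrightarrow> P a \<longrightarrow> P b"
      using d by blast
  qed auto
  moreover have "p \<circ> linepath 0 0 = (\<lambda>_. pathstart p)" "p \<circ> linepath 0 1 = p"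
    by (auto simp: linepath_def pathstart_def)
  ultimately show ?thesis
    using edge_path_approximable_vertex[OF p(3)] by (simp add: P_def)
qed

theorem path_homotopic_realization:
  assumes "semilocally_simply_connected M" "path p" "path_image p \<subseteq> M"
    and "{pathstart p} \<in> X 0" "{pathfinish p} \<in> X 0"
  obtains es where "edge_path X (pathstart p) es (pathfinish p)" "homotopic_paths M p (realization (pathstart p) es)"
proof -
  obtain es \<beta> where es: "edge_path X (pathstart p) es (pathstart \<beta>)"
    and \<beta>: "path \<beta>" "path_image \<beta> \<subseteq> carrier_cell (pathfinish p)"
    and hom: "homotopic_paths M p (realization (pathstart p) es +++ \<beta>)"
    using path_edge_path_approximable[OF assms(1-4)] unfolding edge_path_approximable_def by blast
  note r = realization_path[OF es]
  have const: "\<beta> t = pathfinish p" if "t \<in> {0..1}" for t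
    using \<beta>(2) that carrier_cell_vertex[OF assms(5)] by (auto simp: path_image_def image_subset_iff)
  then have start: "pathstart \<beta> = pathfinish p"
    by (simp add: pathstart_def)
  have sub: "path_image (realization (pathstart p) es) \<subseteq> M" "path_image \<beta> \<subseteq> M"
    using homotopic_paths_imp_subset[OF hom] r by (auto simp: path_image_join)
  have "homotopic_paths M p (realization (pathstart p) es +++ (\<lambda>_. pathfinish p))"
    using hom r sub \<beta>(1) const by (elim homotopic_paths_trans) (intro homotopic_paths_join homotopic_paths_eq, auto)
  also have "homotopic_paths M \<dots> (realization (pathstart p) es)"
    using homotopic_paths_join_constant(1)[OF r(1) sub(1)] r(3) start by simp
  finally show thesis
    using that es start by simp
qed

end

section \<open>The 1-skeleton\<close>

locale graph_complex = cell_complex N M X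
  for N :: "'n::finite itself" and M :: "'a::topological_space set" and X :: "nat \<Rightarrow> 'a set set" +
  assumes dim_le_1: "c \<in> X k \<Longrightarrow> k \<le> 1"
begin

lemma cell_vertex_or_edge:
  assumes "c \<in> cells"
  obtains v where "c = {v}" "{v} \<in> X 0" | "c \<in> X 1"
proof -
  obtain k where "c \<in> X k" "k = 0 \<or> k = 1"
    using assms dim_le_1 by (metis UN_E le_less less_one)
  then show thesis
    using that zero_cell_singleton by metis
qed

lemma carrier_cell_eq_of_mem_carrier:
  assumes "c \<in> cells" "x \<in> c" "y \<in> c" "x \<in> carrier_cell y"
  shows "y = x \<or> carrier_cell y = c"
proof (cases "{y} \<in> X 0")
  case True
  then show ?thesis
    using carrier_cell_vertex assms(4) by auto
next
  case False
  then show ?thesis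
    using cell_vertex_or_edge[OF assms(1)] carrier_cell_edge assms(3) by (metis singletonD)
qed

lemma continuous_on_carrier_cell_glue:
  assumes W: "W \<subseteq> M" "\<And>y. y \<in> W \<Longrightarrow> v \<in> carrier_cell y"
    and r: "\<And>c. c \<in> cells \<Longrightarrow> v \<in> c \<Longrightarrow> continuous_on (I \<times> c) (r c)"
    and fixed: "\<And>c s. c \<in> cells \<Longrightarrow> v \<in> c \<Longrightarrow> r c (s, v) = v"
  shows "continuous_on (I \<times> W) (\<lambda>z. r (carrier_cell (snd z)) z)"
proof (rule continuous_on_times_cells[where C = "{c \<in> cells. v \<in> c}", OF W(1)])
  have carrier: "carrier_cell y \<in> cells" "v \<in> carrier_cell y" "y \<in> carrier_cell y" if "y \<in> W" for y
    using that W carrier_cell[of y] by auto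
  then show "W \<subseteq> \<Union>{c \<in> cells. v \<in> c}"
    by (intro subsetI UnionI[of "carrier_cell _"] CollectI conjI)
  fix c assume c: "c \<in> {c \<in> cells. v \<in> c}"
  have agree: "r c (s, y) = r (carrier_cell y) (s, y)" if "y \<in> W" "y \<in> c" for s y
  proof -
    have "y = v \<or> carrier_cell y = c"
      using that c W(2) by (intro carrier_cell_eq_of_mem_carrier) auto
    moreover have "r c (s, v) = v" "r (carrier_cell y) (s, v) = v"
      using fixed c carrier(1,2)[OF that(1)] by blast+
    ultimately show ?thesis
      by auto
  qed
  have "continuous_on (I \<times> (W \<inter> c)) (r c)"
    by (rule continuous_on_subset[of "I \<times> c"]) (use r c in auto)
  then show "continuous_on (I \<times> (W \<inter> c)) (\<lambda>z. r (carrier_cell (snd z)) z)"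
    by (rule continuous_on_eq) (use agree in auto)
qed auto

lemma vertex_star_contraction:
  assumes W: "W \<subseteq> M" "\<And>y. y \<in> W \<Longrightarrow> v \<in> carrier_cell y"
  obtains r :: "real \<times> 'a \<Rightarrow> 'a" where "continuous_on ({0..1} \<times> W) r" "r ` ({0..1} \<times> W) \<subseteq> M"
    "\<And>y. y \<in> W \<Longrightarrow> r (0, y) = y" "\<And>y. y \<in> W \<Longrightarrow> r (1, y) = v"
proof -
  have "\<exists>r. continuous_on ({0..1} \<times> c) r \<and> r ` ({0..1} \<times> c) \<subseteq> c \<and> (\<forall>y\<in>c. r (0, y) = y \<and> r (1, y) = v) \<and>
      (\<forall>s::real. r (s, v) = v)" if "c \<in> cells" "v \<in> c" for c
    by (rule cell_contraction[OF that]) auto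
  then obtain r :: "'a set \<Rightarrow> real \<times> 'a \<Rightarrow> 'a"
    where r: "\<And>c. c \<in> cells \<Longrightarrow> v \<in> c \<Longrightarrow> continuous_on ({0..1} \<times> c) (r c) \<and> r c ` ({0..1} \<times> c) \<subseteq> c \<and>
      (\<forall>y\<in>c. r c (0, y) = y \<and> r c (1, y) = v) \<and> (\<forall>s. r c (s, v) = v)"
    by metis
  have carrier: "carrier_cell y \<in> cells" "v \<in> carrier_cell y" "y \<in> carrier_cell y" if "y \<in> W" for y
    using that W carrier_cell[of y] by auto
  define R where "R z = r (carrier_cell (snd z)) z" for z
  have "continuous_on ({0..1} \<times> W) R"
    unfolding R_def by (rule continuous_on_carrier_cell_glue[OF W]) (use r in auto)
  moreover have "R ` ({0..1} \<times> W) \<subseteq> M"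
  proof
    fix x assume "x \<in> R ` ({0..1} \<times> W)"
    then obtain s y where y: "y \<in> W" and "s \<in> {0..1}" "x = R (s, y)"
      by auto
    then have "x \<in> carrier_cell y"
      using r[OF carrier(1,2)[OF y]] carrier(3)[OF y] by (auto simp: R_def)
    then show "x \<in> M"
      using carrier(1) cell_subset y by blast
  qed
  moreover have "R (0, y) = y" "R (1, y) = v" if "y \<in> W" for y
    using r carrier[OF that] by (simp_all add: R_def)
  ultimately show thesis
    using that[of R] by simp
qed

lemma semilocally_simply_connected_graph: "semilocally_simply_connected M"
  unfolding semilocally_simply_connected_def
proof
  fix x assume x: "x \<in> M"
  obtain W where W: "openin (top_of_set M) W" "x \<in> W" "\<And>y. y \<in> W \<Longrightarrow> carrier_cell x \<subseteq> carrier_cell y"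
    using carrier_cell_upward_nbhd[OF x] by blast
  have WM: "W \<subseteq> M"
    using W(1) by (rule openin_imp_subset)
  have star: "x \<in> carrier_cell y" if "y \<in> W" for y
    using W(3)[OF that] carrier_cell(2)[OF x] by blast
  have "homotopic_paths M p q"
    if p: "path p" "path_image p \<subseteq> W" and q: "path q" "path_image q \<subseteq> W"
      and pq: "pathstart p = pathstart q" "pathfinish p = pathfinish q" for p q
  proof (cases "{x} \<in> X 0")
    case True
    show ?thesis
    proof (rule vertex_star_contraction[OF WM star])
      fix r :: "real \<times> 'a \<Rightarrow> 'a"
      assume r: "continuous_on ({0..1} \<times> W) r" "r ` ({0..1} \<times> W) \<subseteq> M"
        "\<And>y. y \<in> W \<Longrightarrow> r (0, y) = y" "\<And>y. y \<in> W \<Longrightarrow> r (1, y) = x"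
      show ?thesis
        by (rule homotopic_paths_contraction[OF r p q pq])
    qed
  next
    case False
    have "carrier_cell y = carrier_cell x" if "y \<in> W" for y
      using cell_vertex_or_edge[OF carrier_cell(1)] star[OF that] carrier_cell_edge False that WM
      by (metis singletonD subsetD)
    then have W_cell: "W \<subseteq> carrier_cell x"
      using carrier_cell(2) WM by blast
    have "homotopic_paths (carrier_cell x) p q"
      using p q pq W_cell by (intro cell_homotopic_paths carrier_cell(1)[OF x]) auto
    then show ?thesis
      using cell_subset[OF carrier_cell(1)[OF x]] homotopic_paths_subset by blast
  qed
  then have "all_paths_homotopic_in M W"
    by (simp add: all_paths_homotopic_in_def)
  then show "\<exists>U. openin (top_of_set M) U \<and> x \<in> U \<and> all_paths_homotopic_in M U"
    using W(1,2) by blast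
qed

end

context cell_complex
begin

lemma skeleton_subset: "skeleton X i \<subseteq> M"
  using cell_subset by (auto simp: skeleton_def)

lemma embedded_cell_complex_skeleton:
  "embedded_cell_complex N (skeleton X i) (\<lambda>k. if k \<le> i then X k else {})" (is "embedded_cell_complex N ?S ?X")
proof -
  have boundary: "cell_boundary ?X k c = cell_boundary X k c" if "k \<le> i" for k c
    using that unfolding cell_boundary_def by (intro arg_cong[where f = Union] Collect_cong) auto
  show ?thesis
    unfolding embedded_cell_complex_def
  proof (intro conjI allI ballI)
    show "finite (\<Union>k. ?X k)"
      using finite_cells by (rule rev_finite_subset) auto
  next
    fix k c assume "c \<in> ?X k"
    then have c: "k \<le> i" "c \<in> X k"
      by (auto split: if_splits)
    then show "c \<subseteq> ?S"
      by (auto simp: skeleton_def)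
    show "\<exists>(V :: (real ^ 'n) set) h g. subspace V \<and> dim V = k \<and>
        homeomorphism (V \<inter> cball 0 1) c h g \<and> h ` (V \<inter> sphere 0 1) = cell_boundary ?X k c"
      unfolding boundary[OF c(1)] using embedded c(2) unfolding embedded_cell_complex_def by blast
  next
    fix x assume x: "x \<in> ?S"
    have iff: "(c \<in> ?X k \<and> x \<in> c - cell_boundary ?X k c) \<longleftrightarrow> k \<le> i \<and> c \<in> X k \<and> x \<in> c - cell_boundary X k c" for k c
      using boundary[of k c] by auto
    have "x \<in> M"
      using x skeleton_subset by blast
    obtain j d where "j \<le> i" "d \<in> X j" "x \<in> d"
      using x by (auto simp: skeleton_def)
    then obtain k where "k \<le> i" "carrier_cell x \<in> X k" "x \<in> carrier_cell x - cell_boundary X k (carrier_cell x)"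
      using carrier_cell_face[of d j x] by (meson order_trans)
    then show "\<exists>!c. \<exists>k. c \<in> ?X k \<and> x \<in> c - cell_boundary ?X k c"
      unfolding iff using carrier_cell_unique[OF \<open>x \<in> M\<close>] by blast
  qed
qed

lemma graph_complex_skeleton_1:
  "graph_complex N (skeleton X 1) (\<lambda>k. if k \<le> 1 then X k else {})"
proof (intro graph_complex.intro cell_complex.intro graph_complex_axioms.intro)
  show "Hausdorff_space (top_of_set (skeleton X 1))"
    using Hausdorff_space_subtopology[OF hausdorff, of "skeleton X 1"] skeleton_subset
    by (simp add: subtopology_subtopology inf.absorb2)
qed (use embedded_cell_complex_skeleton in \<open>auto split: if_splits\<close>)

lemma edge_path_skeleton_1: "edge_path (\<lambda>k. if k \<le> 1 then X k else {}) v es w \<longleftrightarrow> edge_path X v es w"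
  by (induction X v es w rule: edge_path.induct) auto

lemma skeleton_1_path_homotopic_realization:
  assumes "path p" "path_image p \<subseteq> skeleton X 1" "{pathstart p} \<in> X 0" "{pathfinish p} \<in> X 0"
  obtains es where "edge_path X (pathstart p) es (pathfinish p)"
    "homotopic_paths (skeleton X 1) p (realization (pathstart p) es)"
proof -
  interpret skeleton: graph_complex N "skeleton X 1" "\<lambda>k. if k \<le> 1 then X k else {}"
    by (rule graph_complex_skeleton_1)
  show thesis
    using skeleton.path_homotopic_realization[OF skeleton.semilocally_simply_connected_graph assms(1,2)] assms(3,4) that
    unfolding edge_path_skeleton_1 by auto
qed

lemma realization_subset_skeleton_1:
  assumes "edge_path X v es w"
  shows "path_image (realization v es) \<subseteq> skeleton X 1"
proof -
  have "fst ` set es \<subseteq> X 1" "{v} \<in> X 0"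
    using edge_path_edges[OF assms] edge_path_vertices[OF assms] by auto
  moreover have "\<Union>(X 0) \<subseteq> skeleton X 1" "\<Union>(X 1) \<subseteq> skeleton X 1"
    by (auto simp: skeleton_def)
  ultimately show ?thesis
    unfolding realization_path(4)[OF assms] by blast
qed

end

section \<open>Flat sections of sheaves on posets\<close>

text \<open>For the Alexandrov topology on \<open>C\<close>, a sheaf is given by its stalks \<open>F c\<close> and by restrictions from
  \<open>F d\<close> to \<open>F c\<close> for \<open>c \<le> d\<close>; the function \<open>res c\<close> serves all \<open>d\<close> at once.\<close>

locale injective_poset_sheaf =
  fixes C :: "'c::order set" and F :: "'c \<Rightarrow> 'd set" and res :: "'c \<Rightarrow> 'd \<Rightarrow> 'd"
  assumes res_in: "c \<in> C \<Longrightarrow> d \<in> C \<Longrightarrow> c \<le> d \<Longrightarrow> x \<in> F d \<Longrightarrow> res c x \<in> F c"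
    and res_self: "c \<in> C \<Longrightarrow> x \<in> F c \<Longrightarrow> res c x = x"
    and res_res: "c \<in> C \<Longrightarrow> d \<in> C \<Longrightarrow> e \<in> C \<Longrightarrow> c \<le> d \<Longrightarrow> d \<le> e \<Longrightarrow> x \<in> F e \<Longrightarrow> res c (res d x) = res c x"
    and inj_res: "c \<in> C \<Longrightarrow> d \<in> C \<Longrightarrow> c \<le> d \<Longrightarrow> inj_on (res c) (F d)"
begin

definition alexandrov_continuous_on :: "'b::topological_space set \<Rightarrow> ('b \<Rightarrow> 'c) \<Rightarrow> bool" where
  "alexandrov_continuous_on Y \<phi> \<longleftrightarrow> \<phi> ` Y \<subseteq> C \<and> (\<forall>y\<in>Y. \<forall>\<^sub>F z in at y within Y. \<phi> y \<le> \<phi> z)"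

definition flat_section :: "'b::topological_space set \<Rightarrow> ('b \<Rightarrow> 'c) \<Rightarrow> ('b \<Rightarrow> 'd) \<Rightarrow> bool" where
  "flat_section Y \<phi> s \<longleftrightarrow> alexandrov_continuous_on Y \<phi> \<and> (\<forall>y\<in>Y. s y \<in> F (\<phi> y)) \<and>
     (\<forall>y\<in>Y. \<forall>\<^sub>F z in at y within Y. res (\<phi> y) (s z) = s y)"

definition flat_sections_extend :: "'b::topological_space set \<Rightarrow> ('b \<Rightarrow> 'c) \<Rightarrow> bool" where
  "flat_sections_extend Y \<phi> \<longleftrightarrow> (\<forall>y\<in>Y. \<forall>x\<in>F (\<phi> y). \<exists>s. flat_section Y \<phi> s \<and> s y = x)"

lemma alexandrov_continuous_on_subset:
  "alexandrov_continuous_on Y \<phi> \<Longrightarrow> Z \<subseteq> Y \<Longrightarrow> alexandrov_continuous_on Z \<phi>"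
  unfolding alexandrov_continuous_on_def by (auto intro: filter_leD[OF at_le])

lemma flat_section_subset: "flat_section Y \<phi> s \<Longrightarrow> Z \<subseteq> Y \<Longrightarrow> flat_section Z \<phi> s"
  unfolding flat_section_def
  by (auto intro: alexandrov_continuous_on_subset filter_leD[OF at_le])

lemma eventually_at_within_compose:
  assumes "continuous_on Z j" "j ` Z \<subseteq> Y" "z \<in> Z"
    and "\<forall>\<^sub>F y in at (j z) within Y. P y" "P (j z)"
  shows "\<forall>\<^sub>F x in at z within Z. P (j x)"
proof -
  have "\<forall>\<^sub>F y in nhds (j z). y \<in> Y \<longrightarrow> P y"
    using assms(4) unfolding eventually_at_filter by (rule eventually_mono) (use assms(5) in auto)
  moreover have "filterlim j (nhds (j z)) (at z within Z)"
    using assms(1,3) by (simp add: continuous_on_def)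
  ultimately have "\<forall>\<^sub>F x in at z within Z. j x \<in> Y \<longrightarrow> P (j x)"
    by (rule eventually_compose_filterlim)
  moreover have "\<forall>\<^sub>F x in at z within Z. x \<in> Z"
    by (simp add: eventually_at_filter)
  ultimately show ?thesis
    by eventually_elim (use assms(2) in blast)
qed

lemma flat_section_compose:
  assumes s: "flat_section Y \<phi> s" and j: "continuous_on Z j" "j ` Z \<subseteq> Y"
    and \<psi>: "\<And>z. z \<in> Z \<Longrightarrow> \<psi> z = \<phi> (j z)"
  shows "flat_section Z \<psi> (s \<circ> j)"
  unfolding flat_section_def alexandrov_continuous_on_def
proof (intro conjI ballI)
  show "\<psi> ` Z \<subseteq> C"
    using s j(2) \<psi> by (auto simp: flat_section_def alexandrov_continuous_on_def)
  fix z assume z: "z \<in> Z"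
  then have "j z \<in> Y"
    using j(2) by blast
  then have jz: "s (j z) \<in> F (\<phi> (j z))" "\<phi> (j z) \<in> C"
    "\<forall>\<^sub>F y in at (j z) within Y. \<phi> (j z) \<le> \<phi> y"
    "\<forall>\<^sub>F y in at (j z) within Y. res (\<phi> (j z)) (s y) = s (j z)"
    using s by (auto simp: flat_section_def alexandrov_continuous_on_def)
  show "(s \<circ> j) z \<in> F (\<psi> z)"
    using jz(1) z \<psi> by simp
  have in_Z: "\<forall>\<^sub>F x in at z within Z. x \<in> Z"
    by (simp add: eventually_at_filter)
  have "\<forall>\<^sub>F x in at z within Z. \<phi> (j z) \<le> \<phi> (j x)"
    using eventually_at_within_compose[OF j z jz(3)] by simp
  then show "\<forall>\<^sub>F x in at z within Z. \<psi> z \<le> \<psi> x"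
    using in_Z by eventually_elim (simp add: \<psi> z)
  have "\<forall>\<^sub>F x in at z within Z. res (\<phi> (j z)) (s (j x)) = s (j z)"
    using eventually_at_within_compose[OF j z jz(4)] res_self jz(1,2) by simp
  then show "\<forall>\<^sub>F x in at z within Z. res (\<psi> z) ((s \<circ> j) x) = (s \<circ> j) z"
    using in_Z by eventually_elim (simp add: \<psi> z)
qed

lemma flat_section_constant:
  assumes "alexandrov_continuous_on Y \<phi>" "c \<in> C" "x \<in> F c" "\<And>y. y \<in> Y \<Longrightarrow> \<phi> y \<le> c"
  shows "flat_section Y \<phi> (\<lambda>y. res (\<phi> y) x)"
  unfolding flat_section_def
proof (intro conjI ballI)
  fix y assume y: "y \<in> Y"
  then have "\<phi> y \<in> C"
    using assms(1) by (auto simp: alexandrov_continuous_on_def)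
  then show "res (\<phi> y) x \<in> F (\<phi> y)"
    using res_in assms(2-4) y by blast
  have "\<forall>\<^sub>F z in at y within Y. \<phi> y \<le> \<phi> z" "\<forall>\<^sub>F z in at y within Y. z \<in> Y"
    using assms(1) y by (auto simp: alexandrov_continuous_on_def eventually_at_filter)
  then show "\<forall>\<^sub>F z in at y within Y. res (\<phi> y) (res (\<phi> z) x) = res (\<phi> y) x"
  proof eventually_elim
    case (elim z)
    then have "\<phi> z \<in> C"
      using assms(1) by (auto simp: alexandrov_continuous_on_def)
    then show ?case
      using res_res \<open>\<phi> y \<in> C\<close> assms(2-4) elim by blast
  qed
qed (fact assms(1))

lemma flat_section_unique:
  assumes "connected Y" and s: "flat_section Y \<phi> s" and s': "flat_section Y \<phi> s'"
    and y: "y \<in> Y" "s y = s' y" and z: "z \<in> Y"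
  shows "s z = s' z"
proof (rule connected_induction_simple[where P = "\<lambda>z. s z = s' z", OF assms(1) y(1) z y(2)])
  fix a assume a: "a \<in> Y"
  have "\<forall>\<^sub>F x in at a within Y. x \<in> Y"
    by (simp add: eventually_at_filter)
  moreover have "\<forall>\<^sub>F x in at a within Y. \<phi> a \<le> \<phi> x" "\<forall>\<^sub>F x in at a within Y. res (\<phi> a) (s x) = s a"
    "\<forall>\<^sub>F x in at a within Y. res (\<phi> a) (s' x) = s' a"
    using s s' a by (auto simp: flat_section_def alexandrov_continuous_on_def)
  ultimately have "\<forall>\<^sub>F x in at a within Y. s x = s' x \<longleftrightarrow> s a = s' a"
  proof eventually_elim
    case (elim x)
    then have "inj_on (res (\<phi> a)) (F (\<phi> x))" "s x \<in> F (\<phi> x)" "s' x \<in> F (\<phi> x)"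
      using inj_res s s' a by (auto simp: flat_section_def alexandrov_continuous_on_def)
    then show ?case
      using elim by (metis inj_onD)
  qed
  then obtain T where T: "open T" "a \<in> T" "\<forall>x\<in>T. x \<noteq> a \<longrightarrow> x \<in> Y \<longrightarrow> (s x = s' x \<longleftrightarrow> s a = s' a)"
    unfolding eventually_at_topological by blast
  have "s x = s' x \<longleftrightarrow> s a = s' a" if "x \<in> Y \<inter> T" for x
    using that T(3) by (cases "x = a") auto
  then have "\<forall>x\<in>Y \<inter> T. \<forall>y\<in>Y \<inter> T. s x = s' x \<longrightarrow> s y = s' y"
    by blast
  moreover have "openin (top_of_set Y) (Y \<inter> T)" "a \<in> Y \<inter> T"
    using a T(1,2) by (auto intro: openin_open_Int)
  ultimately show "\<exists>T. openin (top_of_set Y) T \<and> a \<in> T \<and> (\<forall>x\<in>T. \<forall>y\<in>T. s x = s' x \<longrightarrow> s y = s' y)"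
    by blast
qed

lemma flat_section_constant_base:
  assumes "connected Y" "flat_section Y (\<lambda>_. c) s" "y \<in> Y" "z \<in> Y"
  shows "s y = s z"
proof -
  have base: "alexandrov_continuous_on Y (\<lambda>_. c)" "c \<in> C" "s y \<in> F c"
    using assms(2,3) by (auto simp: flat_section_def alexandrov_continuous_on_def)
  then have "flat_section Y (\<lambda>_. c) (\<lambda>_. s y)"
    using flat_section_constant[OF base] res_self by simp
  then show ?thesis
    using flat_section_unique[OF assms(1,2), of "\<lambda>_. s y" y z] assms(3,4) by simp
qed

lemma flat_section_if_common_restriction:
  assumes cont: "alexandrov_continuous_on Y \<phi>" and c: "c \<in> C" "\<And>y. y \<in> Y \<Longrightarrow> c \<le> \<phi> y"
    and s: "\<And>y. y \<in> Y \<Longrightarrow> s y \<in> F (\<phi> y)" "\<And>y. y \<in> Y \<Longrightarrow> res c (s y) = x"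
  shows "flat_section Y \<phi> s"
  unfolding flat_section_def
proof (intro conjI ballI)
  have C: "\<phi> y \<in> C" if "y \<in> Y" for y
    using cont that by (auto simp: alexandrov_continuous_on_def)
  fix y assume y: "y \<in> Y"
  then show "s y \<in> F (\<phi> y)"
    by (rule s)
  have "\<forall>\<^sub>F z in at y within Y. \<phi> y \<le> \<phi> z" "\<forall>\<^sub>F z in at y within Y. z \<in> Y"
    using cont y by (auto simp: alexandrov_continuous_on_def eventually_at_filter)
  then show "\<forall>\<^sub>F z in at y within Y. res (\<phi> y) (s z) = s y"
  proof eventually_elim
    case (elim z)
    have "res c (res (\<phi> y) (s z)) = res c (s y)"
      using res_res[OF c(1) C[OF y] C[OF elim(2)] c(2)[OF y] elim(1)] s y elim(2) by simp
    then show ?case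
      using inj_onD[OF inj_res[OF c(1) C[OF y] c(2)[OF y]]] res_in[OF C[OF y] C[OF elim(2)] elim(1)] s(1) y elim(2)
      by blast
  qed
qed (fact cont)

lemma flat_sections_extend_local:
  assumes \<phi>: "alexandrov_continuous_on Y \<phi>" and y: "y \<in> Y"
    and surj: "\<And>z. z \<in> Y \<Longrightarrow> \<phi> y \<le> \<phi> z \<Longrightarrow> res (\<phi> y) ` F (\<phi> z) = F (\<phi> y)"
  obtains W where "open W" "y \<in> W" "\<And>Z. Z \<subseteq> Y \<inter> W \<Longrightarrow> flat_sections_extend Z \<phi>"
proof -
  obtain W where W: "open W" "y \<in> W" "\<And>z. z \<in> Y \<Longrightarrow> z \<in> W \<Longrightarrow> \<phi> y \<le> \<phi> z"
    using \<phi> y unfolding alexandrov_continuous_on_def eventually_at_topological by (metis order_refl)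
  have "\<exists>s. flat_section Z \<phi> s \<and> s z = x" if Z: "Z \<subseteq> Y \<inter> W" and z: "z \<in> Z" and x: "x \<in> F (\<phi> z)" for Z z x
  proof -
    have C: "\<phi> w \<in> C" if "w \<in> Z" for w
      using \<phi> Z that by (auto simp: alexandrov_continuous_on_def)
    have above: "\<phi> y \<in> C" "\<And>w. w \<in> Z \<Longrightarrow> \<phi> y \<le> \<phi> w"
      using \<phi> y W(3) Z unfolding alexandrov_continuous_on_def by blast+
    have "\<exists>t. t \<in> F (\<phi> w) \<and> res (\<phi> y) t = res (\<phi> y) x" if "w \<in> Z" for w
      using surj[of w] res_in[OF above(1) C[OF z] above(2)[OF z] x] Z that above(2)[OF that]
      by (metis IntE imageE subsetD)
    then obtain s where s: "\<And>w. w \<in> Z \<Longrightarrow> s w \<in> F (\<phi> w) \<and> res (\<phi> y) (s w) = res (\<phi> y) x"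
      by metis
    have "flat_section Z \<phi> s"
      using alexandrov_continuous_on_subset[OF \<phi>, of Z] Z above s
      by (intro flat_section_if_common_restriction[where c = "\<phi> y" and x = "res (\<phi> y) x"]) auto
    moreover have "s z = x"
      using inj_onD[OF inj_res[OF above(1) C[OF z] above(2)[OF z]]] s[OF z] x by blast
    ultimately show ?thesis
      by blast
  qed
  then show thesis
    using that[OF W(1,2)] unfolding flat_sections_extend_def by blast
qed

lemma flat_section_Un:
  assumes s: "flat_section A \<phi> s" and s': "flat_section B \<phi> s'" and "closed A" "closed B"
    and agree: "\<And>x. x \<in> A \<inter> B \<Longrightarrow> s x = s' x"
  shows "flat_section (A \<union> B) \<phi> (\<lambda>x. if x \<in> A then s x else s' x)"
proof -
  let ?s = "\<lambda>x. if x \<in> A then s x else s' x"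
  have eventually_Un: "\<forall>\<^sub>F z in at y within A \<union> B. P z"
    if "y \<in> A \<Longrightarrow> \<forall>\<^sub>F z in at y within A. P z" "y \<in> B \<Longrightarrow> \<forall>\<^sub>F z in at y within B. P z" for y P
  proof -
    have closed_within: "\<forall>\<^sub>F z in at y within S. P z"
      if "closed S" "y \<in> S \<Longrightarrow> \<forall>\<^sub>F z in at y within S. P z" for S
      using that unfolding eventually_at_topological closed_def by (cases "y \<in> S") blast+
    show ?thesis
      using closed_within[OF assms(3) that(1)] closed_within[OF assms(4) that(2)]
      by (simp add: at_within_union eventually_sup)
  qed
  have "alexandrov_continuous_on (A \<union> B) \<phi>"
    using s s' eventually_Un unfolding flat_section_def alexandrov_continuous_on_def by (auto simp: image_Un)
  moreover have "?s y \<in> F (\<phi> y)" if "y \<in> A \<union> B" for y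
    using s s' that by (auto simp: flat_section_def)
  moreover have "\<forall>\<^sub>F z in at y within A \<union> B. res (\<phi> y) (?s z) = ?s y" if "y \<in> A \<union> B" for y
  proof (rule eventually_Un)
    assume "y \<in> A"
    then have "\<forall>\<^sub>F z in at y within A. res (\<phi> y) (s z) = s y" "\<forall>\<^sub>F z in at y within A. z \<in> A"
      using s by (auto simp: flat_section_def eventually_at_filter)
    then show "\<forall>\<^sub>F z in at y within A. res (\<phi> y) (?s z) = ?s y"
      by eventually_elim (use \<open>y \<in> A\<close> in simp)
  next
    assume y: "y \<in> B"
    have s'_eq: "?s z = s' z" if "z \<in> B" for z
      using that agree by auto
    have "\<forall>\<^sub>F z in at y within B. res (\<phi> y) (s' z) = s' y" "\<forall>\<^sub>F z in at y within B. z \<in> B"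
      using s' y by (auto simp: flat_section_def eventually_at_filter)
    then show "\<forall>\<^sub>F z in at y within B. res (\<phi> y) (?s z) = ?s y"
      by eventually_elim (simp only: s'_eq y)
  qed
  ultimately show ?thesis
    by (auto simp: flat_section_def)
qed

lemma flat_sections_extend_Un:
  assumes A: "flat_sections_extend A \<phi>" and B: "flat_sections_extend B \<phi>" and closed: "closed A" "closed B"
    and AB: "connected (A \<inter> B)" "A \<inter> B \<noteq> {}"
  shows "flat_sections_extend (A \<union> B) \<phi>"
proof -
  have extend: "\<exists>s. flat_section (A \<union> B) \<phi> s \<and> s y = x"
    if A: "flat_sections_extend A \<phi>" and B: "flat_sections_extend B \<phi>" and closed: "closed A" "closed B"
      and AB: "connected (A \<inter> B)" "A \<inter> B \<noteq> {}" and y: "y \<in> A" and x: "x \<in> F (\<phi> y)" for A B y x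
  proof -
    obtain s where s: "flat_section A \<phi> s" "s y = x"
      using A y x unfolding flat_sections_extend_def by blast
    obtain p where p: "p \<in> A" "p \<in> B"
      using AB(2) by blast
    then have "s p \<in> F (\<phi> p)"
      using s(1) by (simp add: flat_section_def)
    then obtain s' where s': "flat_section B \<phi> s'" "s' p = s p"
      using B p(2) unfolding flat_sections_extend_def by blast
    have "s z = s' z" if "z \<in> A \<inter> B" for z
      using flat_section_unique[OF AB(1) flat_section_subset flat_section_subset _ _ that] s(1) s' p by auto
    then show ?thesis
      using flat_section_Un[OF s(1) s'(1) closed] s(2) y
      by (intro exI[of _ "\<lambda>x. if x \<in> A then s x else s' x"]) auto
  qed
  have "\<exists>s. flat_section (A \<union> B) \<phi> s \<and> s y = x" if "y \<in> A \<union> B" "x \<in> F (\<phi> y)" for y x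
    using that extend[OF A B closed AB] extend[OF B A closed(2,1)] AB by (auto simp: Int_commute Un_commute)
  then show ?thesis
    by (simp add: flat_sections_extend_def)
qed

end

lemma strip_induct:
  fixes P :: "(real \<times> real) set \<Rightarrow> bool"
  assumes join: "\<And>a b x y z. a \<le> b \<Longrightarrow> x \<le> y \<Longrightarrow> y \<le> z \<Longrightarrow>
      P ({a..b} \<times> {x..y}) \<Longrightarrow> P ({a..b} \<times> {y..z}) \<Longrightarrow> P ({a..b} \<times> {x..z})"
    and local: "\<And>y. y \<in> {c..d} \<Longrightarrow> \<exists>W. open W \<and> (x, y) \<in> W \<and> (\<forall>Z \<subseteq> (I \<times> {c..d}) \<inter> W. P Z)"
    and "c \<le> d"
  shows "\<exists>A. open A \<and> x \<in> A \<and> (\<forall>a b. a \<le> b \<longrightarrow> {a..b} \<subseteq> A \<inter> I \<longrightarrow> P ({a..b} \<times> {c..d}))"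
proof -
  define near where "near A y z \<longleftrightarrow> open A \<and> x \<in> A \<and> (\<forall>a b. a \<le> b \<longrightarrow> {a..b} \<subseteq> A \<inter> I \<longrightarrow> P ({a..b} \<times> {y..z}))"
    for A y z
  have "c \<le> c \<and> d \<le> d \<longrightarrow> (\<exists>A. near A c d)"
  proof (rule Bolzano[of c d "\<lambda>y z. c \<le> y \<and> z \<le> d \<longrightarrow> (\<exists>A. near A y z)"])
    fix u v w
    assume "c \<le> u \<and> v \<le> d \<longrightarrow> (\<exists>A. near A u v)" "c \<le> v \<and> w \<le> d \<longrightarrow> (\<exists>A. near A v w)" and le: "u \<le> v" "v \<le> w"
    moreover have "near (A \<inter> B) u w" if "near A u v" "near B v w" for A B
      using that join[OF _ le] by (auto simp: near_def)
    ultimately show "c \<le> u \<and> w \<le> d \<longrightarrow> (\<exists>A. near A u w)"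
      by (meson order_trans)
  next
    fix y assume "c \<le> y" "y \<le> d"
    then obtain W where W: "open W" "(x, y) \<in> W" "\<And>Z. Z \<subseteq> (I \<times> {c..d}) \<inter> W \<Longrightarrow> P Z"
      using local[of y] by auto
    then obtain A B where AB: "open A" "open B" "x \<in> A" "y \<in> B" "A \<times> B \<subseteq> W"
      using open_prod_elim by (metis mem_Sigma_iff)
    then obtain \<epsilon> where \<epsilon>: "\<epsilon> > 0" "ball y \<epsilon> \<subseteq> B"
      by (meson open_contains_ball)
    have "near A u v" if "u \<le> y" "y \<le> v" "v - u < \<epsilon>" "c \<le> u" "v \<le> d" for u v
    proof -
      have "{u..v} \<subseteq> B \<inter> {c..d}"
        using that \<epsilon>(2) by (auto simp: dist_real_def subset_iff)
      then show ?thesis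
        unfolding near_def using AB(1,3,5) by (intro conjI allI impI W(3)) auto
    qed
    then show "\<exists>\<epsilon>>0. \<forall>u v. u \<le> y \<and> y \<le> v \<and> v - u < \<epsilon> \<longrightarrow> c \<le> u \<and> v \<le> d \<longrightarrow> (\<exists>A. near A u v)"
      using \<epsilon>(1) by blast
  qed (rule \<open>c \<le> d\<close>)
  then show ?thesis
    by (simp add: near_def)
qed

lemma rectangle_induct:
  fixes P :: "(real \<times> real) set \<Rightarrow> bool"
  assumes horizontal: "\<And>x y z a b. x \<le> y \<Longrightarrow> y \<le> z \<Longrightarrow> a \<le> b \<Longrightarrow>
      P ({x..y} \<times> {a..b}) \<Longrightarrow> P ({y..z} \<times> {a..b}) \<Longrightarrow> P ({x..z} \<times> {a..b})"
    and vertical: "\<And>a b x y z. a \<le> b \<Longrightarrow> x \<le> y \<Longrightarrow> y \<le> z \<Longrightarrow>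
      P ({a..b} \<times> {x..y}) \<Longrightarrow> P ({a..b} \<times> {y..z}) \<Longrightarrow> P ({a..b} \<times> {x..z})"
    and local: "\<And>p. p \<in> {l..r} \<times> {c..d} \<Longrightarrow> \<exists>W. open W \<and> p \<in> W \<and> (\<forall>Z \<subseteq> ({l..r} \<times> {c..d}) \<inter> W. P Z)"
    and "l \<le> r" "c \<le> d"
  shows "P ({l..r} \<times> {c..d})"
proof -
  have "l \<le> l \<and> r \<le> r \<longrightarrow> P ({l..r} \<times> {c..d})"
  proof (rule Bolzano[of l r "\<lambda>a b. l \<le> a \<and> b \<le> r \<longrightarrow> P ({a..b} \<times> {c..d})"])
    fix x assume x: "l \<le> x" "x \<le> r"
    have "\<exists>A. open A \<and> x \<in> A \<and> (\<forall>a b. a \<le> b \<longrightarrow> {a..b} \<subseteq> A \<inter> {l..r} \<longrightarrow> P ({a..b} \<times> {c..d}))"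
      by (rule strip_induct) (use x vertical local \<open>c \<le> d\<close> in auto)
    then obtain A where A: "open A" "x \<in> A" "\<And>a b. a \<le> b \<Longrightarrow> {a..b} \<subseteq> A \<inter> {l..r} \<Longrightarrow> P ({a..b} \<times> {c..d})"
      by blast
    obtain \<epsilon> where \<epsilon>: "\<epsilon> > 0" "ball x \<epsilon> \<subseteq> A"
      using A(1,2) by (meson open_contains_ball)
    have "P ({a..b} \<times> {c..d})" if "a \<le> x" "x \<le> b" "b - a < \<epsilon>" "l \<le> a" "b \<le> r" for a b
      using that \<epsilon>(2) by (intro A(3)) (auto simp: dist_real_def subset_iff)
    then show "\<exists>\<epsilon>>0. \<forall>a b. a \<le> x \<and> x \<le> b \<and> b - a < \<epsilon> \<longrightarrow> l \<le> a \<and> b \<le> r \<longrightarrow> P ({a..b} \<times> {c..d})"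
      using \<epsilon>(1) by blast
  qed (use horizontal \<open>l \<le> r\<close> \<open>c \<le> d\<close> in auto)
  then show ?thesis
    by simp
qed

context injective_poset_sheaf
begin

theorem flat_sections_extend_square:
  fixes \<phi> :: "real \<times> real \<Rightarrow> 'c"
  assumes "alexandrov_continuous_on ({0..1} \<times> {0..1}) \<phi>"
    and "\<And>y z. y \<in> {0..1} \<times> {0..1} \<Longrightarrow> z \<in> {0..1} \<times> {0..1} \<Longrightarrow> \<phi> y \<le> \<phi> z \<Longrightarrow> res (\<phi> y) ` F (\<phi> z) = F (\<phi> y)"
  shows "flat_sections_extend ({0..1} \<times> {0..1}) \<phi>"
proof (rule rectangle_induct)
  fix a b c y z :: real assume le: "a \<le> b" "b \<le> c" "y \<le> z"
    and P: "flat_sections_extend ({a..b} \<times> {y..z}) \<phi>" "flat_sections_extend ({b..c} \<times> {y..z}) \<phi>"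
  have eq: "{a..c} \<times> {y..z} = {a..b} \<times> {y..z} \<union> {b..c} \<times> {y..z}" "{a..b} \<times> {y..z} \<inter> {b..c} \<times> {y..z} = {b} \<times> {y..z}"
    using le by auto
  show "flat_sections_extend ({a..c} \<times> {y..z}) \<phi>"
    unfolding eq(1) using P le(3)
    by (intro flat_sections_extend_Un) (auto simp: eq(2) intro!: closed_Times connected_Times)
next
  fix a b x y z :: real assume le: "a \<le> b" "x \<le> y" "y \<le> z"
    and P: "flat_sections_extend ({a..b} \<times> {x..y}) \<phi>" "flat_sections_extend ({a..b} \<times> {y..z}) \<phi>"
  have eq: "{a..b} \<times> {x..z} = {a..b} \<times> {x..y} \<union> {a..b} \<times> {y..z}" "{a..b} \<times> {x..y} \<inter> {a..b} \<times> {y..z} = {a..b} \<times> {y}"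
    using le by auto
  show "flat_sections_extend ({a..b} \<times> {x..z}) \<phi>"
    unfolding eq(1) using P le(1)
    by (intro flat_sections_extend_Un) (auto simp: eq(2) intro!: closed_Times connected_Times)
next
  fix p :: "real \<times> real" assume "p \<in> {0..1} \<times> {0..1}"
  then show "\<exists>W. open W \<and> p \<in> W \<and> (\<forall>Z \<subseteq> ({0..1} \<times> {0..1}) \<inter> W. flat_sections_extend Z \<phi>)"
    using flat_sections_extend_local[OF assms(1)] assms(2) by metis
qed simp_all

end

section \<open>Coherent colorings and their transport\<close>

locale cpx_complex = cell_complex N M X + dual_triangulation M T \<Delta> \<kappa> n X D
  for N :: "'n::finite itself" and M :: "'a::topological_space set" and X :: "nat \<Rightarrow> 'a set set"
    and T and \<Delta> :: "'a set \<Rightarrow> (real ^ 'n) set" and \<kappa> and n :: nat and D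

lemma cpx_complex_exists:
  fixes M :: "'a::topological_space set"
  assumes "Hausdorff_space (top_of_set M)" "cpx TYPE('n::finite) M X"
  shows "\<exists>T (\<Delta> :: 'a set \<Rightarrow> (real ^ 'n) set) \<kappa> D. cpx_complex TYPE('n) M X T \<Delta> \<kappa> CARD('n) D"
proof -
  obtain T where T: "simplicial_triangulation TYPE('n) M T" "dual_complex CARD('n) X T"
    using assms(2) unfolding cpx_def by blast
  have "\<exists>(\<Delta> :: 'a set \<Rightarrow> (real ^ 'n) set) \<kappa>. triangulation M T \<Delta> \<kappa>"
    using T(1) unfolding simplicial_triangulation_def triangulation_def by (rule conjunct2)
  then obtain \<Delta> :: "'a set \<Rightarrow> (real ^ 'n) set" and \<kappa> where "triangulation M T \<Delta> \<kappa>"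
    by blast
  moreover obtain D where "\<forall>k\<le>CARD('n). bij_betw D (T k) (X (CARD('n) - k))"
    "\<forall>s \<in> (\<Union>k. T k). \<forall>t \<in> (\<Union>k. T k). s \<subseteq> t \<longleftrightarrow> D t \<subseteq> D s"
    using T(2) unfolding dual_complex_def by blast
  moreover have "cell_complex TYPE('n) M X"
    using assms by (simp add: cell_complex_def cpx_def)
  moreover from this have "k \<le> CARD('n)" if "c \<in> X k" for c k
    using that by (rule cell_complex.cell_dim_le)
  ultimately have "cpx_complex TYPE('n) M X T \<Delta> \<kappa> CARD('n) D"
    by (auto simp: cpx_complex_def dual_triangulation_def dual_triangulation_axioms_def)
  then show ?thesis
    by blast
qed

context cpx_complex
begin

lemma finite_regions: "finite (regions d)"
proof -
  have "regions d \<subseteq> cells"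
    by (auto simp: regions_at_def)
  then show ?thesis
    using finite_cells finite_subset by blast
qed

lemma regions_antimono: "c \<subseteq> d \<Longrightarrow> regions d \<subseteq> regions c"
  by (auto simp: regions_at_def)

lemma regions_edge:
  assumes "e \<in> X 1" "v \<in> vertices e"
  obtains r where "r \<notin> regions e" "regions {v} = insert r (regions e)"
proof -
  have v: "{v} \<in> X 0" "v \<in> e"
    using assms by (auto simp: vertices_def)
  have "card (regions e) + 1 = n + 1" "card (regions {v}) = n + 1"
    using card_regions[OF v(1) assms(1) v(2)] card_regions[OF v(1) v(1)] by simp_all
  moreover have sub: "regions e \<subseteq> regions {v}"
    using v by (intro regions_antimono) auto
  ultimately have "card (regions {v} - regions e) = 1"
    by (simp add: card_Diff_subset finite_regions)
  then obtain r where "regions {v} - regions e = {r}"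
    by (meson card_1_singletonE)
  then show thesis
    using that sub by blast
qed

subsection \<open>Colorings at vertices\<close>

definition colorings :: "'a \<Rightarrow> ('a set \<Rightarrow> nat) set" where
  "colorings v = {f \<in> extensional (regions {v}). bij_betw f (regions {v}) {1..n+1}}"

lemma colorings_eqI:
  assumes "f \<in> colorings v" "g \<in> colorings v" "\<And>r. r \<in> regions {v} \<Longrightarrow> f r = g r"
  shows "f = g"
  using assms by (auto simp: colorings_def intro: extensionalityI)

lemma coloring_compose_bij:
  assumes "f \<in> colorings v" "bij_betw \<tau> (regions {u}) (regions {v})"
  shows "restrict (f \<circ> \<tau>) (regions {u}) \<in> colorings u"
  using assms bij_betw_trans by (auto simp: colorings_def)

lemma edge_transport_cong:
  assumes "\<And>r. r \<in> regions e \<Longrightarrow> f r = g r"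
  shows "edge_transport n X (e, u) f = edge_transport n X (e, u) g"
proof -
  have "f ` regions e = g ` regions e"
    using assms by force
  then show ?thesis
    using assms by (auto simp: edge_transport_def regions_at_def fun_eq_iff restrict_def)
qed

lemma edge_transport_eqI:
  assumes e: "e \<in> X 1" "u \<in> vertices e" and g: "g \<in> colorings u"
    and agree: "\<And>r. r \<in> regions e \<Longrightarrow> g r = f r"
  shows "edge_transport n X (e, u) f = g"
proof -
  have g': "g \<in> extensional (regions {u})" "inj_on g (regions {u})" "g ` regions {u} = {1..n+1}"
    using g by (auto simp: colorings_def bij_betw_def)
  have "edge_transport n X (e, u) g r = g r" for r
  proof (cases "r \<in> regions {u} \<and> \<not> e \<subseteq> r")
    case True
    then have "r \<notin> regions e" "r \<in> regions {u}"
      by (auto simp: regions_at_def)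
    moreover from this have "regions {u} = insert r (regions e)"
      using regions_edge[OF e] by (metis insert_iff)
    ultimately have "(THE i. i \<in> {1..n+1} \<and> i \<notin> g ` regions e) = g r"
      using g'(2) unfolding g'(3)[symmetric] by (intro the_equality) auto
    then show ?thesis
      using True by (simp add: edge_transport_def)
  next
    case False
    then show ?thesis
      using g'(1) by (auto simp: edge_transport_def extensional_def)
  qed
  then show ?thesis
    using edge_transport_cong[of e g f u] agree by auto
qed

lemma edge_transport_coloring:
  assumes e: "e \<in> X 1" "u \<in> vertices e" "v \<in> vertices e" and f: "f \<in> colorings v"
  shows "edge_transport n X (e, u) f \<in> colorings u" "\<And>r. r \<in> regions e \<Longrightarrow> edge_transport n X (e, u) f r = f r"
proof -
  obtain r where r: "r \<notin> regions e" "regions {u} = insert r (regions e)"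
    using regions_edge[OF e(1,2)] .
  obtain r' where r': "r' \<notin> regions e" "regions {v} = insert r' (regions e)"
    using regions_edge[OF e(1,3)] .
  define g where "g = restrict (f \<circ> (\<lambda>s. if s = r then r' else s)) (regions {u})"
  have "bij_betw (\<lambda>s. if s = r then r' else s) (regions {u}) (regions {v})"
    unfolding r(2) r'(2) using r(1) r'(1) by (auto simp: bij_betw_def inj_on_def)
  then have "g \<in> colorings u"
    unfolding g_def by (rule coloring_compose_bij[OF f])
  moreover have g: "g s = f s" if "s \<in> regions e" for s
    using that r by (auto simp: g_def)
  ultimately have "edge_transport n X (e, u) f = g"
    by (intro edge_transport_eqI[OF e(1,2)])
  then show "edge_transport n X (e, u) f \<in> colorings u"
    "\<And>r. r \<in> regions e \<Longrightarrow> edge_transport n X (e, u) f r = f r"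
    using \<open>g \<in> colorings u\<close> g by auto
qed

lemma transport_Nil: "transport n X [] f = f"
  by (simp add: transport_def)

lemma transport_Cons: "transport n X (s # es) f = transport n X es (edge_transport n X s f)"
  by (simp add: transport_def)

lemma transport_append: "transport n X (es @ es') f = transport n X es' (transport n X es f)"
  by (simp add: transport_def)

lemma transport_coloring:
  "edge_path X v es w \<Longrightarrow> f \<in> colorings v \<Longrightarrow> transport n X es f \<in> colorings w"
proof (induction es arbitrary: v f)
  case Nil
  then show ?case
    by (simp add: transport_Nil)
next
  case (Cons s es)
  then obtain e u where s: "s = (e, u)" and e: "e \<in> X 1" "v \<in> vertices e" "u \<in> vertices e"
    and es: "edge_path X u es w"
    by (elim edge_path_ConsE)
  show ?case
    unfolding s transport_Cons
    by (rule Cons.IH[OF es edge_transport_coloring(1)[OF e(1,3,2) Cons.prems(2)]])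
qed

subsection \<open>The sheaf of coherent colorings\<close>

definition coherent_colorings :: "'a set \<Rightarrow> ('a \<Rightarrow> 'a set \<Rightarrow> nat) set" where
  "coherent_colorings c = {f \<in> extensional (vertices c). (\<forall>v\<in>vertices c. f v \<in> colorings v) \<and>
     (\<forall>e\<in>X 1. e \<subseteq> c \<longrightarrow> (\<forall>u\<in>vertices e. \<forall>v\<in>vertices e. \<forall>r\<in>regions e. f u r = f v r))}"

definition restrict_coloring :: "'a set \<Rightarrow> ('a \<Rightarrow> 'a set \<Rightarrow> nat) \<Rightarrow> 'a \<Rightarrow> 'a set \<Rightarrow> nat" where
  "restrict_coloring c f = restrict f (vertices c)"

lemma coherent_coloringsI:
  assumes "f \<in> extensional (vertices c)" "\<And>v. v \<in> vertices c \<Longrightarrow> f v \<in> colorings v"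
    and "\<And>e u v r. e \<in> X 1 \<Longrightarrow> e \<subseteq> c \<Longrightarrow> u \<in> vertices e \<Longrightarrow> v \<in> vertices e \<Longrightarrow> r \<in> regions e \<Longrightarrow> f u r = f v r"
  shows "f \<in> coherent_colorings c"
  using assms unfolding coherent_colorings_def by blast

lemma coherent_coloringsD:
  assumes "f \<in> coherent_colorings c"
  shows "f \<in> extensional (vertices c)" "v \<in> vertices c \<Longrightarrow> f v \<in> colorings v"
    and "e \<in> X 1 \<Longrightarrow> e \<subseteq> c \<Longrightarrow> u \<in> vertices e \<Longrightarrow> v \<in> vertices e \<Longrightarrow> r \<in> regions e \<Longrightarrow> f u r = f v r"
  using assms unfolding coherent_colorings_def by blast+

lemma restrict_coloring_apply: "v \<in> vertices c \<Longrightarrow> restrict_coloring c f v = f v"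
  by (simp add: restrict_coloring_def)

lemma restrict_coloring_coherent:
  assumes f: "f \<in> coherent_colorings d" and cd: "c \<subseteq> d"
  shows "restrict_coloring c f \<in> coherent_colorings c"
proof (rule coherent_coloringsI)
  show "restrict_coloring c f \<in> extensional (vertices c)"
    by (simp add: restrict_coloring_def)
  show "restrict_coloring c f v \<in> colorings v" if "v \<in> vertices c" for v
    using coherent_coloringsD(2)[OF f] that vertices_mono[OF cd] by (auto simp: restrict_coloring_apply)
  show "restrict_coloring c f u r = restrict_coloring c f v r"
    if "e \<in> X 1" "e \<subseteq> c" "u \<in> vertices e" "v \<in> vertices e" "r \<in> regions e" for e u v r
  proof -
    have "u \<in> vertices c" "v \<in> vertices c"
      using that(3,4) vertices_mono[OF that(2)] by blast+
    then show ?thesis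
      using coherent_coloringsD(3)[OF f that(1) order_trans[OF that(2) cd] that(3-5)]
      by (simp add: restrict_coloring_apply)
  qed
qed

lemma coherent_transport:
  assumes "edge_path X v es w" "v \<in> vertices c" "\<Union>(fst ` set es) \<subseteq> c" "f \<in> coherent_colorings c"
  shows "transport n X es (f v) = f w"
  using assms(1-3)
proof (induction es arbitrary: v)
  case Nil
  then show ?case
    by (simp add: transport_Nil)
next
  case (Cons s es)
  then obtain e u where s: "s = (e, u)" and e: "e \<in> X 1" "v \<in> vertices e" "u \<in> vertices e"
    and es: "edge_path X u es w"
    by (elim edge_path_ConsE)
  have c: "e \<subseteq> c" "\<Union>(fst ` set es) \<subseteq> c"
    using Cons.prems(3) s by auto
  have u: "u \<in> vertices c"
    using e(3) vertices_mono[OF c(1)] by blast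
  then have "f u \<in> colorings u" "\<And>r. r \<in> regions e \<Longrightarrow> f u r = f v r"
    using coherent_coloringsD(2,3)[OF assms(4)] e c(1) by blast+
  then have "edge_transport n X (e, u) (f v) = f u"
    by (rule edge_transport_eqI[OF e(1,3)])
  then show ?case
    unfolding s transport_Cons using Cons.IH[OF es u c(2)] by simp
qed

lemma coherent_colorings_eqI:
  assumes c: "c \<in> cells" and f: "f \<in> coherent_colorings c" and g: "g \<in> coherent_colorings c"
    and v: "v \<in> vertices c" "f v = g v"
  shows "f = g"
proof
  fix u
  show "f u = g u"
  proof (cases "u \<in> vertices c")
    case True
    then obtain es where "edge_path X v es u" "\<Union>(fst ` set es) \<subseteq> c"
      using cell_edge_connected[OF c v(1)] by blast
    then show ?thesis
      using coherent_transport[OF _ v(1) _ f] coherent_transport[OF _ v(1) _ g] v(2) by force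
  next
    case False
    then show ?thesis
      using coherent_coloringsD(1)[OF f] coherent_coloringsD(1)[OF g] by (simp add: extensional_def)
  qed
qed

sublocale sheaf: injective_poset_sheaf cells coherent_colorings restrict_coloring
proof
  fix c d assume c: "c \<in> cells" and d: "d \<in> cells" and cd: "c \<subseteq> d"
  show "inj_on (restrict_coloring c) (coherent_colorings d)"
  proof (rule inj_onI)
    fix f g assume fg: "f \<in> coherent_colorings d" "g \<in> coherent_colorings d"
      "restrict_coloring c f = restrict_coloring c g"
    obtain v where v: "v \<in> vertices c"
      using vertices_nonempty[OF c] by blast
    then have "f v = g v"
      using fg(3) restrict_coloring_apply by metis
    then show "f = g"
      using coherent_colorings_eqI[OF d fg(1,2)] v vertices_mono[OF cd] by blast
  qed
next
  show "restrict_coloring c f = f" if "f \<in> coherent_colorings c" for c f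
    unfolding restrict_coloring_def using coherent_coloringsD(1)[OF that] by (rule extensional_restrict)
  show "restrict_coloring c (restrict_coloring d f) = restrict_coloring c f" if "c \<subseteq> d" for c d f
    using vertices_mono[OF that] by (simp add: restrict_coloring_def inf.absorb2)
qed (rule restrict_coloring_coherent)

definition extendable :: "'a set \<Rightarrow> bool" where
  "extendable c \<longleftrightarrow> (\<forall>v\<in>vertices c. \<forall>w\<in>colorings v. \<exists>f\<in>coherent_colorings c. f v = w)"

lemma extendable_restrict_surj:
  assumes "c \<in> cells" "d \<in> cells" "c \<subseteq> d" "extendable d"
  shows "restrict_coloring c ` coherent_colorings d = coherent_colorings c"
proof
  show "restrict_coloring c ` coherent_colorings d \<subseteq> coherent_colorings c"
    using restrict_coloring_coherent assms(3) by blast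
  show "coherent_colorings c \<subseteq> restrict_coloring c ` coherent_colorings d"
  proof
    fix f assume f: "f \<in> coherent_colorings c"
    obtain v where v: "v \<in> vertices c"
      using vertices_nonempty[OF assms(1)] by blast
    then have "v \<in> vertices d" "f v \<in> colorings v"
      using coherent_coloringsD(2)[OF f] vertices_mono[OF assms(3)] by blast+
    then obtain g where g: "g \<in> coherent_colorings d" "g v = f v"
      using assms(4) unfolding extendable_def by blast
    then have "restrict_coloring c g = f"
      using coherent_colorings_eqI[OF assms(1) restrict_coloring_coherent[OF g(1) assms(3)] f v] v
      by (simp add: restrict_coloring_apply)
    then show "f \<in> restrict_coloring c ` coherent_colorings d"
      using g(1) by blast
  qed
qed

lemma coherent_colorings_vertex:
  assumes "{v} \<in> X 0"
  shows "coherent_colorings {v} = (\<lambda>w. \<lambda>_\<in>{v}. w) ` colorings v"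
proof -
  have "\<not> e \<subseteq> {v}" if "e \<in> X 1" for e
    using edge_infinite[OF that] finite_subset by blast
  then have iff: "f \<in> coherent_colorings {v} \<longleftrightarrow> f \<in> extensional {v} \<and> f v \<in> colorings v" for f
    using assms by (auto simp: coherent_colorings_def vertices_vertex)
  show ?thesis
  proof
    show "coherent_colorings {v} \<subseteq> (\<lambda>w. \<lambda>_\<in>{v}. w) ` colorings v"
    proof
      fix f assume "f \<in> coherent_colorings {v}"
      then have "f = (\<lambda>_\<in>{v}. f v)" "f v \<in> colorings v"
        unfolding iff by (auto simp: extensional_def fun_eq_iff restrict_def)
      then show "f \<in> (\<lambda>w. \<lambda>_\<in>{v}. w) ` colorings v"
        by blast
    qed
  qed (auto simp: iff)
qed

lemma extendable_vertex:
  assumes "c \<in> X 0"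
  shows "extendable c"
proof -
  obtain v where "c = {v}"
    using zero_cell_singleton[OF assms] .
  then show ?thesis
    using assms by (auto simp: extendable_def vertices_vertex coherent_colorings_vertex)
qed

lemma extendable_edge:
  assumes e: "e \<in> X 1"
  shows "extendable e"
  unfolding extendable_def
proof (intro ballI)
  fix v w assume v: "v \<in> vertices e" and w: "w \<in> colorings v"
  define f where "f = (\<lambda>u\<in>vertices e. edge_transport n X (e, u) w)"
  have f: "f u \<in> colorings u" "\<And>r. r \<in> regions e \<Longrightarrow> f u r = w r" if "u \<in> vertices e" for u
    using edge_transport_coloring[OF e that v w] that by (auto simp: f_def)
  have "f \<in> coherent_colorings e"
  proof (rule coherent_coloringsI)
    show "f u r = f u' r"
      if "e' \<in> X 1" "e' \<subseteq> e" "u \<in> vertices e'" "u' \<in> vertices e'" "r \<in> regions e'" for e' u u' r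
      using that f(2) edge_subset_edge[OF that(1) e that(2)] by simp
  qed (use f(1) in \<open>auto simp: f_def\<close>)
  moreover have "f v = w"
    using edge_transport_eqI[OF e v w, of w] v by (simp add: f_def)
  ultimately show "\<exists>f\<in>coherent_colorings e. f v = w"
    by blast
qed

subsection \<open>Homotopy invariance of transport\<close>

lemma alexandrov_continuous_on_carrier_cell:
  assumes "continuous_on Y g" "g ` Y \<subseteq> M"
  shows "sheaf.alexandrov_continuous_on Y (\<lambda>y. carrier_cell (g y))"
  unfolding sheaf.alexandrov_continuous_on_def
proof (intro conjI ballI)
  show "(\<lambda>y. carrier_cell (g y)) ` Y \<subseteq> cells"
    using assms(2) carrier_cell(1) by blast
  fix y assume y: "y \<in> Y"
  then obtain W where W: "openin (top_of_set M) W" "g y \<in> W" "\<And>x. x \<in> W \<Longrightarrow> carrier_cell (g y) \<subseteq> carrier_cell x"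
    using assms(2) carrier_cell_upward_nbhd by blast
  then obtain G where G: "open G" "W = M \<inter> G"
    by (auto simp: openin_open)
  have "(g \<longlongrightarrow> g y) (at y within Y)"
    using assms(1) y by (simp add: continuous_on_def)
  then have "\<forall>\<^sub>F z in at y within Y. g z \<in> G"
    using G W(2) by (intro topological_tendstoD) auto
  moreover have "\<forall>\<^sub>F z in at y within Y. z \<in> Y"
    by (simp add: eventually_at_filter)
  ultimately show "\<forall>\<^sub>F z in at y within Y. carrier_cell (g y) \<subseteq> carrier_cell (g z)"
    by eventually_elim (use assms(2) G(2) W(3) in blast)
qed

lemma flat_section_edge_arc:
  assumes e: "e \<in> X 1" "v \<in> vertices e" "u \<in> vertices e" "u \<noteq> v"
    and s: "sheaf.flat_section {0..1} (\<lambda>t. carrier_cell (edge_arc e v u t)) s"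
  shows "s 1 u = edge_transport n X (e, u) (s 0 v)"
proof -
  let ?p = "edge_arc e v u"
  have vertex: "{v} \<in> X 0" "{u} \<in> X 0" "{v} \<in> cells" "{v} \<subseteq> e"
    using e by (auto simp: vertices_def)
  have p: "?p 0 = v" "?p 1 = u" "continuous_on {0..1} ?p" "?p ` {0..1} = e"
    using edge_arc[OF e] by (auto simp: arc_def path_def path_image_def pathstart_def pathfinish_def)
  have "s 0 \<in> coherent_colorings (carrier_cell (?p 0))"
    using s by (simp add: sheaf.flat_section_def)
  then have s0: "s 0 \<in> coherent_colorings {v}"
    using p(1) carrier_cell_vertex[OF vertex(1)] by simp
  then have "s 0 v \<in> colorings v"
    by (auto simp: coherent_colorings_vertex[OF vertex(1)])
  then obtain f where f: "f \<in> coherent_colorings e" "f v = s 0 v"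
    using extendable_edge[OF e(1)] e(2) unfolding extendable_def by blast
  have "sheaf.flat_section {0..1} (\<lambda>t. carrier_cell (?p t)) (\<lambda>t. restrict_coloring (carrier_cell (?p t)) f)"
    using p(3,4) cell_subset e(1) f(1) carrier_cell_subset[of e]
    by (intro sheaf.flat_section_constant[of _ _ e] alexandrov_continuous_on_carrier_cell) blast+
  moreover have "s 0 = restrict_coloring (carrier_cell (?p 0)) f"
    using coherent_colorings_eqI[OF _ s0 restrict_coloring_coherent[OF f(1)], of v] vertex f(2) p(1)
    by (simp add: carrier_cell_vertex vertices_vertex restrict_coloring_apply)
  ultimately have "s 1 = restrict_coloring (carrier_cell (?p 1)) f"
    using sheaf.flat_section_unique[OF connected_Icc s, of _ 0 1] by auto
  then have "s 1 u = f u"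
    using p(2) vertex(2) by (simp add: carrier_cell_vertex vertices_vertex restrict_coloring_apply)
  also have "\<dots> = edge_transport n X (e, u) (s 0 v)"
    using coherent_transport[of v "[(e, u)]" u e f] e vertex f by (auto simp: transport_def vertices_def)
  finally show ?thesis .
qed

lemma flat_section_realization:
  assumes "edge_path X v es w" "sheaf.flat_section {0..1} (\<lambda>t. carrier_cell (realization v es t)) s"
  shows "s 1 w = transport n X es (s 0 v)"
  using assms
proof (induction es arbitrary: v s)
  case Nil
  then show ?case
    using sheaf.flat_section_constant_base[OF connected_Icc, of 0 1 _ s 0 1] by (simp add: transport_Nil)
next
  case (Cons a es)
  then obtain e u where a: "a = (e, u)" and e: "e \<in> X 1" "v \<in> vertices e" "u \<in> vertices e" "u \<noteq> v"
    and es: "edge_path X u es w"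
    by (elim edge_path_ConsE)
  let ?p = "edge_arc e v u" and ?q = "realization u es"
  have s: "sheaf.flat_section {0..1} (\<lambda>t. carrier_cell ((?p +++ ?q) t)) s"
    using Cons.prems(2) a by simp
  have pq: "?p 1 = ?q 0"
    using edge_arc(4)[OF e] realization_path(2)[OF es] by (simp add: pathstart_def pathfinish_def)
  have "sheaf.flat_section {0..1} (\<lambda>t. carrier_cell (?p t)) (s \<circ> (\<lambda>t. t / 2))"
    by (rule sheaf.flat_section_compose[OF s]) (auto intro!: continuous_intros simp: joinpaths_def)
  then have "s (1 / 2) u = edge_transport n X (e, u) (s 0 v)"
    using flat_section_edge_arc[OF e] by fastforce
  moreover have "sheaf.flat_section {0..1} (\<lambda>t. carrier_cell (?q t)) (s \<circ> (\<lambda>t. (t + 1) / 2))"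
  proof (rule sheaf.flat_section_compose[OF s])
    show "carrier_cell (?q t) = carrier_cell ((?p +++ ?q) ((t + 1) / 2))" if "t \<in> {0..1}" for t
      using that pq by (auto simp: joinpaths_def add_divide_distrib)
  qed (auto intro!: continuous_intros)
  from Cons.IH[OF es this] have "s 1 w = transport n X es (s (1 / 2) u)"
    by simp
  ultimately show ?case
    by (simp add: a transport_Cons)
qed

lemma flat_sections_extend_homotopy:
  assumes S: "S \<subseteq> M" "\<And>x. x \<in> S \<Longrightarrow> extendable (carrier_cell x)"
    and h: "continuous_on ({0..1} \<times> {0..1}) h" "h ` ({0..1::real} \<times> {0..1::real}) \<subseteq> S"
  shows "sheaf.flat_sections_extend ({0..1} \<times> {0..1}) (\<lambda>z. carrier_cell (h z))"
proof (rule sheaf.flat_sections_extend_square)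
  show "sheaf.alexandrov_continuous_on ({0..1} \<times> {0..1}) (\<lambda>z. carrier_cell (h z))"
    using alexandrov_continuous_on_carrier_cell[OF h(1)] h(2) S(1) by blast
  show "restrict_coloring (carrier_cell (h y)) ` coherent_colorings (carrier_cell (h z)) =
      coherent_colorings (carrier_cell (h y))"
    if "y \<in> {0..1} \<times> {0..1}" "z \<in> {0..1} \<times> {0..1}" "carrier_cell (h y) \<subseteq> carrier_cell (h z)" for y z
    using that h(2) S by (intro extendable_restrict_surj carrier_cell(1)) blast+
qed

lemma flat_section_edge_path_side:
  assumes s: "sheaf.flat_section Q (\<lambda>z. carrier_cell (h z)) s" and "Pair t ` {0..1} \<subseteq> Q"
    and es: "edge_path X v es w" "\<And>x. x \<in> {0..1} \<Longrightarrow> h (t, x) = realization v es x"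
  shows "s (t, 1::real) w = transport n X es (s (t, 0) v)"
proof -
  have "sheaf.flat_section {0..1} (\<lambda>x. carrier_cell (realization v es x)) (s \<circ> Pair t)"
    by (rule sheaf.flat_section_compose[OF s]) (use assms in \<open>auto intro!: continuous_intros\<close>)
  then show ?thesis
    using flat_section_realization[OF es(1)] by fastforce
qed

lemma flat_section_constant_side:
  assumes s: "sheaf.flat_section Q (\<lambda>z. carrier_cell (h z)) s" and "(\<lambda>t. (t, x)) ` {0..1} \<subseteq> Q"
    and "\<And>t. t \<in> {0..1} \<Longrightarrow> h (t, x) = a"
  shows "s (0::real, x) = s (1, x)"
proof -
  have "sheaf.flat_section {0..1} (\<lambda>_. carrier_cell a) (s \<circ> (\<lambda>t. (t, x)))"
    by (rule sheaf.flat_section_compose[OF s]) (use assms in \<open>auto intro!: continuous_intros\<close>)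
  then show ?thesis
    using sheaf.flat_section_constant_base[OF connected_Icc, of 0 1 "carrier_cell a" "s \<circ> (\<lambda>t. (t, x))" 0 1] by simp
qed

theorem transport_homotopic:
  assumes S: "S \<subseteq> M" "\<And>x. x \<in> S \<Longrightarrow> extendable (carrier_cell x)"
    and es: "edge_path X v es w" "edge_path X v es' w"
    and homotopic: "homotopic_paths S (realization v es) (realization v es')"
    and f: "f \<in> colorings v"
  shows "transport n X es f = transport n X es' f"
proof -
  have ends: "pathstart (realization v es) = v" "pathfinish (realization v es) = w"
    using realization_path[OF es(1)] by auto
  obtain h :: "real \<times> real \<Rightarrow> 'a" where h: "continuous_on ({0..1} \<times> {0..1}) h" "h ` ({0..1} \<times> {0..1}) \<subseteq> S"
    "\<And>x. x \<in> {0..1} \<Longrightarrow> h (0, x) = realization v es x" "\<And>x. x \<in> {0..1} \<Longrightarrow> h (1, x) = realization v es' x"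
    "\<And>t. t \<in> {0..1} \<Longrightarrow> pathstart (h \<circ> Pair t) = v \<and> pathfinish (h \<circ> Pair t) = w"
    using homotopic unfolding homotopic_paths ends image_subset_iff_funcset by blast
  have corners: "h (t, 0) = v" "h (t, 1) = w" if "t \<in> {0..1}" for t
    using h(5)[OF that] by (auto simp: pathstart_def pathfinish_def)
  have "(\<lambda>_\<in>{v}. f) \<in> coherent_colorings (carrier_cell (h (0, 0)))"
    using corners(1)[of 0] f edge_path_vertices[OF es(1)] by (simp add: carrier_cell_vertex coherent_colorings_vertex)
  then obtain s where s: "sheaf.flat_section ({0..1} \<times> {0..1}) (\<lambda>z. carrier_cell (h z)) s" "s (0, 0) = (\<lambda>_\<in>{v}. f)"
    using flat_sections_extend_homotopy[OF S h(1,2)] unfolding sheaf.flat_sections_extend_def by force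
  have "s (0, 1) w = transport n X es (s (0, 0) v)" "s (1, 1) w = transport n X es' (s (1, 0) v)"
    using flat_section_edge_path_side[OF s(1) _ es(1) h(3)] flat_section_edge_path_side[OF s(1) _ es(2) h(4)]
    by (simp_all add: image_subset_iff)
  moreover have "s (0, 0) = s (1, 0)" "s (0, 1) = s (1, 1)"
    using flat_section_constant_side[OF s(1) _ corners(1)] flat_section_constant_side[OF s(1) _ corners(2)]
    by (simp_all add: image_subset_iff)
  moreover have "s (0, 0) v = f"
    by (simp add: s(2))
  ultimately show ?thesis
    by simp
qed

end

section \<open>Extending colorings over cells\<close>

context cpx_complex
begin

text \<open>\<open>r\<close> and \<open>r'\<close> are the regions at \<open>u\<close> that contain \<open>e\<close>, respectively \<open>e'\<close>, but not the polygon \<open>c\<close>.\<close>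

definition corner :: "'a set \<Rightarrow> 'a \<Rightarrow> 'a set \<Rightarrow> 'a set \<Rightarrow> 'a set \<Rightarrow> 'a set \<Rightarrow> bool" where
  "corner c u e e' r r' \<longleftrightarrow> {d \<in> X 1. d \<subseteq> c \<and> u \<in> d} = {e, e'} \<and> e \<noteq> e' \<and>
     r \<notin> regions c \<and> r' \<notin> regions c \<and> r \<noteq> r' \<and>
     regions e = insert r (regions c) \<and> regions e' = insert r' (regions c) \<and>
     regions {u} = insert r (insert r' (regions c))"

lemma corner_swap: "corner c u e e' r r' \<Longrightarrow> corner c u e' e r' r"
  by (auto simp: corner_def)

lemma corner_edges:
  assumes "corner c u e e' r r'"
  shows "e \<in> X 1" "e' \<in> X 1" "e \<subseteq> c" "e' \<subseteq> c" "u \<in> e" "u \<in> e'"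
proof -
  have "{d \<in> X 1. d \<subseteq> c \<and> u \<in> d} = {e, e'}"
    using assms by (simp only: corner_def)
  then have "e \<in> {d \<in> X 1. d \<subseteq> c \<and> u \<in> d}" "e' \<in> {d \<in> X 1. d \<subseteq> c \<and> u \<in> d}"
    by (simp_all only: insert_iff simp_thms)
  then show "e \<in> X 1" "e' \<in> X 1" "e \<subseteq> c" "e' \<subseteq> c" "u \<in> e" "u \<in> e'"
    by blast+
qed

lemma corner_edge_cases:
  assumes "corner c u e e' r r'" "d \<in> X 1" "d \<subseteq> c" "u \<in> d"
  shows "d = e \<or> d = e'"
proof -
  have "{d \<in> X 1. d \<subseteq> c \<and> u \<in> d} = {e, e'}"
    using assms(1) by (simp only: corner_def)
  then show ?thesis
    using assms(2-4) by blast
qed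

lemma card_regions_outside_cell:
  assumes "{u} \<in> X 0" "d \<in> X j" "u \<in> d"
  shows "card (regions {u} - regions d) = j"
proof -
  have "regions d \<subseteq> regions {u}"
    using assms(3) by (intro regions_antimono) auto
  then show ?thesis
    using card_regions[OF assms] card_regions[OF assms(1) assms(1)]
    by (simp add: card_Diff_subset finite_regions)
qed

lemma edge_of_outside_region:
  assumes u: "{u} \<in> X 0" and c: "c \<in> X 2" "u \<in> c" and s: "s \<in> regions {u} - regions c"
  shows "\<exists>e\<in>X 1. e \<subseteq> c \<and> u \<in> e \<and> regions e = insert s (regions c)"
proof -
  have "regions c \<subseteq> regions {u}"
    using c(2) by (intro regions_antimono) auto
  then have "insert s (regions c) \<subseteq> regions {u}"
    using s by blast
  moreover have "n + 1 - card (insert s (regions c)) = 1"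
    using s card_regions[OF u c] by (simp add: finite_regions)
  ultimately obtain e where "e \<in> X 1" "u \<in> e" "regions e = insert s (regions c)"
    using cell_of_regions[OF u, of "insert s (regions c)"] by auto
  then show ?thesis
    using regions_subset_iff[OF u _ _ c, of e 1] by blast
qed

lemma outside_region_of_edge:
  assumes u: "{u} \<in> X 0" and c: "c \<in> X 2" "u \<in> c" and e: "e \<in> X 1" "e \<subseteq> c" "u \<in> e"
  shows "\<exists>s\<in>regions {u} - regions c. regions e = insert s (regions c)"
proof -
  have sub: "regions c \<subseteq> regions e" "regions e \<subseteq> regions {u}"
    using e by (auto intro!: regions_antimono)
  then have "card (regions e - regions c) = 1"
    using card_regions[OF u e(1,3)] card_regions[OF u c] by (simp add: card_Diff_subset finite_regions)
  then obtain s where "regions e - regions c = {s}"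
    by (meson card_1_singletonE)
  then show ?thesis
    using sub by blast
qed

lemma two_cell_corner:
  assumes c: "c \<in> X 2" "u \<in> vertices c"
  shows "\<exists>e e' r r'. corner c u e e' r r'"
proof -
  have u: "{u} \<in> X 0" "u \<in> c"
    using c(2) by (auto simp: vertices_def)
  obtain r r' where r: "regions {u} - regions c = {r, r'}" "r \<noteq> r'"
    using card_regions_outside_cell[OF u(1) c(1) u(2)] by (meson card_2_iff)
  have outside: "r \<in> regions {u} - regions c" "r' \<in> regions {u} - regions c"
    unfolding r(1) by simp_all
  obtain e where e: "e \<in> X 1" "e \<subseteq> c" "u \<in> e" "regions e = insert r (regions c)"
    using edge_of_outside_region[OF u(1) c(1) u(2) outside(1)] by blast
  obtain e' where e': "e' \<in> X 1" "e' \<subseteq> c" "u \<in> e'" "regions e' = insert r' (regions c)"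
    using edge_of_outside_region[OF u(1) c(1) u(2) outside(2)] by blast
  have "d \<in> {e, e'}" if d: "d \<in> X 1" "d \<subseteq> c" "u \<in> d" for d
  proof -
    obtain s where "s \<in> {r, r'}" "regions d = insert s (regions c)"
      using outside_region_of_edge[OF u(1) c(1) u(2) d] unfolding r(1) by blast
    then have "regions d = regions e \<or> regions d = regions e'"
      using e(4) e'(4) by auto
    then show ?thesis
      using regions_subset_iff[OF u(1)] d e e' by (metis insertCI order_refl subset_antisym)
  qed
  then have "{d \<in> X 1. d \<subseteq> c \<and> u \<in> d} = {e, e'}"
    using e(1-3) e'(1-3) by blast
  moreover have "e \<noteq> e'"
    using e(4) e'(4) outside r(2) by (metis DiffD2 insertE insertI1)
  moreover have "regions {u} = insert r (insert r' (regions c))"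
    using r(1) regions_antimono[of "{u}" c] u(2) by blast
  ultimately show ?thesis
    unfolding corner_def using e(4) e'(4) outside r(2) by (intro exI[of _ e] exI[of _ e'] exI[of _ r] exI[of _ r']) simp
qed

lemma cell_vertices_connected:
  assumes c: "c \<in> cells" and W: "W \<subseteq> vertices c" "W \<noteq> {}"
    and closed: "\<And>e. e \<in> X 1 \<Longrightarrow> e \<subseteq> c \<Longrightarrow> vertices e \<inter> W \<noteq> {} \<Longrightarrow> vertices e \<subseteq> W"
  shows "W = vertices c"
proof -
  have reach: "edge_path X u es v \<Longrightarrow> u \<in> W \<Longrightarrow> \<Union>(fst ` set es) \<subseteq> c \<Longrightarrow> v \<in> W" for u es v
  proof (induction es arbitrary: u)
    case (Cons s es)
    then obtain e x where "s = (e, x)" "e \<in> X 1" "u \<in> vertices e" "x \<in> vertices e" "edge_path X x es v"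
      by (elim edge_path_ConsE)
    then show ?case
      using Cons.IH[of x] Cons.prems(2,3) closed[of e] by auto
  qed simp
  obtain u where u: "u \<in> W"
    using W(2) by blast
  have "v \<in> W" if v: "v \<in> vertices c" for v
  proof -
    obtain es where "edge_path X u es v" "\<Union>(fst ` set es) \<subseteq> c"
      using cell_edge_connected[OF c subsetD[OF W(1) u] v] .
    then show ?thesis
      using reach u by blast
  qed
  then show ?thesis
    using W(1) by blast
qed

lemma two_cell_cycle_graph:
  assumes c: "c \<in> X 2"
  shows "cycle_graph {e \<in> X 1. e \<subseteq> c} (vertices c) vertices"
proof
  show "finite {e \<in> X 1. e \<subseteq> c}"
    using finite_cells by (rule rev_finite_subset) blast
  show "vertices e \<subseteq> vertices c" "card (vertices e) = 2" if "e \<in> {e \<in> X 1. e \<subseteq> c}" for e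
    using that vertices_mono card_vertices_edge by auto
  show "card {e \<in> {e \<in> X 1. e \<subseteq> c}. v \<in> vertices e} = 2" if v: "v \<in> vertices c" for v
  proof -
    obtain e e' r r' where "corner c v e e' r r'"
      using two_cell_corner[OF c v] by blast
    then have "{d \<in> X 1. d \<subseteq> c \<and> v \<in> d} = {e, e'}" "e \<noteq> e'"
      by (simp_all only: corner_def simp_thms)
    moreover have "{e \<in> {e \<in> X 1. e \<subseteq> c}. v \<in> vertices e} = {d \<in> X 1. d \<subseteq> c \<and> v \<in> d}"
      using v by (auto simp: vertices_def)
    ultimately show ?thesis
      by (simp only: card_2_iff) blast
  qed
  show "W = vertices c"
    if "W \<subseteq> vertices c" "W \<noteq> {}" "\<And>e. e \<in> {e \<in> X 1. e \<subseteq> c} \<Longrightarrow> vertices e \<inter> W \<noteq> {} \<Longrightarrow> vertices e \<subseteq> W" for W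
    using that c by (intro cell_vertices_connected) blast+
qed

lemma two_cell_alternating_edge_coloring:
  assumes c: "c \<in> X 2" "even_sided X c"
  shows "\<exists>b :: 'a set \<Rightarrow> bool. \<forall>u\<in>vertices c. \<forall>e e' r r'. corner c u e e' r r' \<longrightarrow> b e \<noteq> b e'"
proof (rule cycle_graph.even_alternating_edge_coloring[OF two_cell_cycle_graph[OF c(1)]])
  show "even (card {e \<in> X 1. e \<subseteq> c})"
    using c(2) by (simp add: even_sided_def)
  fix b :: "'a set \<Rightarrow> bool"
  assume b: "\<And>u e e'. e \<in> {e \<in> X 1. e \<subseteq> c} \<Longrightarrow> e' \<in> {e \<in> X 1. e \<subseteq> c} \<Longrightarrow>
      u \<in> vertices e \<Longrightarrow> u \<in> vertices e' \<Longrightarrow> e \<noteq> e' \<Longrightarrow> b e \<noteq> b e'"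
  have "b e \<noteq> b e'" if "u \<in> vertices c" "corner c u e e' r r'" for u e e' r r'
  proof (rule b[of _ _ u])
    show "e \<noteq> e'"
      using that(2) by (simp only: corner_def simp_thms)
  qed (use that(1) corner_edges[OF that(2)] in \<open>auto simp: vertices_def\<close>)
  then have "\<forall>u\<in>vertices c. \<forall>e e' r r'. corner c u e e' r r' \<longrightarrow> b e \<noteq> b e'"
    by blast
  then show ?thesis
    by (intro exI[of _ b])
qed

lemma two_cell_oriented_corners:
  assumes c: "c \<in> X 2" "even_sided X c"
  obtains b :: "'a set \<Rightarrow> bool" and e e' r r'
  where "\<And>u. u \<in> vertices c \<Longrightarrow> corner c u (e u) (e' u) (r u) (r' u)"
    and "\<And>u. u \<in> vertices c \<Longrightarrow> b (e u) \<and> \<not> b (e' u)"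
proof -
  obtain b :: "'a set \<Rightarrow> bool"
    where b: "\<forall>u\<in>vertices c. \<forall>e e' r r'. corner c u e e' r r' \<longrightarrow> b e \<noteq> b e'"
    using two_cell_alternating_edge_coloring[OF c] by (rule exE)
  have "\<exists>e e' r r'. corner c u e e' r r' \<and> b e \<and> \<not> b e'" if u: "u \<in> vertices c" for u
  proof -
    obtain e e' r r' where "corner c u e e' r r'"
      using two_cell_corner[OF c(1) u] by blast
    moreover from this have "b e \<noteq> b e'"
      using b u by blast
    ultimately show ?thesis
      using corner_swap by blast
  qed
  then show thesis
    using that[of _ _ _ _ b] by metis
qed

definition exchange :: "'a set \<Rightarrow> 'a set \<Rightarrow> 'a set \<Rightarrow> 'a set \<Rightarrow> 'a set \<Rightarrow> 'a set" where
  "exchange r r' s s' t = (if t = r then s else if t = r' then s' else t)"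

lemma exchange_bij:
  assumes "corner c u e e' r r'" "corner c v d d' s s'"
  shows "bij_betw (exchange r r' s s') (regions {u}) (regions {v})"
proof -
  have "regions {u} = insert r (insert r' (regions c))" "regions {v} = insert s (insert s' (regions c))"
    "r \<noteq> r'" "r \<notin> regions c" "r' \<notin> regions c" "s \<noteq> s'" "s \<notin> regions c" "s' \<notin> regions c"
    using assms by (simp_all only: corner_def simp_thms)
  then show ?thesis
    by (auto simp: bij_betw_def inj_on_def exchange_def)
qed

lemma exchange_edge:
  assumes corner: "corner c u e e' r r'" and d: "d \<in> X 1" "d \<subseteq> c" "u \<in> d" and t: "t \<in> regions d"
  shows "exchange r r' s s' t = (if t \<in> regions c then t else if d = e then s else s')"
proof -
  have u: "r \<notin> regions c" "r' \<notin> regions c" "r \<noteq> r'" "e \<noteq> e'"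
    "regions e = insert r (regions c)" "regions e' = insert r' (regions c)"
    using corner by (simp_all only: corner_def simp_thms)
  then show ?thesis
    using corner_edge_cases[OF corner d] t by (auto simp: exchange_def)
qed

lemma extendable_two_cell:
  assumes c: "c \<in> X 2" "even_sided X c"
  shows "extendable c"
  unfolding extendable_def
proof (intro ballI)
  fix v w assume v: "v \<in> vertices c" and w: "w \<in> colorings v"
  obtain b :: "'a set \<Rightarrow> bool" and e e' r r'
    where corner: "\<And>u. u \<in> vertices c \<Longrightarrow> corner c u (e u) (e' u) (r u) (r' u)"
      and b: "\<And>u. u \<in> vertices c \<Longrightarrow> b (e u) \<and> \<not> b (e' u)"
    by (rule two_cell_oriented_corners[OF c]) (rule that)
  define f where "f = (\<lambda>u\<in>vertices c. restrict (w \<circ> exchange (r u) (r' u) (r v) (r' v)) (regions {u}))"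
  have color: "f u t = (if t \<in> regions c then w t else if b d then w (r v) else w (r' v))"
    if u: "u \<in> vertices c" and d: "d \<in> X 1" "d \<subseteq> c" "u \<in> d" and t: "t \<in> regions d" for u d t
  proof -
    have "t \<in> regions {u}"
      using t d(3) regions_antimono[of "{u}" d] by blast
    moreover have "b d \<longleftrightarrow> d = e u"
      using corner_edge_cases[OF corner[OF u] d] b[OF u] by auto
    ultimately show ?thesis
      using u exchange_edge[OF corner[OF u] d t] by (simp add: f_def)
  qed
  have coloring: "f u \<in> colorings u" if u: "u \<in> vertices c" for u
    using coloring_compose_bij[OF w exchange_bij[OF corner[OF u] corner[OF v]]] u by (simp add: f_def)
  have "f \<in> coherent_colorings c"
  proof (rule coherent_coloringsI)
    show "f u t = f u' t"
      if "d \<in> X 1" "d \<subseteq> c" "u \<in> vertices d" "u' \<in> vertices d" "t \<in> regions d" for d u u' t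
    proof -
      have "u \<in> vertices c" "u' \<in> vertices c" "u \<in> d" "u' \<in> d"
        using that(3,4) vertices_mono[OF that(2)] by (auto simp: vertices_def)
      then show ?thesis
        using color[OF _ that(1,2) _ that(5)] by simp
    qed
  qed (use coloring in \<open>auto simp: f_def\<close>)
  moreover have "f v = w"
    by (rule colorings_eqI[OF coloring[OF v] w]) (simp add: f_def v exchange_def)
  ultimately show "\<exists>f\<in>coherent_colorings c. f v = w"
    by blast
qed

lemma extendable_if_path_independent:
  assumes c: "c \<in> cells"
    and independent: "\<And>v w u es es'. v \<in> vertices c \<Longrightarrow> w \<in> colorings v \<Longrightarrow>
      edge_path X v es u \<Longrightarrow> \<Union>(fst ` set es) \<subseteq> c \<Longrightarrow> edge_path X v es' u \<Longrightarrow> \<Union>(fst ` set es') \<subseteq> c \<Longrightarrow>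
      transport n X es w = transport n X es' w"
  shows "extendable c"
  unfolding extendable_def
proof (intro ballI)
  fix v w assume v: "v \<in> vertices c" and w: "w \<in> colorings v"
  have "\<exists>es. edge_path X v es u \<and> \<Union>(fst ` set es) \<subseteq> c" if "u \<in> vertices c" for u
    using edge_connected_in_cell[OF c v that] by (simp only: edge_connected_in_def)
  then obtain P where P: "\<And>u. u \<in> vertices c \<Longrightarrow> edge_path X v (P u) u \<and> \<Union>(fst ` set (P u)) \<subseteq> c"
    by metis
  define f where "f = (\<lambda>u\<in>vertices c. transport n X (P u) w)"
  have f: "f u = transport n X es w" if "u \<in> vertices c" "edge_path X v es u" "\<Union>(fst ` set es) \<subseteq> c" for u es
    using independent[OF v w _ _ that(2,3)] P[OF that(1)] that(1) by (simp add: f_def)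
  have coloring: "f u \<in> colorings u" if "u \<in> vertices c" for u
    using P[OF that] transport_coloring[OF _ w] that by (simp add: f_def)
  have "f \<in> coherent_colorings c"
  proof (rule coherent_coloringsI)
    fix e a b r assume e: "e \<in> X 1" "e \<subseteq> c" and ab: "a \<in> vertices e" "b \<in> vertices e" and r: "r \<in> regions e"
    show "f a r = f b r"
    proof (cases "a = b")
      case False
      have c_ab: "a \<in> vertices c" "b \<in> vertices c"
        using ab vertices_mono[OF e(2)] by auto
      have "edge_path X v (P a @ [(e, b)]) b"
        using P[OF c_ab(1)] e ab False by (intro edge_path_append[of v _ a]) (auto simp: vertices_def)
      then have "f b = transport n X (P a @ [(e, b)]) w"
        using P[OF c_ab(1)] e(2) by (intro f[OF c_ab(2)]) auto
      then have "f b = edge_transport n X (e, b) (f a)"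
        using c_ab(1) by (simp add: transport_def f_def)
      then show ?thesis
        using edge_transport_coloring(2)[OF e(1) ab(2,1) coloring[OF c_ab(1)] r] by simp
    qed simp
  qed (use coloring in \<open>auto simp: f_def\<close>)
  moreover have "f v = w"
    using f[OF v, of "[]"] v by (simp add: vertices_def transport_Nil)
  ultimately show "\<exists>f\<in>coherent_colorings c. f v = w"
    by blast
qed

lemma extendable_high_cell:
  assumes c: "c \<in> X k" "3 \<le> k" and faces: "\<And>j d. j < k \<Longrightarrow> d \<in> X j \<Longrightarrow> extendable d"
  shows "extendable c"
proof (rule extendable_if_path_independent)
  show "c \<in> cells"
    using c(1) by blast
  fix v w u es es' assume v: "v \<in> vertices c" and w: "w \<in> colorings v"
    and es: "edge_path X v es u" "\<Union>(fst ` set es) \<subseteq> c" and es': "edge_path X v es' u" "\<Union>(fst ` set es') \<subseteq> c"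
  let ?B = "cell_boundary X k c"
  have BM: "?B \<subseteq> M"
    using cell_subset c(1) cell_boundary_subset by blast
  have B: "extendable (carrier_cell x)" if "x \<in> ?B" for x
    using carrier_cell_boundary[OF that] faces by metis
  have realization: "path_image (realization v ds) \<subseteq> ?B" if "edge_path X v ds u" "\<Union>(fst ` set ds) \<subseteq> c" for ds
  proof -
    have "e \<subseteq> ?B" if "e \<in> X 1" "e \<subseteq> c" for e
      using that c(2) unfolding cell_boundary_def by (intro Union_upper) (auto intro!: exI[of _ 1])
    moreover have "v \<in> ?B"
      using v vertices_subset_cell_boundary[of k c] c(2) by auto
    ultimately show ?thesis
      unfolding realization_path(4)[OF that(1)] using edge_path_edges[OF that(1)] that(2) by (auto simp: Sup_le_iff)
  qed
  have "homotopic_paths ?B (realization v es) (realization v es')"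
    using realization_path[OF es(1)] realization_path[OF es'(1)] realization[OF es] realization[OF es']
    by (intro cell_boundary_homotopic_paths[OF c]) auto
  then show "transport n X es w = transport n X es' w"
    using transport_homotopic[OF BM B es(1) es'(1) _ w] by blast
qed

lemma extendable_cell:
  assumes even: "\<And>c. c \<in> X 2 \<Longrightarrow> even_sided X c" and "c \<in> cells"
  shows "extendable c"
proof -
  have "extendable c" if "c \<in> X k" for k c
    using that
  proof (induction k arbitrary: c rule: less_induct)
    case (less k)
    consider "k = 0" | "k = 1" | "k = 2" | "3 \<le> k"
      by linarith
    then show ?case
      using less extendable_vertex extendable_edge extendable_two_cell even extendable_high_cell
      by cases blast+
  qed
  then show ?thesis
    using assms(2) by blast
qed

end

section \<open>Holonomy of closed edge paths\<close>

lemma bij_betw_permutation_ex1: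
  assumes f: "bij_betw f A B" and g: "bij_betw g A B"
  shows "\<exists>!\<sigma>. \<sigma> permutes B \<and> (\<forall>a\<in>A. g a = \<sigma> (f a))"
proof (rule ex1I)
  let ?\<sigma> = "\<lambda>b. if b \<in> B then g (inv_into A f b) else b"
  have "bij_betw (g \<circ> inv_into A f) B B"
    by (rule bij_betw_trans[OF bij_betw_inv_into[OF f] g])
  then have "bij_betw ?\<sigma> B B"
    by (rule bij_betw_cong[THEN iffD1, rotated]) simp
  then have "?\<sigma> permutes B"
    by (rule bij_imp_permutes) simp
  then show "?\<sigma> permutes B \<and> (\<forall>a\<in>A. g a = ?\<sigma> (f a))"
    using f bij_betw_inv_into_left[OF f] by (auto simp: bij_betw_def)
  fix \<tau> assume \<tau>: "\<tau> permutes B \<and> (\<forall>a\<in>A. g a = \<tau> (f a))"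
  show "\<tau> = ?\<sigma>"
  proof
    show "\<tau> b = ?\<sigma> b" for b
      using \<tau> bij_betw_inv_into_right[OF f, of b] bij_betwE[OF bij_betw_inv_into[OF f]]
      by (cases "b \<in> B") (metis, simp add: permutes_not_in[of _ B])
  qed
qed

context cpx_complex
begin

lemma permuted_coloring:
  assumes "f \<in> colorings v" "\<sigma> permutes {1..n+1}"
  shows "restrict (\<sigma> \<circ> f) (regions {v}) \<in> colorings v"
proof -
  have "bij_betw (\<sigma> \<circ> f) (regions {v}) {1..n+1}"
    using assms permutes_imp_bij by (auto simp: colorings_def intro: bij_betw_trans)
  then show ?thesis
    by (simp add: colorings_def)
qed

lemma transport_permuted:
  assumes "\<sigma> permutes {1..n+1}"
  shows "edge_path X v es w \<Longrightarrow> f \<in> colorings v \<Longrightarrow>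
    transport n X es (restrict (\<sigma> \<circ> f) (regions {v})) = restrict (\<sigma> \<circ> transport n X es f) (regions {w})"
proof (induction es arbitrary: v f)
  case Nil
  then show ?case
    by (simp add: transport_Nil)
next
  case (Cons s es)
  then obtain e u where s: "s = (e, u)" and e: "e \<in> X 1" "v \<in> vertices e" "u \<in> vertices e"
    and es: "edge_path X u es w"
    by (elim edge_path_ConsE)
  note g = edge_transport_coloring[OF e(1,3,2) Cons.prems(2)]
  have "regions e \<subseteq> regions {u}" "regions e \<subseteq> regions {v}"
    using e(2,3) by (auto simp: vertices_def intro!: regions_antimono)
  then have "edge_transport n X (e, u) (restrict (\<sigma> \<circ> f) (regions {v})) =
      restrict (\<sigma> \<circ> edge_transport n X (e, u) f) (regions {u})"
    using g assms by (intro edge_transport_eqI[OF e(1,3)] permuted_coloring) auto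
  then show ?case
    unfolding s transport_Cons using Cons.IH[OF es g(1)] by (simp only:)
qed

definition holonomy :: "'a \<Rightarrow> ('a set \<Rightarrow> nat) \<Rightarrow> ('a set \<times> 'a) list \<Rightarrow> nat \<Rightarrow> nat" where
  "holonomy v w es = (THE \<sigma>. \<sigma> permutes {1..n+1} \<and> (\<forall>r\<in>regions {v}. transport n X es w r = \<sigma> (w r)))"

lemma holonomy_ex1:
  assumes "w \<in> colorings v" "edge_path X v es v"
  shows "\<exists>!\<sigma>. \<sigma> permutes {1..n+1} \<and> (\<forall>r\<in>regions {v}. transport n X es w r = \<sigma> (w r))"
  using transport_coloring[OF assms(2,1)] assms(1)
  by (intro bij_betw_permutation_ex1) (auto simp: colorings_def)

lemma holonomy:
  assumes "w \<in> colorings v" "edge_path X v es v"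
  shows "holonomy v w es permutes {1..n+1}"
    and "\<And>r. r \<in> regions {v} \<Longrightarrow> transport n X es w r = holonomy v w es (w r)"
  using theI'[OF holonomy_ex1[OF assms]] unfolding holonomy_def by auto

lemma holonomy_eqI:
  assumes "w \<in> colorings v" "edge_path X v es v" "\<sigma> permutes {1..n+1}"
    and "\<And>r. r \<in> regions {v} \<Longrightarrow> transport n X es w r = \<sigma> (w r)"
  shows "holonomy v w es = \<sigma>"
  unfolding holonomy_def using assms by (intro the1_equality holonomy_ex1) auto

lemma holonomy_append:
  assumes w: "w \<in> colorings v" and es: "edge_path X v es v" "edge_path X v es' v"
  shows "holonomy v w (es @ es') = holonomy v w es \<circ> holonomy v w es'"
proof (rule holonomy_eqI[OF w edge_path_append[OF es]])
  let ?\<sigma> = "holonomy v w es" and ?\<tau> = "holonomy v w es'"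
  show "?\<sigma> \<circ> ?\<tau> permutes {1..n+1}"
    using holonomy(1)[OF w] es by (intro permutes_compose)
  fix r assume r: "r \<in> regions {v}"
  have "transport n X es w = restrict (?\<sigma> \<circ> w) (regions {v})"
    using holonomy(2)[OF w es(1)]
    by (intro colorings_eqI[OF transport_coloring[OF es(1) w] permuted_coloring[OF w holonomy(1)[OF w es(1)]]]) simp
  then have "transport n X (es @ es') w = restrict (?\<sigma> \<circ> transport n X es' w) (regions {v})"
    using transport_permuted[OF holonomy(1)[OF w es(1)] es(2) w] by (simp only: transport_append)
  then show "transport n X (es @ es') w r = (?\<sigma> \<circ> ?\<tau>) (w r)"
    using r holonomy(2)[OF w es(2) r] by simp
qed

lemma transport_restrict:
  assumes "edge_path X v es v'" and r: "r \<in> regions {v'}"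
  shows "transport n X es (restrict col (regions {v})) r = transport n X es col r"
proof (cases es)
  case Nil
  then show ?thesis
    using assms by (simp add: transport_Nil)
next
  case (Cons s es')
  then obtain e u where s: "s = (e, u)" "v \<in> vertices e"
    using assms(1) by (auto elim!: edge_path_ConsE)
  then have "regions e \<subseteq> regions {v}"
    by (auto simp: vertices_def intro!: regions_antimono)
  then have "edge_transport n X (e, u) (restrict col (regions {v})) = edge_transport n X (e, u) col"
    by (intro edge_transport_cong) auto
  then show ?thesis
    by (simp add: Cons s transport_Cons)
qed

end

section \<open>Fundamental groups\<close>

lemma loop_class_eq_iff:
  assumes "path p" "path_image p \<subseteq> S"
  shows "loop_class S p = loop_class S q \<longleftrightarrow> homotopic_paths S p q"
proof
  assume "loop_class S p = loop_class S q"
  moreover have "p \<in> loop_class S p"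
    using assms by (simp add: loop_class_def)
  ultimately show "homotopic_paths S p q"
    by (simp add: loop_class_def homotopic_paths_sym)
next
  assume "homotopic_paths S p q"
  then show "loop_class S p = loop_class S q"
    unfolding loop_class_def using homotopic_paths_sym homotopic_paths_trans by blast
qed

lemma fundamental_group_carrierE:
  assumes "\<gamma> \<in> carrier (fundamental_group S x)"
  obtains p where "\<gamma> = loop_class S p" "path p" "path_image p \<subseteq> S" "pathstart p = x" "pathfinish p = x"
  using assms by (auto simp: fundamental_group_def)

lemma fundamental_group_carrierI:
  "path p \<Longrightarrow> path_image p \<subseteq> S \<Longrightarrow> pathstart p = x \<Longrightarrow> pathfinish p = x \<Longrightarrow>
    loop_class S p \<in> carrier (fundamental_group S x)"
  by (auto simp: fundamental_group_def)

lemma fundamental_group_mult: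
  assumes "path p" "path_image p \<subseteq> S" "path q" "path_image q \<subseteq> S" "pathfinish p = pathstart q"
  shows "loop_class S p \<otimes>\<^bsub>fundamental_group S x\<^esub> loop_class S q = loop_class S (p +++ q)"
proof -
  have "loop_class S (p' +++ q') = loop_class S (p +++ q)" if "p' \<in> loop_class S p" "q' \<in> loop_class S q" for p' q'
  proof -
    have "homotopic_paths S (p +++ q) (p' +++ q')"
      using that assms(5) by (intro homotopic_paths_join) (auto simp: loop_class_def)
    then show ?thesis
      using assms loop_class_eq_iff[of "p +++ q" S "p' +++ q'"] by (simp add: path_image_join)
  qed
  moreover have "p \<in> loop_class S p" "q \<in> loop_class S q"
    using assms by (simp_all add: loop_class_def)
  ultimately have "(\<Union>p'\<in>loop_class S p. \<Union>q'\<in>loop_class S q. loop_class S (p' +++ q')) = loop_class S (p +++ q)"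
    by blast
  then show ?thesis
    by (simp add: fundamental_group_def)
qed

lemma fundamental_group_m_closed:
  assumes "\<gamma> \<in> carrier (fundamental_group S x)" "\<delta> \<in> carrier (fundamental_group S x)"
  shows "\<gamma> \<otimes>\<^bsub>fundamental_group S x\<^esub> \<delta> \<in> carrier (fundamental_group S x)"
proof -
  obtain p where p: "\<gamma> = loop_class S p" "path p" "path_image p \<subseteq> S" "pathstart p = x" "pathfinish p = x"
    using fundamental_group_carrierE[OF assms(1)] .
  obtain q where q: "\<delta> = loop_class S q" "path q" "path_image q \<subseteq> S" "pathstart q = x" "pathfinish q = x"
    using fundamental_group_carrierE[OF assms(2)] .
  then show ?thesis
    using p fundamental_group_mult[of p S q x]
    by (auto simp: path_image_join intro!: fundamental_group_carrierI)
qed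

lemma inclusion_map_loop_class:
  assumes "path p" "path_image p \<subseteq> S" "S \<subseteq> T"
  shows "inclusion_map T (loop_class S p) = loop_class T p"
proof -
  have "loop_class T q = loop_class T p" if "q \<in> loop_class S p" for q
  proof -
    have "homotopic_paths T p q"
      using that assms(3) homotopic_paths_subset by (auto simp: loop_class_def)
    then show ?thesis
      using loop_class_eq_iff[of p T q] assms by auto
  qed
  moreover have "p \<in> loop_class S p"
    using assms by (auto simp: loop_class_def)
  ultimately show ?thesis
    unfolding inclusion_map_def by blast
qed

lemma inclusion_map_hom:
  assumes "S \<subseteq> T"
  shows "inclusion_map T \<in> hom (fundamental_group S x) (fundamental_group T x)"
proof (rule homI)
  fix \<gamma> assume "\<gamma> \<in> carrier (fundamental_group S x)"
  then obtain p where p: "\<gamma> = loop_class S p" "path p" "path_image p \<subseteq> S" "pathstart p = x" "pathfinish p = x"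
    by (rule fundamental_group_carrierE)
  then show "inclusion_map T \<gamma> \<in> carrier (fundamental_group T x)"
    using assms inclusion_map_loop_class[of p S T] by (auto intro!: fundamental_group_carrierI)
  fix \<delta> assume "\<delta> \<in> carrier (fundamental_group S x)"
  then obtain q where q: "\<delta> = loop_class S q" "path q" "path_image q \<subseteq> S" "pathstart q = x" "pathfinish q = x"
    by (rule fundamental_group_carrierE)
  have "inclusion_map T (\<gamma> \<otimes>\<^bsub>fundamental_group S x\<^esub> \<delta>) = loop_class T (p +++ q)"
    using p q assms by (simp add: fundamental_group_mult inclusion_map_loop_class path_image_join)
  also have "\<dots> = inclusion_map T \<gamma> \<otimes>\<^bsub>fundamental_group T x\<^esub> inclusion_map T \<delta>"
    using p q assms by (simp add: fundamental_group_mult inclusion_map_loop_class)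
  finally show "inclusion_map T (\<gamma> \<otimes>\<^bsub>fundamental_group S x\<^esub> \<delta>) =
      inclusion_map T \<gamma> \<otimes>\<^bsub>fundamental_group T x\<^esub> inclusion_map T \<delta>" .
qed

lemma hom_factor:
  assumes \<iota>: "\<iota> \<in> hom G G'" "\<iota> ` carrier G = carrier G'" and f: "f \<in> hom G K"
    and closed: "\<And>a b. a \<in> carrier G \<Longrightarrow> b \<in> carrier G \<Longrightarrow> a \<otimes>\<^bsub>G\<^esub> b \<in> carrier G"
    and fibres: "\<And>a b. a \<in> carrier G \<Longrightarrow> b \<in> carrier G \<Longrightarrow> \<iota> a = \<iota> b \<Longrightarrow> f a = f b"
  obtains h where "h \<in> hom G' K" "h \<in> extensional (carrier G')" "\<And>a. a \<in> carrier G \<Longrightarrow> h (\<iota> a) = f a"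
proof -
  define h where "h = (\<lambda>b\<in>carrier G'. f (inv_into (carrier G) \<iota> b))"
  have h: "h (\<iota> a) = f a" if "a \<in> carrier G" for a
  proof -
    have "\<iota> a \<in> \<iota> ` carrier G"
      using that by simp
    then have "f (inv_into (carrier G) \<iota> (\<iota> a)) = f a"
      by (intro fibres that inv_into_into f_inv_into_f)
    then show ?thesis
      using \<iota>(2) \<open>\<iota> a \<in> \<iota> ` carrier G\<close> by (simp add: h_def)
  qed
  have "h \<in> hom G' K"
  proof (rule homI)
    fix b assume "b \<in> carrier G'"
    then obtain a where a: "a \<in> carrier G" "b = \<iota> a"
      using \<iota>(2) by auto
    then show "h b \<in> carrier K"
      using h hom_in_carrier[OF f] by metis
    fix b' assume "b' \<in> carrier G'"
    then obtain a' where a': "a' \<in> carrier G" "b' = \<iota> a'"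
      using \<iota>(2) by auto
    have "h (b \<otimes>\<^bsub>G'\<^esub> b') = h (\<iota> (a \<otimes>\<^bsub>G\<^esub> a'))"
      using hom_mult[OF \<iota>(1)] a a' by simp
    also have "\<dots> = h b \<otimes>\<^bsub>K\<^esub> h b'"
      unfolding h[OF closed[OF a(1) a'(1)]] using hom_mult[OF f] a a' h by metis
    finally show "h (b \<otimes>\<^bsub>G'\<^esub> b') = h b \<otimes>\<^bsub>K\<^esub> h b'" .
  qed
  then show thesis
    using that h by (simp add: h_def)
qed

lemma hom_factor_ex1:
  assumes \<iota>: "\<iota> \<in> hom G G'" "\<iota> ` carrier G = carrier G'" and f: "f \<in> hom G K"
    and closed: "\<And>a b. a \<in> carrier G \<Longrightarrow> b \<in> carrier G \<Longrightarrow> a \<otimes>\<^bsub>G\<^esub> b \<in> carrier G"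
    and fibres: "\<And>a b. a \<in> carrier G \<Longrightarrow> b \<in> carrier G \<Longrightarrow> \<iota> a = \<iota> b \<Longrightarrow> f a = f b"
  shows "\<exists>!h. h \<in> hom G' K \<and> h \<in> extensional (carrier G') \<and> (\<forall>a\<in>carrier G. h (\<iota> a) = f a)"
proof -
  obtain h where h: "h \<in> hom G' K" "h \<in> extensional (carrier G')" "\<And>a. a \<in> carrier G \<Longrightarrow> h (\<iota> a) = f a"
    using hom_factor[OF assms] by blast
  show ?thesis
  proof (rule ex1I)
    show "h \<in> hom G' K \<and> h \<in> extensional (carrier G') \<and> (\<forall>a\<in>carrier G. h (\<iota> a) = f a)"
      using h by blast
    fix h' assume h': "h' \<in> hom G' K \<and> h' \<in> extensional (carrier G') \<and> (\<forall>a\<in>carrier G. h' (\<iota> a) = f a)"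
    show "h' = h"
    proof (rule extensionalityI)
      show "h' b = h b" if "b \<in> carrier G'" for b
        using that h(3) h' \<iota>(2) by (metis imageE)
    qed (use h h' in auto)
  qed
qed

context cell_complex
begin

lemma skeleton_1_loop_realization:
  assumes "\<gamma> \<in> carrier (fundamental_group (skeleton X 1) v)" "{v} \<in> X 0"
  obtains es where "edge_path X v es v" "\<gamma> = loop_class (skeleton X 1) (realization v es)"
proof -
  obtain p where p: "\<gamma> = loop_class (skeleton X 1) p" "path p" "path_image p \<subseteq> skeleton X 1"
    "pathstart p = v" "pathfinish p = v"
    using fundamental_group_carrierE[OF assms(1)] .
  obtain es where "edge_path X v es v" "homotopic_paths (skeleton X 1) p (realization v es)"
    using skeleton_1_path_homotopic_realization[OF p(2,3)] assms(2) unfolding p(4,5) by blast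
  then show thesis
    using that loop_class_eq_iff[of p] p by blast
qed

lemma realization_loop_class:
  assumes "edge_path X v es v"
  shows "loop_class (skeleton X 1) (realization v es) \<in> carrier (fundamental_group (skeleton X 1) v)"
    and "inclusion_map M (loop_class (skeleton X 1) (realization v es)) = loop_class M (realization v es)"
  using realization_path(1-3)[OF assms] realization_subset_skeleton_1[OF assms] skeleton_subset
  by (simp_all only: fundamental_group_carrierI inclusion_map_loop_class)

lemma inclusion_map_skeleton_1_surj:
  assumes "semilocally_simply_connected M" "{v} \<in> X 0"
  shows "inclusion_map M ` carrier (fundamental_group (skeleton X 1) v) = carrier (fundamental_group M v)"
proof
  show "inclusion_map M ` carrier (fundamental_group (skeleton X 1) v) \<subseteq> carrier (fundamental_group M v)"
    using hom_in_carrier[OF inclusion_map_hom[OF skeleton_subset]] by blast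
  show "carrier (fundamental_group M v) \<subseteq> inclusion_map M ` carrier (fundamental_group (skeleton X 1) v)"
  proof
    fix \<gamma> assume "\<gamma> \<in> carrier (fundamental_group M v)"
    then obtain p where p: "\<gamma> = loop_class M p" "path p" "path_image p \<subseteq> M" "pathstart p = v" "pathfinish p = v"
      by (rule fundamental_group_carrierE)
    obtain es where es: "edge_path X v es v" "homotopic_paths M p (realization v es)"
      using path_homotopic_realization[OF assms(1) p(2,3)] assms(2) unfolding p(4,5) by blast
    then have "\<gamma> = inclusion_map M (loop_class (skeleton X 1) (realization v es))"
      using p loop_class_eq_iff[of p M] realization_loop_class(2) by simp
    then show "\<gamma> \<in> inclusion_map M ` carrier (fundamental_group (skeleton X 1) v)"
      using realization_loop_class(1)[OF es(1)] by blast
  qed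
qed

end

section \<open>Extension of the holonomy\<close>

locale even_cpx_complex = cpx_complex N M X T \<Delta> \<kappa> n D
  for N :: "'n::finite itself" and M :: "'a::topological_space set" and X :: "nat \<Rightarrow> 'a set set"
    and T and \<Delta> :: "'a set \<Rightarrow> (real ^ 'n) set" and \<kappa> and n :: nat and D +
  fixes v0 :: 'a and col :: "'a set \<Rightarrow> nat"
  assumes even: "c \<in> X 2 \<Longrightarrow> even_sided X c" and base: "{v0} \<in> X 0"
    and col: "bij_betw col (regions {v0}) {1..n+1}"
begin

abbreviation w0 :: "'a set \<Rightarrow> nat" where
  "w0 \<equiv> restrict col (regions {v0})"

lemma base_coloring: "w0 \<in> colorings v0"
  using col by (simp add: colorings_def bij_betw_restrict_eq)

lemma holonomy_homotopic:
  assumes es: "edge_path X v0 es v0" "edge_path X v0 es' v0"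
    and homotopic: "homotopic_paths M (realization v0 es) (realization v0 es')"
  shows "holonomy v0 w0 es = holonomy v0 w0 es'"
proof -
  have "extendable (carrier_cell x)" if "x \<in> M" for x
    using extendable_cell[OF even carrier_cell(1)[OF that]] .
  then show ?thesis
    unfolding holonomy_def using transport_homotopic[OF order_refl _ es homotopic base_coloring] by simp
qed

lemma Hol1_realization:
  assumes es: "edge_path X v0 es v0"
  shows "Hol1 n X v0 col (loop_class (skeleton X 1) (realization v0 es)) = holonomy v0 w0 es"
  unfolding Hol1_def
proof (rule the_equality)
  note w = base_coloring
  have col_w: "transport n X ds col r = transport n X ds w0 r" "w0 r = col r"
    if "edge_path X v0 ds v0" "r \<in> regions {v0}" for ds r
    using transport_restrict[OF that] that(2) by simp_all
  have "realization v0 es \<in> loop_class (skeleton X 1) (realization v0 es)"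
    using realization_path[OF es] realization_subset_skeleton_1[OF es] by (simp add: loop_class_def)
  then show "holonomy v0 w0 es permutes {1..n+1} \<and>
      (\<exists>ds. edge_path X v0 ds v0 \<and> realization v0 ds \<in> loop_class (skeleton X 1) (realization v0 es) \<and>
        (\<forall>r\<in>regions {v0}. transport n X ds col r = holonomy v0 w0 es (col r)))"
    using holonomy[OF w es] es col_w by metis
  fix \<sigma> assume \<sigma>: "\<sigma> permutes {1..n+1} \<and>
      (\<exists>ds. edge_path X v0 ds v0 \<and> realization v0 ds \<in> loop_class (skeleton X 1) (realization v0 es) \<and>
        (\<forall>r\<in>regions {v0}. transport n X ds col r = \<sigma> (col r)))"
  then obtain ds where ds: "edge_path X v0 ds v0" "homotopic_paths (skeleton X 1) (realization v0 es) (realization v0 ds)"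
    "\<forall>r\<in>regions {v0}. transport n X ds col r = \<sigma> (col r)"
    by (auto simp: loop_class_def)
  have "\<sigma> = holonomy v0 w0 ds"
    using \<sigma> ds(1,3) col_w by (intro holonomy_eqI[OF w, symmetric]) auto
  also have "\<dots> = holonomy v0 w0 es"
    using holonomy_homotopic[OF es ds(1)] homotopic_paths_subset[OF ds(2) skeleton_subset] by simp
  finally show "\<sigma> = holonomy v0 w0 es" .
qed

lemma Hol1_hom: "Hol1 n X v0 col \<in> hom (fundamental_group (skeleton X 1) v0) (sym_group (n + 1))"
proof (rule homI)
  let ?S = "skeleton X 1"
  fix \<gamma> assume "\<gamma> \<in> carrier (fundamental_group ?S v0)"
  then obtain es where es: "edge_path X v0 es v0" "\<gamma> = loop_class ?S (realization v0 es)"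
    using skeleton_1_loop_realization base by blast
  then show "Hol1 n X v0 col \<gamma> \<in> carrier (sym_group (n + 1))"
    using Hol1_realization holonomy(1)[OF base_coloring] by (simp add: sym_group_def)
  fix \<delta> assume "\<delta> \<in> carrier (fundamental_group ?S v0)"
  then obtain es' where es': "edge_path X v0 es' v0" "\<delta> = loop_class ?S (realization v0 es')"
    using skeleton_1_loop_realization base by blast
  note r = realization_path[OF es(1)] realization_subset_skeleton_1[OF es(1)]
    and r' = realization_path[OF es'(1)] realization_subset_skeleton_1[OF es'(1)]
  have "\<gamma> \<otimes>\<^bsub>fundamental_group ?S v0\<^esub> \<delta> = loop_class ?S (realization v0 es +++ realization v0 es')"
    unfolding es(2) es'(2) using r r' by (intro fundamental_group_mult) simp_all
  also have "\<dots> = loop_class ?S (realization v0 (es @ es'))"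
    using realization_append[OF es(1) es'(1)] r r' by (subst loop_class_eq_iff) (simp_all add: path_image_join)
  finally show "Hol1 n X v0 col (\<gamma> \<otimes>\<^bsub>fundamental_group ?S v0\<^esub> \<delta>) =
      Hol1 n X v0 col \<gamma> \<otimes>\<^bsub>sym_group (n + 1)\<^esub> Hol1 n X v0 col \<delta>"
    using Hol1_realization[OF edge_path_append[OF es(1) es'(1)]] Hol1_realization[OF es(1)] Hol1_realization[OF es'(1)]
      holonomy_append[OF base_coloring es(1) es'(1)] es(2) es'(2) by (simp add: sym_group_def)
qed

lemma Hol1_eq_if_inclusion_map_eq:
  assumes "\<gamma> \<in> carrier (fundamental_group (skeleton X 1) v0)" "\<delta> \<in> carrier (fundamental_group (skeleton X 1) v0)"
    and "inclusion_map M \<gamma> = inclusion_map M \<delta>"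
  shows "Hol1 n X v0 col \<gamma> = Hol1 n X v0 col \<delta>"
proof -
  obtain es where es: "edge_path X v0 es v0" "\<gamma> = loop_class (skeleton X 1) (realization v0 es)"
    using skeleton_1_loop_realization[OF assms(1) base] .
  obtain es' where es': "edge_path X v0 es' v0" "\<delta> = loop_class (skeleton X 1) (realization v0 es')"
    using skeleton_1_loop_realization[OF assms(2) base] .
  have "homotopic_paths M (realization v0 es) (realization v0 es')"
    using assms(3) es es' realization_loop_class(2) loop_class_eq_iff[of "realization v0 es" M]
      realization_path(1)[OF es(1)] realization_subset_skeleton_1[OF es(1)] skeleton_subset by (metis order_trans)
  then show ?thesis
    using Hol1_realization es es' holonomy_homotopic by simp
qed

end

theorem proposition6:
  fixes M :: "'a::topological_space set"
    and A :: "('a set \<times> ('a \<Rightarrow> real ^ 'n::finite)) set"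
    and X :: "nat \<Rightarrow> 'a set set"
    and v0 :: 'a
    and col :: "'a set \<Rightarrow> nat"
  assumes "closed_smooth_manifold M A" and "connected M"
    and "cpx TYPE('n) M X"
    and "\<forall>c \<in> X 2. even_sided X c"
    and "{v0} \<in> X 0"
    and "bij_betw col (regions_at CARD('n) X {v0}) {1..CARD('n) + 1}"
  shows "\<exists>!H. H \<in> hom (fundamental_group M v0) (sym_group (CARD('n) + 1)) \<and>
              H \<in> extensional (carrier (fundamental_group M v0)) \<and>
              (\<forall>\<gamma> \<in> carrier (fundamental_group (skeleton X 1) v0).
                 H (inclusion_map M \<gamma>) = Hol1 CARD('n) X v0 col \<gamma>)"
proof -
  have hausdorff: "Hausdorff_space (top_of_set M)" and slsc: "semilocally_simply_connected M"
    using assms(1) smooth_atlas_imp_semilocally_simply_connected unfolding closed_smooth_manifold_def by blast+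
  obtain T \<kappa> D and \<Delta> :: "'a set \<Rightarrow> (real ^ 'n) set"
    where "cpx_complex TYPE('n) M X T \<Delta> \<kappa> CARD('n) D"
    using cpx_complex_exists[OF hausdorff assms(3)] by blast
  then interpret even_cpx_complex "TYPE('n)" M X T \<Delta> \<kappa> "CARD('n)" D v0 col
    using assms(4-6) by (simp add: even_cpx_complex_def even_cpx_complex_axioms_def)
  show ?thesis
  proof (rule hom_factor_ex1)
    show "inclusion_map M \<in> hom (fundamental_group (skeleton X 1) v0) (fundamental_group M v0)"
      by (rule inclusion_map_hom[OF skeleton_subset])
    show "inclusion_map M ` carrier (fundamental_group (skeleton X 1) v0) = carrier (fundamental_group M v0)"
      by (rule inclusion_map_skeleton_1_surj[OF slsc base])
  qed (fact Hol1_hom fundamental_group_m_closed Hol1_eq_if_inclusion_map_eq)+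
qed

end
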